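(* Let $(\mathcal A,\varphi)$ be a non-commutative $W^\star$-probability space. Let $\mathbb X,\mathbb Y\in\mathcal A$ be self-adjoint, positive, free, compactly supported and non-degenerate random variables. Define $$\mathbb U:=(\mathbb I+\mathbb X)^{-1/2}\,\mathbb Y\,(\mathbb I+\mathbb X)^{-1/2},\qquad \mathbb V:=(\mathbb I+\mathbb U)^{1/2}\,\mathbb X\,(\mathbb I+\mathbb U)^{1/2},$$ and assume that there exist constants $\bar\alpha,\bar\beta>0$ such that $$\varphi(\mathbb V\,|\,\mathbb U)=\bar\alpha\,\mathbb I,\qquad \varphi(\mathbb V^{-1}\,|\,\mathbb U)=\bar\beta\,\mathbb I.$$ Then $\bar\alpha\bar\beta>1$ and there exists $a>0$ such that $\mathbb X\sim f\mathcal K(\bar\alpha\gamma,\,a\gamma,\,\gamma)$ and $\mathbb Y\sim f\mathrm{Pois}(1/\gamma,\,a\gamma)$, where $\gamma=\bar\beta/(\bar\alpha\bar\beta-1)$.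
   Context: A $W^\star$-probability space is a pair $(\mathcal A,\varphi)$ with $\mathcal A$ a von Neumann algebra with unit $\mathbb I$ and $\varphi$ a faithful, normal, tracial, positive linear functional with $\varphi(\mathbb I)=1$. For self-adjoint $\mathbb X\in\mathcal A$, $\mathbb X\sim\mu$ means that $\mu$ is the $\star$-distribution of $\mathbb X$: the compactly supported probability measure on $\mathbb R$ with $\varphi(\mathbb X^n)=\int t^n\,d\mu(t)$ for all $n$. $\mathbb X$ is called positive if the support of $\mu$ is contained in $(0,\infty)$; non-degenerate means not a scalar multiple of $\mathbb I$. Freeness is in the sense of Voiculescu with respect to $\varphi$. For a von Neumann subalgebra $\mathcal B\subset\mathcal A$, $\varphi(\cdot|\mathcal B):\mathcal A\to\mathcal B$ is the conditional expectation, i.e. the unique faithful normal projection with $\varphi(\varphi(\cdot|\mathcal B))=\varphi(\cdot)$; $\varphi(\cdot|\mathbb U)$ is the one for $\mathcal B$ the von Neumann algebra generated by $\mathbb U$ (and $\mathbb I$). Free-Poisson distribution $f\mathrm{Pois}(\gamma,\lambda)$ (jump size $\gamma>0$, rate $\lambda>0$): the measure $\max\{0,1-\lambda\}\,\delta_0+\tilde\nu$, where $\tilde\nu$ is supported on $\left(\gamma(1-\sqrt\lambda)^2,\gamma(1+\sqrt\lambda)^2\right)$ and has there the density $\frac{1}{2\pi\gamma x}\sqrt{4\lambda\gamma^2-(x-\gamma(1+\lambda))^2}$. Free-Kummer distribution $f\mathcal K(\alpha,\beta,\gamma)$ (generic parameters): it is defined for $\alpha\ge 1$, $\beta\in\mathbb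 R$, $\gamma>0$ such that the system $$\gamma+\frac{\beta}{\sqrt{(s+1)(t+1)}}-\frac{\alpha-1}{\sqrt{st}}=0,\qquad \gamma\frac{s+t}{2}-\alpha+1+\beta-\frac{\beta}{\sqrt{(s+1)(t+1)}}=2$$ has a solution $0<s<t$ (which is the case whenever $\alpha>1$), and is the probability measure with density $$\frac{1}{2\pi}\sqrt{(x-s)(t-x)}\left(\frac{\alpha-1}{x\sqrt{st}}-\frac{\beta}{(1+x)\sqrt{(s+1)(t+1)}}\right)I_{(s,t)}(x).$$ *)

theory Defs
  imports "HOL-Probability.Probability"
begin

section \<open>Complex Hilbert spaces and bounded operators\<close>

text \<open>
  The complex inner product is conjugate-linear in its first argument. Positive definiteness,
  the norm and completeness are inherited from the underlying real Hilbert space.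
\<close>

class complex_hilbert_space = real_inner + complete_space +
  fixes scaleC :: "complex \<Rightarrow> 'a \<Rightarrow> 'a"  (infixr "*\<^sub>C" 75)
    and cinner :: "'a \<Rightarrow> 'a \<Rightarrow> complex"
  assumes scaleC_add_right: "c *\<^sub>C (x + y) = c *\<^sub>C x + c *\<^sub>C y"
    and scaleC_add_left: "(c + d) *\<^sub>C x = c *\<^sub>C x + d *\<^sub>C x"
    and scaleC_scaleC: "c *\<^sub>C d *\<^sub>C x = (c * d) *\<^sub>C x"
    and scaleR_eq_scaleC: "scaleR r x = complex_of_real r *\<^sub>C x"
    and cinner_commute: "cinner x y = cnj (cinner y x)"
    and cinner_add_left: "cinner (x + y) z = cinner x z + cinner y z"
    and cinner_scaleC_left: "cinner (c *\<^sub>C x) y = cnj c * cinner x y"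
    and inner_eq_Re_cinner: "inner x y = Re (cinner x y)"

lemma norm_scaleC: "norm (c *\<^sub>C x) = cmod c * norm x"
  for x :: "'a :: complex_hilbert_space"
proof -
  have "cinner (c *\<^sub>C x) (c *\<^sub>C x) = cnj c * cnj (cinner (c *\<^sub>C x) x)"
    by (metis cinner_scaleC_left cinner_commute)
  also have "\<dots> = (c * cnj c) * cnj (cinner x x)"
    by (simp add: cinner_scaleC_left)
  finally have "inner (c *\<^sub>C x) (c *\<^sub>C x) = (cmod c)\<^sup>2 * inner x x"
    by (simp add: inner_eq_Re_cinner complex_norm_square [symmetric])
  then show ?thesis
    by (simp add: norm_eq_sqrt_inner real_sqrt_mult)
qed

text \<open>
  The library type \<open>'h \<Rightarrow>\<^sub>L 'h\<close> consists of the bounded real-linear maps; the bounded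
  operators on the complex Hilbert space are those satisfying \<open>clinear_op\<close>.
\<close>

type_synonym 'h op = "'h \<Rightarrow>\<^sub>L 'h"

definition clinear_op :: "'h::complex_hilbert_space op \<Rightarrow> bool" where
  "clinear_op T \<longleftrightarrow> (\<forall>c x. blinfun_apply T (c *\<^sub>C x) = c *\<^sub>C blinfun_apply T x)"

lift_definition op_scaleC :: "complex \<Rightarrow> 'h::complex_hilbert_space op \<Rightarrow> 'h op"
  is "\<lambda>c T x. c *\<^sub>C T x"
proof -
  fix c :: complex and T :: "'h \<Rightarrow> 'h"
  assume "bounded_linear T"
  moreover have "bounded_linear (\<lambda>x :: 'h. c *\<^sub>C x)"
    by (rule bounded_linear_intro [where K = "cmod c"])
      (simp_all add: scaleC_add_right scaleR_eq_scaleC scaleC_scaleC norm_scaleC mult.commute)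
  ultimately show "bounded_linear (\<lambda>x. c *\<^sub>C T x)"
    using bounded_linear_compose by blast
qed

definition adjoint_ops :: "'h::complex_hilbert_space op \<Rightarrow> 'h op \<Rightarrow> bool" where
  "adjoint_ops S T \<longleftrightarrow>
     (\<forall>x y. cinner (blinfun_apply S x) y = cinner x (blinfun_apply T y))"

definition self_adjoint :: "'h::complex_hilbert_space op \<Rightarrow> bool" where
  "self_adjoint T \<longleftrightarrow> clinear_op T \<and> adjoint_ops T T"

definition nonneg_op :: "'h::complex_hilbert_space op \<Rightarrow> bool" where
  "nonneg_op T \<longleftrightarrow> clinear_op T \<and> (\<forall>x. cinner x (blinfun_apply T x) \<in> nonneg_Reals)"

definition op_le :: "'h::complex_hilbert_space op \<Rightarrow> 'h op \<Rightarrow> bool" where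
  "op_le S T \<longleftrightarrow> nonneg_op (T - S)"

definition op_power :: "'h::complex_hilbert_space op \<Rightarrow> nat \<Rightarrow> 'h op" where
  "op_power T n = ((o\<^sub>L) T ^^ n) id_blinfun"

definition op_inverse :: "'h::complex_hilbert_space op \<Rightarrow> 'h op" where
  "op_inverse T = (THE S. S o\<^sub>L T = id_blinfun \<and> T o\<^sub>L S = id_blinfun)"

definition op_sqrt :: "'h::complex_hilbert_space op \<Rightarrow> 'h op" where
  "op_sqrt T = (THE S. nonneg_op S \<and> S o\<^sub>L S = T)"


section \<open>Von Neumann algebras and W*-probability spaces\<close>

definition commutant :: "'h::complex_hilbert_space op set \<Rightarrow> 'h op set" where
  "commutant A = {T. clinear_op T \<and> (\<forall>S\<in>A. T o\<^sub>L S = S o\<^sub>L T)}"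

definition von_neumann_algebra :: "'h::complex_hilbert_space op set \<Rightarrow> bool" where
  "von_neumann_algebra A \<longleftrightarrow>
     (\<forall>S\<in>A. \<exists>T\<in>A. adjoint_ops S T) \<and> commutant (commutant A) = A"

definition generated_von_neumann_algebra ::
    "'h::complex_hilbert_space op set \<Rightarrow> 'h op set" where
  "generated_von_neumann_algebra S = von_neumann_algebra hull S"

text \<open>
  \<open>x\<close> is the supremum in \<open>A\<close> of the bounded increasing net \<open>D\<close> of self-adjoint elements of
  \<open>A\<close>, nets being represented by upward directed sets.
\<close>

definition directed_sup ::
    "'h::complex_hilbert_space op set \<Rightarrow> 'h op set \<Rightarrow> 'h op \<Rightarrow> bool" where
  "directed_sup A D x \<longleftrightarrow>
     D \<noteq> {} \<and> D \<subseteq> A \<and> (\<forall>d\<in>D. self_adjoint d) \<and>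
     (\<forall>d\<in>D. \<forall>d'\<in>D. \<exists>e\<in>D. op_le d e \<and> op_le d' e) \<and>
     x \<in> A \<and> (\<forall>d\<in>D. op_le d x) \<and>
     (\<forall>y\<in>A. (\<forall>d\<in>D. op_le d y) \<longrightarrow> op_le x y)"

locale W_star_probability_space =
  fixes A :: "'h::complex_hilbert_space op set"
    and \<phi> :: "'h op \<Rightarrow> complex"
  assumes von_neumann: "von_neumann_algebra A"
    and state_add: "S \<in> A \<Longrightarrow> T \<in> A \<Longrightarrow> \<phi> (S + T) = \<phi> S + \<phi> T"
    and state_scale: "T \<in> A \<Longrightarrow> \<phi> (op_scaleC c T) = c * \<phi> T"
    and state_unit: "\<phi> id_blinfun = 1"
    and state_nonneg: "T \<in> A \<Longrightarrow> nonneg_op T \<Longrightarrow> \<phi> T \<in> nonneg_Reals"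
    and state_faithful: "T \<in> A \<Longrightarrow> nonneg_op T \<Longrightarrow> \<phi> T = 0 \<Longrightarrow> T = 0"
    and state_tracial: "S \<in> A \<Longrightarrow> T \<in> A \<Longrightarrow> \<phi> (S o\<^sub>L T) = \<phi> (T o\<^sub>L S)"
    and state_normal: "directed_sup A D x \<Longrightarrow> Re (\<phi> x) = (SUP d\<in>D. Re (\<phi> d))"

text \<open>
  \<open>E\<close> is the conditional expectation of \<open>(A, \<phi>)\<close> onto the von Neumann subalgebra \<open>B\<close>, i.e. the
  \<open>\<phi>\<close>-preserving faithful normal (positive linear) projection of \<open>A\<close> onto \<open>B\<close>. The
  \<open>B\<close>-bimodule property is a consequence (Tomiyama). Values of \<open>E\<close> outside \<open>A\<close> are irrelevant.
\<close>

locale conditional_expectation = W_star_probability_space A \<phi>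
  for A :: "'h::complex_hilbert_space op set" and \<phi> :: "'h op \<Rightarrow> complex" +
  fixes B :: "'h op set" and E :: "'h op \<Rightarrow> 'h op"
  assumes sub_von_neumann: "von_neumann_algebra B"
    and subalgebra: "B \<subseteq> A"
    and cexp_add: "S \<in> A \<Longrightarrow> T \<in> A \<Longrightarrow> E (S + T) = E S + E T"
    and cexp_scale: "T \<in> A \<Longrightarrow> E (op_scaleC c T) = op_scaleC c (E T)"
    and cexp_range: "T \<in> A \<Longrightarrow> E T \<in> B"
    and cexp_id: "T \<in> B \<Longrightarrow> E T = T"
    and cexp_nonneg: "T \<in> A \<Longrightarrow> nonneg_op T \<Longrightarrow> nonneg_op (E T)"
    and cexp_faithful: "T \<in> A \<Longrightarrow> nonneg_op T \<Longrightarrow> E T = 0 \<Longrightarrow> T = 0"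
    and cexp_normal: "directed_sup A D x \<Longrightarrow> directed_sup B (E ` D) (E x)"
    and cexp_preserves: "T \<in> A \<Longrightarrow> \<phi> (E T) = \<phi> T"


section \<open>Freeness\<close>

definition unital_star_algebra :: "'h::complex_hilbert_space op set \<Rightarrow> bool" where
  "unital_star_algebra A \<longleftrightarrow>
     (\<forall>T\<in>A. clinear_op T) \<and> id_blinfun \<in> A \<and>
     (\<forall>S\<in>A. \<forall>T\<in>A. S + T \<in> A \<and> S o\<^sub>L T \<in> A) \<and>
     (\<forall>c. \<forall>T\<in>A. op_scaleC c T \<in> A) \<and>
     (\<forall>S\<in>A. \<exists>T\<in>A. adjoint_ops S T)"

text \<open>
  \<open>\<phi> (a\<^sub>1 \<cdots> a\<^sub>n) = 0\<close> whenever \<open>n \<ge> 1\<close>, \<open>a\<^sub>j \<in> \<A> i\<^sub>j\<close>, \<open>\<phi> a\<^sub>j = 0\<close> and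
  \<open>i\<^sub>1 \<noteq> i\<^sub>2 \<noteq> \<dots> \<noteq> i\<^sub>n\<close>; the list \<open>w\<close> consists of the pairs \<open>(i\<^sub>j, a\<^sub>j)\<close>.
\<close>

definition free_algebras ::
    "('h::complex_hilbert_space op \<Rightarrow> complex) \<Rightarrow> ('i \<Rightarrow> 'h op set) \<Rightarrow> bool" where
  "free_algebras \<phi> \<A> \<longleftrightarrow>
     (\<forall>w. w \<noteq> [] \<and> successively (\<lambda>p q. fst p \<noteq> fst q) w \<and>
          (\<forall>(i, a) \<in> set w. a \<in> \<A> i \<and> \<phi> a = 0) \<longrightarrow>
          \<phi> (foldr (o\<^sub>L) (map snd w) id_blinfun) = 0)"

definition free_variables ::
    "('h::complex_hilbert_space op \<Rightarrow> complex) \<Rightarrow> 'h op \<Rightarrow> 'h op \<Rightarrow> bool" where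
  "free_variables \<phi> X Y \<longleftrightarrow>
     free_algebras \<phi> (\<lambda>i::bool. unital_star_algebra hull {if i then X else Y})"


section \<open>Distributions of self-adjoint variables\<close>

definition has_distribution ::
    "('h::complex_hilbert_space op \<Rightarrow> complex) \<Rightarrow> 'h op \<Rightarrow> real measure \<Rightarrow> bool" where
  "has_distribution \<phi> X \<mu> \<longleftrightarrow>
     prob_space \<mu> \<and> sets \<mu> = sets borel \<and>
     (\<exists>K. compact K \<and> emeasure \<mu> (- K) = 0) \<and>
     (\<forall>n. \<phi> (op_power X n) = complex_of_real (\<integral>t. t ^ n \<partial>\<mu>))"

definition measure_support :: "real measure \<Rightarrow> real set" where
  "measure_support \<mu> = {x. \<forall>G. open G \<and> x \<in> G \<longrightarrow> emeasure \<mu> G > 0}"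

definition positive_variable ::
    "('h::complex_hilbert_space op \<Rightarrow> complex) \<Rightarrow> 'h op \<Rightarrow> bool" where
  "positive_variable \<phi> X \<longleftrightarrow> (\<exists>\<mu>. has_distribution \<phi> X \<mu> \<and> measure_support \<mu> \<subseteq> {0<..})"

definition non_degenerate :: "'h::complex_hilbert_space op \<Rightarrow> bool" where
  "non_degenerate X \<longleftrightarrow> (\<nexists>c. X = op_scaleC c id_blinfun)"


section \<open>Free-Poisson and free-Kummer distributions\<close>

text \<open>\<open>\<gamma>\<close> is the jump size and \<open>\<rho>\<close> the rate.\<close>

definition free_Poisson_density :: "real \<Rightarrow> real \<Rightarrow> real \<Rightarrow> real" where
  "free_Poisson_density \<gamma> \<rho> x =
     1 / (2 * pi * \<gamma> * x) * sqrt (4 * \<rho> * \<gamma>\<^sup>2 - (x - \<gamma> * (1 + \<rho>))\<^sup>2)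
       * indicator {\<gamma> * (1 - sqrt \<rho>)\<^sup>2 <..< \<gamma> * (1 + sqrt \<rho>)\<^sup>2} x"

definition free_Poisson :: "real \<Rightarrow> real \<Rightarrow> real measure" where
  "free_Poisson \<gamma> \<rho> =
     measure_of UNIV (sets borel)
       (\<lambda>B. ennreal (max 0 (1 - \<rho>)) * emeasure (return borel 0) B
            + emeasure (density lborel (\<lambda>x. ennreal (free_Poisson_density \<gamma> \<rho> x))) B)"

text \<open>\<open>measure_of\<close> falls back to the zero measure on functions that are not measures; it does not here.\<close>

lemma sets_free_Poisson [simp]: "sets (free_Poisson \<gamma> \<rho>) = sets borel"
  unfolding free_Poisson_def using sets.sigma_sets_eq [of "borel :: real measure"] by simp

lemma emeasure_free_Poisson:
  assumes B: "B \<in> sets borel"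
  shows "emeasure (free_Poisson \<gamma> \<rho>) B =
     ennreal (max 0 (1 - \<rho>)) * indicator B 0
       + (\<integral>\<^sup>+x\<in>B. ennreal (free_Poisson_density \<gamma> \<rho> x) \<partial>lborel)"
proof -
  let ?c = "ennreal (max 0 (1 - \<rho>))"
    and ?D = "density lborel (\<lambda>x. ennreal (free_Poisson_density \<gamma> \<rho> x))"
  let ?m = "\<lambda>B. ?c * emeasure (return borel 0) B + emeasure ?D B"
  have "countably_additive (sets borel) ?m"
    unfolding countably_additive_def
  proof safe
    fix F :: "nat \<Rightarrow> real set"
    assume F: "range F \<subseteq> sets borel" "disjoint_family F"
    have "(\<Sum>i. ?m (F i)) = ?c * (\<Sum>i. emeasure (return borel 0) (F i)) + (\<Sum>i. emeasure ?D (F i))"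
      by (subst suminf_add [symmetric]) (auto intro!: summableI simp: ennreal_suminf_cmult)
    also have "\<dots> = ?m (\<Union>i. F i)"
      using F by (simp add: suminf_emeasure del: emeasure_return)
    finally show "(\<Sum>i. ?m (F i)) = ?m (\<Union>i. F i)" .
  qed
  moreover have "sigma_algebra UNIV (sets (borel :: real measure))"
    using sets.sigma_algebra_axioms [of "borel :: real measure"] by simp
  ultimately have "emeasure (free_Poisson \<gamma> \<rho>) B = ?m B"
    unfolding free_Poisson_def
    by (intro emeasure_measure_of_sigma) (use B in \<open>auto simp: positive_def\<close>)
  moreover have "(\<lambda>x. ennreal (free_Poisson_density \<gamma> \<rho> x)) \<in> borel_measurable borel"
    unfolding free_Poisson_density_def by measurable
  ultimately show ?thesis
    using B by (simp add: emeasure_density)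
qed

definition free_Kummer_system :: "real \<Rightarrow> real \<Rightarrow> real \<Rightarrow> real \<Rightarrow> real \<Rightarrow> bool" where
  "free_Kummer_system \<alpha> \<beta> \<gamma> s t \<longleftrightarrow>
     0 < s \<and> s < t \<and>
     \<gamma> + \<beta> / sqrt ((s + 1) * (t + 1)) - (\<alpha> - 1) / sqrt (s * t) = 0 \<and>
     \<gamma> * ((s + t) / 2) - \<alpha> + 1 + \<beta> - \<beta> / sqrt ((s + 1) * (t + 1)) = 2"

definition free_Kummer_density :: "real \<Rightarrow> real \<Rightarrow> real \<Rightarrow> real \<Rightarrow> real \<Rightarrow> real" where
  "free_Kummer_density \<alpha> \<beta> s t x =
     1 / (2 * pi) * sqrt ((x - s) * (t - x))
       * ((\<alpha> - 1) / (x * sqrt (s * t)) - \<beta> / ((1 + x) * sqrt ((s + 1) * (t + 1))))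
       * indicator {s<..<t} x"

text \<open>
  A predicate rather than a function of the parameters, as the distribution exists only for
  parameters for which the system is solvable.
\<close>

definition is_free_Kummer :: "real \<Rightarrow> real \<Rightarrow> real \<Rightarrow> real measure \<Rightarrow> bool" where
  "is_free_Kummer \<alpha> \<beta> \<gamma> \<mu> \<longleftrightarrow>
     \<alpha> \<ge> 1 \<and> \<gamma> > 0 \<and>
     (\<exists>s t. free_Kummer_system \<alpha> \<beta> \<gamma> s t \<and>
            \<mu> = density lborel (\<lambda>x. ennreal (free_Kummer_density \<alpha> \<beta> s t x)))"

end

theory Submission
  imports Defs "HOL-Computational_Algebra.Polynomial"
begin

text \<open>
  Put \<open>W = (1 + X)\<^sup>-\<^sup>1\<close>. For negative reals \<open>\<omega>\<close> and \<open>w\<close> such that \<open>(1 - \<omega> W)\<^sup>-\<^sup>1\<close> and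
  \<open>(1 - w Y)\<^sup>-\<^sup>1\<close> have the same trace \<open>P\<close>, and for \<open>z = \<omega> w P / (P - 1)\<close>, freeness shows that
  \<open>(1 - z W Y)\<^sup>-\<^sup>1\<close> and \<open>(1 - \<omega> W)\<^sup>-\<^sup>1\<close> pair equally with functions of \<open>X\<close> (subordination). Since \<open>U\<close>
  is similar to \<open>W Y\<close>, the two regression conditions, tested against the resolvent of \<open>U\<close>, become two
  scalar equations in \<open>\<omega>\<close>, \<open>z\<close>, \<open>P\<close>. They combine to \<open>\<omega> = z (c + g P)\<close> with
  \<open>g = (\<alpha> \<beta> - 1) / \<beta>\<close>, which yields separate quadratic equations for the Cauchy transforms of \<open>X\<close> and
  of \<open>Y\<close>. The equation for \<open>Y\<close> is that of a free Poisson law, and \<open>g > 0\<close> because \<open>g\<close> times the mean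
  of \<open>Y\<close> is its variance. The discriminant of the equation for \<open>X\<close> is a quartic that must have a
  double root, and its two other roots are the end points of the support of the free Kummer law. Using
  all negative parameters, and convergence in the norm of the trace only, avoids analytic continuation.
\<close>


section \<open>Operators on a complex Hilbert space\<close>

text \<open>Equal traces and the special \<open>z\<close> have one purpose. Let \<open>p\<close>,
  \<open>q\<close> be the two resolvents of trace \<open>P\<close>. Then
  \<open>p (1 - z W Y) q\<close> has no part linear in \<open>p - P\<close> or \<open>q - P\<close>;
  it is a constant plus a multiple of \<open>(p - P) (q - P)\<close>. Inverting it produces powers
  of that product, which are alternating words. By freeness their trace norms are exactly geometric,
  and \<open>tr (p p) < P\<close> keeps the ratio below 1 for all negative parameters. Three
  obstacles shape the rest. The laws of \<open>X\<close> and \<open>Y\<close> are known by moments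
  only, so operator positivity and resolvent integrals come from polynomial approximation and
  Cauchy-Schwarz. The bimodule property of \<open>E\<close> is not among its axioms; as
  \<open>E V\<close> and \<open>E (op_inverse V)\<close> are scalars, what is used of it is
  orthogonality, obtained from contractivity in the trace norm. Freeness speaks of polynomials, so
  the elements paired with the resolvent of \<open>W Y\<close> stay in norm closures of real
  polynomials. The constant \<open>c\<close> is
  \<open>(1 + tr (X^-1)) / \<beta> - (tr X + 1)\<close>.\<close>

instance complex_hilbert_space \<subseteq> banach ..

text \<open>The library infix \<open>o\<^sub>L\<close> binds more weakly than \<open>+\<close>.\<close>

notation blinfun_compose (infixl "\<circ>\<^sub>L" 70)

lemmas comp_add_left = bounded_bilinear.add_left [OF bounded_bilinear_blinfun_compose]
  and comp_add_right = bounded_bilinear.add_right [OF bounded_bilinear_blinfun_compose]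
  and comp_diff_left = bounded_bilinear.diff_left [OF bounded_bilinear_blinfun_compose]
  and comp_diff_right = bounded_bilinear.diff_right [OF bounded_bilinear_blinfun_compose]
  and comp_minus_left = bounded_bilinear.minus_left [OF bounded_bilinear_blinfun_compose]
  and comp_minus_right = bounded_bilinear.minus_right [OF bounded_bilinear_blinfun_compose]
  and comp_scaleR_left = bounded_bilinear.scaleR_left [OF bounded_bilinear_blinfun_compose]
  and comp_scaleR_right = bounded_bilinear.scaleR_right [OF bounded_bilinear_blinfun_compose]
  and tendsto_comp = bounded_bilinear.tendsto [OF bounded_bilinear_blinfun_compose]
  and comp_sum_left = bounded_bilinear.sum_left [OF bounded_bilinear_blinfun_compose]
  and comp_sum_right = bounded_bilinear.sum_right [OF bounded_bilinear_blinfun_compose]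

lemma comp_assoc: "(a \<circ>\<^sub>L b) \<circ>\<^sub>L c = a \<circ>\<^sub>L (b \<circ>\<^sub>L c)"
  by (rule blinfun_eqI) simp

lemma comp_id [simp]: "a \<circ>\<^sub>L id_blinfun = a" "id_blinfun \<circ>\<^sub>L a = a"
  by (rule blinfun_eqI, simp)+

lemma comp_cong_left: "a \<circ>\<^sub>L b = c \<Longrightarrow> a \<circ>\<^sub>L (b \<circ>\<^sub>L d) = c \<circ>\<^sub>L d"
  by (auto simp: comp_assoc)

lemmas comp_ring = comp_add_left comp_add_right comp_diff_left comp_diff_right
  comp_minus_left comp_minus_right comp_scaleR_left comp_scaleR_right comp_assoc

lemma cinner_add_right: "cinner x (y + z) = cinner x y + cinner x z"
  for x :: "'h::complex_hilbert_space"
  by (metis cinner_add_left cinner_commute complex_cnj_add)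

lemma cinner_scaleC_right: "cinner x (c *\<^sub>C y) = c * cinner x y"
  for x :: "'h::complex_hilbert_space"
  by (metis cinner_scaleC_left cinner_commute complex_cnj_cnj complex_cnj_mult)

lemma Im_cinner: "Im (cinner x y) = inner (\<i> *\<^sub>C x) y"
  for x :: "'h::complex_hilbert_space"
  by (simp add: inner_eq_Re_cinner cinner_scaleC_left)

lemma cinner_eq_inner: "cinner x y = Complex (inner x y) (inner (\<i> *\<^sub>C x) y)"
  for x :: "'h::complex_hilbert_space"
  by (simp add: complex_eq_iff Im_cinner inner_eq_Re_cinner)

lemma op_scaleC_of_real: "op_scaleC (complex_of_real r) T = r *\<^sub>R T"
  by (rule blinfun_eqI) (simp add: op_scaleC.rep_eq scaleR_eq_scaleC blinfun.scaleR_left)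

subsection \<open>Complex linearity and adjoints\<close>

lemma clinear_opI: "(\<And>c x. T (c *\<^sub>C x) = c *\<^sub>C T x) \<Longrightarrow> clinear_op T"
  for T :: "'h::complex_hilbert_space op"
  by (simp add: clinear_op_def)

lemma clinear_opD: "clinear_op T \<Longrightarrow> T (c *\<^sub>C x) = c *\<^sub>C T x"
  for T :: "'h::complex_hilbert_space op"
  by (simp add: clinear_op_def)

lemma scaleC_zero_right [simp]: "c *\<^sub>C (0 :: 'h::complex_hilbert_space) = 0"
  using scaleC_add_right[of c "0 :: 'h" 0] by simp

lemma scaleC_scaleR: "c *\<^sub>C (r *\<^sub>R x) = r *\<^sub>R (c *\<^sub>C x)"
  for x :: "'h::complex_hilbert_space"
  by (simp add: scaleR_eq_scaleC scaleC_scaleC mult.commute)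

lemma scaleC_minus_right: "c *\<^sub>C (- x) = - (c *\<^sub>C x)"
  for x :: "'h::complex_hilbert_space"
  using scaleC_scaleR[of c "-1" x] by simp

lemma clinear_id [simp]: "clinear_op id_blinfun"
  and clinear_zero [simp]: "clinear_op 0"
  by (auto simp: clinear_op_def)

lemma scaleC_diff_right: "c *\<^sub>C (x - y) = c *\<^sub>C x - c *\<^sub>C y"
  for x :: "'h::complex_hilbert_space"
  using scaleC_add_right[of c x "- y"] by (simp add: scaleC_minus_right)

lemma clinear_add: "clinear_op S \<Longrightarrow> clinear_op T \<Longrightarrow> clinear_op (S + T)"
  and clinear_diff: "clinear_op S \<Longrightarrow> clinear_op T \<Longrightarrow> clinear_op (S - T)"
  and clinear_comp: "clinear_op S \<Longrightarrow> clinear_op T \<Longrightarrow> clinear_op (S \<circ>\<^sub>L T)"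
  and clinear_scaleR: "clinear_op S \<Longrightarrow> clinear_op (r *\<^sub>R S)"
  by (simp_all add: clinear_op_def blinfun.bilinear_simps scaleC_add_right scaleC_scaleR
      scaleC_diff_right)

lemma clinear_scaleC: "clinear_op S \<Longrightarrow> clinear_op (op_scaleC c S)"
  by (simp add: clinear_op_def op_scaleC.rep_eq scaleC_scaleC mult.commute)

lemma clinear_limit:
  assumes "\<And>n. clinear_op (f n)" "f \<longlonglongrightarrow> T"
  shows "clinear_op T"
proof (rule clinear_opI)
  fix c x
  have "bounded_linear (\<lambda>x :: 'a. c *\<^sub>C x)"
    by (rule bounded_linear_intro [where K = "cmod c"])
      (simp_all add: scaleC_add_right scaleC_scaleR norm_scaleC mult.commute)
  then have "(\<lambda>n. c *\<^sub>C f n x) \<longlonglongrightarrow> c *\<^sub>C T x"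
    using assms(2) by (intro bounded_linear.tendsto[of "\<lambda>x. c *\<^sub>C x"] blinfun.tendsto tendsto_const)
  moreover have "(\<lambda>n. f n (c *\<^sub>C x)) \<longlonglongrightarrow> T (c *\<^sub>C x)"
    using assms(2) by (intro blinfun.tendsto tendsto_const)
  moreover have "f n (c *\<^sub>C x) = c *\<^sub>C f n x" for n
    using assms(1) by (simp add: clinear_opD)
  ultimately show "T (c *\<^sub>C x) = c *\<^sub>C T x"
    using LIMSEQ_unique by simp blast
qed

lemma adjoint_ops_inner: "adjoint_ops S T \<Longrightarrow> inner (S x) y = inner x (T y)"
  for S T :: "'h::complex_hilbert_space op"
  by (simp add: adjoint_ops_def inner_eq_Re_cinner)

lemma adjoint_opsI:
  fixes S T :: "'h::complex_hilbert_space op"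
  assumes "clinear_op S" "\<And>x y. inner (S x) y = inner x (T y)"
  shows "adjoint_ops S T"
  using assms by (simp add: adjoint_ops_def cinner_eq_inner flip: clinear_opD)

lemma adjoint_ops_commute: "adjoint_ops S T \<Longrightarrow> adjoint_ops T S"
  unfolding adjoint_ops_def by (metis cinner_commute)

lemma adjoint_ops_comp: "adjoint_ops S S' \<Longrightarrow> adjoint_ops T T' \<Longrightarrow> adjoint_ops (S \<circ>\<^sub>L T) (T' \<circ>\<^sub>L S')"
  by (simp add: adjoint_ops_def)

lemma adjoint_ops_id: "adjoint_ops id_blinfun id_blinfun"
  by (simp add: adjoint_ops_def)

lemma self_adjoint_iff:
  "self_adjoint T \<longleftrightarrow> clinear_op T \<and> (\<forall>x y. inner (T x) y = inner x (T y))"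
  for T :: "'h::complex_hilbert_space op"
  unfolding self_adjoint_def using adjoint_opsI adjoint_ops_inner by blast

lemma self_adjointD: "self_adjoint T \<Longrightarrow> inner (T x) y = inner x (T y)"
  for T :: "'h::complex_hilbert_space op"
  by (simp add: self_adjoint_iff)

lemma self_adjoint_clinear: "self_adjoint T \<Longrightarrow> clinear_op T"
  by (simp add: self_adjoint_def)

lemma self_adjoint_id [simp]: "self_adjoint id_blinfun"
  and self_adjoint_zero [simp]: "self_adjoint 0"
  by (auto simp: self_adjoint_iff)

lemma self_adjoint_add: "self_adjoint S \<Longrightarrow> self_adjoint T \<Longrightarrow> self_adjoint (S + T)"
  and self_adjoint_diff: "self_adjoint S \<Longrightarrow> self_adjoint T \<Longrightarrow> self_adjoint (S - T)"
  and self_adjoint_scaleR: "self_adjoint S \<Longrightarrow> self_adjoint (r *\<^sub>R S)"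
  by (auto simp: self_adjoint_iff blinfun.bilinear_simps inner_add_left inner_add_right
      inner_diff_left inner_diff_right clinear_add clinear_diff clinear_scaleR)

lemma self_adjoint_comp:
  "self_adjoint S \<Longrightarrow> self_adjoint T \<Longrightarrow> S \<circ>\<^sub>L T = T \<circ>\<^sub>L S \<Longrightarrow> self_adjoint (S \<circ>\<^sub>L T)"
  unfolding self_adjoint_iff
  by (metis blinfun_apply_blinfun_compose clinear_comp)

lemma self_adjoint_square: "self_adjoint S \<Longrightarrow> self_adjoint (S \<circ>\<^sub>L S)"
  by (simp add: self_adjoint_comp)

lemma self_adjoint_limit:
  assumes "\<And>n. self_adjoint (f n)" "f \<longlonglongrightarrow> T"
  shows "self_adjoint T"
  unfolding self_adjoint_iff
proof (intro conjI allI)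
  show "clinear_op T"
    using assms clinear_limit self_adjoint_clinear by blast
  fix x y
  have "(\<lambda>n. inner (f n x) y) \<longlonglongrightarrow> inner (T x) y" "(\<lambda>n. inner x (f n y)) \<longlonglongrightarrow> inner x (T y)"
    using assms(2) by (auto intro!: tendsto_intros blinfun.tendsto)
  then show "inner (T x) y = inner x (T y)"
    using assms(1) LIMSEQ_unique by (simp add: self_adjointD) blast
qed

text \<open>Polarisation expresses \<open>inner x (T y)\<close> by the quadratic form at
  \<open>x + y\<close> and \<open>x - y\<close>, and the parallelogram law adds up the two bounds.
  Testing with \<open>y\<close> along \<open>T x\<close>, scaled to the length of \<open>x\<close>,
  turns this into a bound of \<open>norm (T x)\<close>.\<close>

lemma self_adjoint_norm_le:
  fixes T :: "'h::complex_hilbert_space op"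
  assumes "self_adjoint T" "\<And>x. \<bar>inner x (T x)\<bar> \<le> c * (norm x)\<^sup>2" "0 \<le> c"
  shows "norm T \<le> c"
proof (rule norm_blinfun_bound)
  fix x
  have *: "inner x (T y) \<le> c / 2 * ((norm x)\<^sup>2 + (norm y)\<^sup>2)" for x y
  proof -
    have "4 * inner x (T y) = inner (x + y) (T (x + y)) - inner (x - y) (T (x - y))"
      using self_adjointD[OF assms(1), of x y]
      by (simp add: blinfun.bilinear_simps inner_add_left inner_add_right
          inner_diff_left inner_diff_right inner_commute)
    also have "\<dots> \<le> c * (norm (x + y))\<^sup>2 + c * (norm (x - y))\<^sup>2"
      using assms(2)[of "x + y"] assms(2)[of "x - y"] by linarith
    also have "\<dots> = 2 * c * ((norm x)\<^sup>2 + (norm y)\<^sup>2)"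
      by (simp add: power2_norm_eq_inner inner_add_left inner_add_right
          inner_diff_left inner_diff_right inner_commute algebra_simps)
    finally show ?thesis by simp
  qed
  show "norm (T x) \<le> c * norm x"
  proof (cases "T x = 0 \<or> x = 0")
    case False
    define y where "y = (norm x / norm (T x)) *\<^sub>R T x"
    have "norm x * norm (T x) = inner y (T x)"
      using False by (simp add: y_def power2_norm_eq_inner [symmetric] power2_eq_square)
    also have "\<dots> \<le> c / 2 * ((norm y)\<^sup>2 + (norm x)\<^sup>2)"
      by (rule *)
    also have "norm y = norm x"
      using False by (simp add: y_def)
    finally have "norm x * norm (T x) \<le> norm x * (c * norm x)"
      by (simp add: power2_eq_square algebra_simps)
    then show ?thesis
      using False by (simp add: mult_le_cancel_left)
  qed (use assms(3) in \<open>auto simp: blinfun.zero_right\<close>)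
qed (fact assms)

subsection \<open>Nonnegative operators\<close>

text \<open>On a complex Hilbert space a real quadratic form forces self-adjointness, by polarisation
  with \<open>x + y\<close> and \<open>\<i> x + y\<close>.\<close>

lemma nonneg_op_iff:
  "nonneg_op T \<longleftrightarrow> self_adjoint T \<and> (\<forall>x. 0 \<le> inner x (T x))"
  for T :: "'h::complex_hilbert_space op"
proof
  assume T: "nonneg_op T"
  then have cl: "clinear_op T" and nn: "\<And>x. cinner x (T x) \<in> nonneg_Reals"
    by (auto simp: nonneg_op_def)
  have re: "cinner (T x) x = cinner x (T x)" for x
    using nn[of x] cinner_commute[of "T x" x]
    by (auto simp: complex_nonneg_Reals_iff complex_eq_iff)
  have "inner (T x) y = inner x (T y)" for x y
  proof -
    have 1: "cinner (T x) y + cinner (T y) x = cinner x (T y) + cinner y (T x)" for x y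
      using re[of "x + y"] re[of x] re[of y]
      by (simp add: blinfun.add_right cinner_add_left cinner_add_right algebra_simps)
    have 2: "- \<i> * cinner (T x) y + \<i> * cinner (T y) x = - \<i> * cinner x (T y) + \<i> * cinner y (T x)"
      using 1[of "\<i> *\<^sub>C x" y] by (simp add: clinear_opD[OF cl] cinner_scaleC_left cinner_scaleC_right)
    have "\<i> * (cinner (T y) x - cinner (T x) y) = \<i> * (cinner y (T x) - cinner x (T y))"
      using 2 by (simp add: algebra_simps)
    then have "cinner (T y) x - cinner (T x) y = cinner y (T x) - cinner x (T y)"
      by simp
    with 1[of x y] have "cinner (T x) y + cinner (T x) y = cinner x (T y) + cinner x (T y)"
      by algebra
    then have "cinner (T x) y = cinner x (T y)"
      by simp
    then show ?thesis
      by (simp add: inner_eq_Re_cinner)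
  qed
  moreover have "0 \<le> inner x (T x)" for x
    using nn[of x] by (simp add: inner_eq_Re_cinner complex_nonneg_Reals_iff)
  ultimately show "self_adjoint T \<and> (\<forall>x. 0 \<le> inner x (T x))"
    using cl by (simp add: self_adjoint_iff)
next
  assume T: "self_adjoint T \<and> (\<forall>x. 0 \<le> inner x (T x))"
  have "Im (cinner x (T x)) = 0" for x
  proof -
    have "cinner x (T x) = cnj (cinner x (T x))"
      using T by (metis adjoint_ops_def cinner_commute self_adjoint_def)
    then show ?thesis
      by (simp add: complex_eq_iff)
  qed
  then show "nonneg_op T"
    using T by (auto simp: nonneg_op_def self_adjoint_def complex_nonneg_Reals_iff inner_eq_Re_cinner)
qed

lemma nonneg_self_adjoint: "nonneg_op T \<Longrightarrow> self_adjoint T"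
  by (simp add: nonneg_op_iff)

lemma nonneg_opD: "nonneg_op T \<Longrightarrow> 0 \<le> inner x (T x)"
  for T :: "'h::complex_hilbert_space op"
  by (simp add: nonneg_op_iff)

lemma nonneg_zero [simp]: "nonneg_op 0"
  and nonneg_id [simp]: "nonneg_op id_blinfun"
  by (simp_all add: nonneg_op_iff)

lemma nonneg_add: "nonneg_op S \<Longrightarrow> nonneg_op T \<Longrightarrow> nonneg_op (S + T)"
  by (simp add: nonneg_op_iff self_adjoint_add blinfun.bilinear_simps inner_add_right)

lemma nonneg_scaleR: "nonneg_op T \<Longrightarrow> 0 \<le> r \<Longrightarrow> nonneg_op (r *\<^sub>R T)"
  by (simp add: nonneg_op_iff self_adjoint_scaleR blinfun.bilinear_simps)

lemma nonneg_conj: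
  assumes "nonneg_op T" "self_adjoint S" shows "nonneg_op (S \<circ>\<^sub>L T \<circ>\<^sub>L S)"
proof -
  have S: "inner (S x) y = inner x (S y)" and T: "inner (T x) y = inner x (T y)" for x y
    using assms self_adjointD nonneg_self_adjoint by blast+
  then show ?thesis
    using assms unfolding nonneg_op_iff self_adjoint_iff
    by (simp add: clinear_comp) (metis S)
qed

lemma nonneg_adjoint_comp:
  assumes "adjoint_ops S S'" "clinear_op S" "clinear_op S'" shows "nonneg_op (S' \<circ>\<^sub>L S)"
proof -
  have "inner (S' x) y = inner x (S y)" for x y
    using adjoint_ops_inner[OF adjoint_ops_commute[OF assms(1)]] .
  moreover have "inner x (S' y) = inner (S x) y" for x y
    using adjoint_ops_inner[OF assms(1)] by simp
  ultimately show ?thesis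
    using assms by (simp add: nonneg_op_iff self_adjoint_iff clinear_comp)
qed

lemma nonneg_square: "self_adjoint S \<Longrightarrow> nonneg_op (S \<circ>\<^sub>L S)"
  using nonneg_conj[of id_blinfun S] by simp

lemma inner_id_diff_nonneg:
  assumes "self_adjoint T" shows "nonneg_op (norm T *\<^sub>R id_blinfun - T)"
    "nonneg_op (norm T *\<^sub>R id_blinfun + T)"
proof -
  have "\<bar>inner x (T x)\<bar> \<le> norm T * inner x x" for x
  proof -
    have "\<bar>inner x (T x)\<bar> \<le> norm x * norm (T x)"
      by (rule Cauchy_Schwarz_ineq2)
    also have "\<dots> \<le> norm x * (norm T * norm x)"
      by (intro mult_left_mono norm_blinfun) auto
    finally show ?thesis
      by (simp add: power2_norm_eq_inner[symmetric] power2_eq_square mult_ac)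
  qed
  then show "nonneg_op (norm T *\<^sub>R id_blinfun - T)" "nonneg_op (norm T *\<^sub>R id_blinfun + T)"
    using assms abs_le_D1 abs_le_D2 minus_le_iff
    by (simp_all add: nonneg_op_iff self_adjoint_add self_adjoint_diff self_adjoint_scaleR
        blinfun.bilinear_simps inner_add_right inner_diff_right) smt+
qed

lemma nonneg_norm_le:
  assumes "nonneg_op T" "nonneg_op (c *\<^sub>R id_blinfun - T)" "0 \<le> c"
  shows "norm T \<le> c"
proof (rule self_adjoint_norm_le)
  show "\<bar>inner x (T x)\<bar> \<le> c * (norm x)\<^sup>2" for x
    using nonneg_opD[OF assms(1), of x] nonneg_opD[OF assms(2), of x]
    by (simp add: blinfun.bilinear_simps inner_diff_right power2_norm_eq_inner)
qed (use assms nonneg_self_adjoint in auto)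

lemma nonneg_antisym:
  assumes "nonneg_op T" "nonneg_op (- T)" shows "T = 0"
  using nonneg_norm_le[of T 0] assms by simp

lemma self_adjoint_comp_self_zero:
  assumes "self_adjoint S" "S \<circ>\<^sub>L S = 0" shows "S = 0"
proof (rule blinfun_eqI)
  fix x
  have "inner (S x) (S x) = inner x ((S \<circ>\<^sub>L S) x)"
    using assms(1) by (simp add: self_adjointD)
  then show "blinfun_apply S x = blinfun_apply 0 x"
    using assms(2) by simp
qed

subsection \<open>Square roots\<close>

primrec sqrt_iter :: "'h::complex_hilbert_space op \<Rightarrow> nat \<Rightarrow> 'h op" where
  "sqrt_iter a 0 = 0"
| "sqrt_iter a (Suc n) = (1/2) *\<^sub>R (a + sqrt_iter a n \<circ>\<^sub>L sqrt_iter a n)"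

primrec sqrt_bound :: "nat \<Rightarrow> real" where
  "sqrt_bound 0 = 0"
| "sqrt_bound (Suc n) = (1 + (sqrt_bound n)\<^sup>2) / 2"

lemma sqrt_bound_range: "0 \<le> sqrt_bound n \<and> sqrt_bound n \<le> 1"
proof (induction n)
  case (Suc n)
  then have "(sqrt_bound n)\<^sup>2 \<le> 1"
    by (simp add: power_le_one)
  with Suc show ?case
    by simp
qed simp

lemma sqrt_bound_mono: "sqrt_bound n \<le> sqrt_bound (Suc n)"
proof -
  have "0 \<le> (1 - sqrt_bound n)\<^sup>2"
    by simp
  then show ?thesis
    by (simp add: power2_eq_square algebra_simps)
qed

lemma sqrt_bound_Cauchy: "Cauchy sqrt_bound"
proof -
  have "incseq sqrt_bound"
    using sqrt_bound_mono by (rule incseq_SucI)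
  moreover have "Bseq sqrt_bound"
    by (rule BseqI'[of _ 1]) (use sqrt_bound_range in simp)
  ultimately show ?thesis
    using Bseq_monoseq_convergent incseq_imp_monoseq convergent_Cauchy by blast
qed

lemma sqrt_iter_commute:
  assumes "a \<circ>\<^sub>L b = b \<circ>\<^sub>L a"
  shows "sqrt_iter a n \<circ>\<^sub>L b = b \<circ>\<^sub>L sqrt_iter a n"
proof (induction n)
  case (Suc n)
  have "sqrt_iter a n \<circ>\<^sub>L (sqrt_iter a n \<circ>\<^sub>L b) = b \<circ>\<^sub>L (sqrt_iter a n \<circ>\<^sub>L sqrt_iter a n)"
    by (simp add: Suc comp_assoc comp_cong_left[OF Suc])
  then show ?case
    by (simp add: comp_ring assms)
qed simp

lemma sqrt_iter_self_adjoint: "self_adjoint a \<Longrightarrow> self_adjoint (sqrt_iter a n)"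
  by (induction n) (auto intro!: self_adjoint_scaleR self_adjoint_add self_adjoint_square)

lemma sqrt_iter_norm:
  assumes "norm a \<le> 1" shows "norm (sqrt_iter a n) \<le> sqrt_bound n"
proof (induction n)
  case (Suc n)
  have "norm (sqrt_iter a (Suc n)) \<le> (norm a + norm (sqrt_iter a n \<circ>\<^sub>L sqrt_iter a n)) / 2"
    using norm_triangle_ineq[of a "sqrt_iter a n \<circ>\<^sub>L sqrt_iter a n"] by (simp add: divide_right_mono)
  also have "norm (sqrt_iter a n \<circ>\<^sub>L sqrt_iter a n) \<le> norm (sqrt_iter a n) * norm (sqrt_iter a n)"
    by (rule norm_blinfun_compose)
  also have "\<dots> \<le> (sqrt_bound n)\<^sup>2"
    using Suc by (simp add: power2_eq_square mult_mono sqrt_bound_range)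
  finally show ?case
    using assms by simp
qed simp

text \<open>Successive iterates commute, being polynomials in \<open>a\<close>, so the difference of
  their squares factors; both factors are dominated by their scalar counterparts.\<close>

lemma sqrt_iter_step:
  assumes "norm a \<le> 1"
  shows "norm (sqrt_iter a (Suc n) - sqrt_iter a n) \<le> sqrt_bound (Suc n) - sqrt_bound n"
proof (induction n)
  case 0
  then show ?case using assms by simp
next
  case (Suc n)
  let ?y = "sqrt_iter a (Suc n)" and ?x = "sqrt_iter a n"
  let ?t = "sqrt_bound (Suc n)" and ?s = "sqrt_bound n"
  have "?x \<circ>\<^sub>L a = a \<circ>\<^sub>L ?x"
    by (rule sqrt_iter_commute) simp
  then have "?x \<circ>\<^sub>L ?y = ?y \<circ>\<^sub>L ?x"
    by (simp add: comp_ring)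
  then have "sqrt_iter a (Suc (Suc n)) - ?y = (1/2) *\<^sub>R ((?y - ?x) \<circ>\<^sub>L (?y + ?x))"
    by (simp only: sqrt_iter.simps(2)[of a "Suc n"] sqrt_iter.simps(2)[of a n])
       (simp add: comp_ring algebra_simps)
  then have "norm (sqrt_iter a (Suc (Suc n)) - ?y) = norm ((?y - ?x) \<circ>\<^sub>L (?y + ?x)) / 2"
    by simp
  also have "\<dots> \<le> norm (?y - ?x) * norm (?y + ?x) / 2"
    by (simp add: norm_blinfun_compose divide_right_mono)
  also have "\<dots> \<le> (?t - ?s) * (?t + ?s) / 2"
    using Suc sqrt_iter_norm[OF assms, of n] sqrt_iter_norm[OF assms, of "Suc n"]
      norm_triangle_ineq[of ?y ?x] sqrt_bound_mono[of n]
    by (intro divide_right_mono mult_mono) (auto simp del: sqrt_iter.simps sqrt_bound.simps)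
  also have "\<dots> = sqrt_bound (Suc (Suc n)) - ?t"
    by (simp add: power2_eq_square field_simps)
  finally show ?case .
qed

lemma sqrt_iter_diff:
  assumes "norm a \<le> 1" "n \<le> m"
  shows "norm (sqrt_iter a m - sqrt_iter a n) \<le> sqrt_bound m - sqrt_bound n"
  using assms(2)
proof (induction m rule: dec_induct)
  case (step m)
  have "norm (sqrt_iter a (Suc m) - sqrt_iter a n)
      \<le> norm (sqrt_iter a (Suc m) - sqrt_iter a m) + norm (sqrt_iter a m - sqrt_iter a n)"
    by (metis diff_add_cancel norm_triangle_ineq add_diff_eq)
  then show ?case
    using step sqrt_iter_step[OF assms(1), of m] by linarith
qed simp

lemma sqrt_iter_Cauchy:
  assumes "norm a \<le> 1" shows "Cauchy (sqrt_iter a)"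
proof (rule metric_CauchyI)
  fix e :: real assume "0 < e"
  then obtain N where N: "\<And>m n. N \<le> m \<Longrightarrow> N \<le> n \<Longrightarrow> dist (sqrt_bound m) (sqrt_bound n) < e"
    using metric_CauchyD[OF sqrt_bound_Cauchy] by blast
  have "dist (sqrt_iter a m) (sqrt_iter a n) \<le> dist (sqrt_bound m) (sqrt_bound n)" for m n
    using sqrt_iter_diff[OF assms, of n m] sqrt_iter_diff[OF assms, of m n]
    by (cases "n \<le> m") (auto simp: dist_norm norm_minus_commute)
  then show "\<exists>N. \<forall>m\<ge>N. \<forall>n\<ge>N. dist (sqrt_iter a m) (sqrt_iter a n) < e"
    using N le_less_trans by blast
qed

text \<open>The root of \<open>1 - a\<close> is \<open>1 - y\<close>, where \<open>y\<close> is the limit of the iteration of \<open>y \<mapsto> (a + y\<^sup>2)/2\<close>;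
  the iteration is dominated by its scalar counterpart for \<open>a = 1\<close>.\<close>

lemma nonneg_sqrt_exists_contraction:
  assumes a: "self_adjoint a" "norm a \<le> 1"
  obtains S where "nonneg_op S" "S \<circ>\<^sub>L S = id_blinfun - a"
    "\<And>b. a \<circ>\<^sub>L b = b \<circ>\<^sub>L a \<Longrightarrow> S \<circ>\<^sub>L b = b \<circ>\<^sub>L S"
proof -
  obtain y where y: "sqrt_iter a \<longlonglongrightarrow> y"
    using Cauchy_convergent[OF sqrt_iter_Cauchy[OF a(2)]] by (auto simp: convergent_def)
  have "(\<lambda>n. sqrt_iter a (Suc n)) \<longlonglongrightarrow> (1/2) *\<^sub>R (a + y \<circ>\<^sub>L y)"
    by (simp only: sqrt_iter.simps) (intro tendsto_intros tendsto_comp y)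
  then have eq: "y = (1/2) *\<^sub>R (a + y \<circ>\<^sub>L y)"
    by (rule LIMSEQ_unique[OF LIMSEQ_Suc[OF y]])
  have sa: "self_adjoint y"
    by (rule self_adjoint_limit[OF sqrt_iter_self_adjoint[OF a(1)] y])
  have "norm (sqrt_iter a n) \<le> 1" for n
    using sqrt_iter_norm[OF a(2), of n] sqrt_bound_range[of n] by linarith
  then have "norm y \<le> 1"
    using LIMSEQ_le_const2[OF tendsto_norm[OF y]] by blast
  then have "nonneg_op ((norm y *\<^sub>R id_blinfun - y) + (1 - norm y) *\<^sub>R id_blinfun)"
    by (intro nonneg_add inner_id_diff_nonneg nonneg_scaleR sa) auto
  then have "nonneg_op (id_blinfun - y)"
    by (simp add: algebra_simps)
  moreover have "2 *\<^sub>R y = a + y \<circ>\<^sub>L y"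
    by (subst eq) simp
  then have "(id_blinfun - y) \<circ>\<^sub>L (id_blinfun - y) = id_blinfun - a"
    by (simp add: comp_ring scaleR_2 algebra_simps)
  moreover have "(id_blinfun - y) \<circ>\<^sub>L b = b \<circ>\<^sub>L (id_blinfun - y)" if "a \<circ>\<^sub>L b = b \<circ>\<^sub>L a" for b
  proof -
    have "(\<lambda>n. sqrt_iter a n \<circ>\<^sub>L b) \<longlonglongrightarrow> y \<circ>\<^sub>L b" "(\<lambda>n. b \<circ>\<^sub>L sqrt_iter a n) \<longlonglongrightarrow> b \<circ>\<^sub>L y"
      by (intro tendsto_comp y tendsto_const)+
    then have "y \<circ>\<^sub>L b = b \<circ>\<^sub>L y"
      unfolding sqrt_iter_commute[OF that] by (rule LIMSEQ_unique)
    then show ?thesis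
      by (simp add: comp_ring)
  qed
  ultimately show ?thesis
    using that by blast
qed

text \<open>Dividing by \<open>norm T\<close> puts \<open>1 - T / norm T\<close> between
  \<open>0\<close> and the identity, where the contraction case applies. The commutation clause
  places the root in the bicommutant of \<open>T\<close>; uniqueness and membership in von Neumann
  algebras rest on it.\<close>

lemma nonneg_sqrt_exists:
  assumes "nonneg_op T"
  obtains S where "nonneg_op S" "S \<circ>\<^sub>L S = T" "\<And>b. T \<circ>\<^sub>L b = b \<circ>\<^sub>L T \<Longrightarrow> S \<circ>\<^sub>L b = b \<circ>\<^sub>L S"
proof (cases "T = 0")
  case True
  then show ?thesis
    using that[of 0] by simp
next
  case False
  define c where "c = norm T"
  define a where "a = id_blinfun - (1/c) *\<^sub>R T"
  have c: "c > 0"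
    using False by (simp add: c_def)
  have "nonneg_op ((1/c) *\<^sub>R (norm T *\<^sub>R id_blinfun - T))"
    by (intro nonneg_scaleR inner_id_diff_nonneg nonneg_self_adjoint assms) (use c in auto)
  then have nn: "nonneg_op a"
    using c by (simp add: a_def scaleR_diff_right c_def [symmetric])
  have "nonneg_op ((1/c) *\<^sub>R T)"
    using assms c by (simp add: nonneg_scaleR)
  then have "norm a \<le> 1"
    using nn by (intro nonneg_norm_le) (auto simp: a_def)
  then obtain S where S: "nonneg_op S" "S \<circ>\<^sub>L S = id_blinfun - a"
    "\<And>b. a \<circ>\<^sub>L b = b \<circ>\<^sub>L a \<Longrightarrow> S \<circ>\<^sub>L b = b \<circ>\<^sub>L S"
    using nonneg_sqrt_exists_contraction nonneg_self_adjoint nn by blast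
  have "T = c *\<^sub>R (id_blinfun - a)"
    using c by (simp add: a_def)
  then have 1: "(sqrt c *\<^sub>R S) \<circ>\<^sub>L (sqrt c *\<^sub>R S) = T"
    using S(2) c by (simp add: comp_ring)
  have 2: "(sqrt c *\<^sub>R S) \<circ>\<^sub>L b = b \<circ>\<^sub>L (sqrt c *\<^sub>R S)" if "T \<circ>\<^sub>L b = b \<circ>\<^sub>L T" for b
  proof -
    have "a \<circ>\<^sub>L b = b \<circ>\<^sub>L a"
      by (simp add: a_def comp_ring that)
    from S(3)[OF this] show ?thesis
      by (simp add: comp_ring)
  qed
  show ?thesis
    by (rule that[OF _ 1 2]) (use S(1) c in \<open>simp_all add: nonneg_scaleR\<close>)
qed

text \<open>Writing \<open>S = R R\<close> with \<open>R\<close> commuting with \<open>T\<close>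
  turns the product into \<open>R T R\<close>.\<close>

lemma nonneg_comp:
  assumes "nonneg_op S" "nonneg_op T" "S \<circ>\<^sub>L T = T \<circ>\<^sub>L S"
  shows "nonneg_op (S \<circ>\<^sub>L T)"
proof -
  obtain R where R: "nonneg_op R" "R \<circ>\<^sub>L R = S" "R \<circ>\<^sub>L T = T \<circ>\<^sub>L R"
    using nonneg_sqrt_exists[OF assms(1)] assms(3) by metis
  have "S \<circ>\<^sub>L T = R \<circ>\<^sub>L T \<circ>\<^sub>L R"
    by (simp add: comp_assoc flip: R(2,3))
  then show ?thesis
    using nonneg_conj[OF assms(2) nonneg_self_adjoint[OF R(1)]] by simp
qed

lemma nonneg_sum_zero:
  assumes "nonneg_op S" "nonneg_op T" "S + T = 0"
  shows "S = 0"
  using assms nonneg_antisym[of S] by (metis add_eq_0_iff)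

text \<open>With \<open>D = S - R\<close>, commutation gives
  \<open>D S D + D R D = D (S S - R R) = 0\<close>. Both summands are nonnegative, hence zero, and
  their difference is \<open>D D D\<close>. Self-adjointness then brings \<open>D\<close> itself
  down to zero.\<close>

lemma nonneg_sqrt_unique:
  assumes "nonneg_op S" "nonneg_op R" "S \<circ>\<^sub>L S = R \<circ>\<^sub>L R" "S \<circ>\<^sub>L R = R \<circ>\<^sub>L S"
  shows "S = R"
proof -
  let ?D = "S - R"
  have sa: "self_adjoint ?D"
    using assms by (simp add: nonneg_self_adjoint self_adjoint_diff)
  have SR: "S \<circ>\<^sub>L (R \<circ>\<^sub>L b) = R \<circ>\<^sub>L (S \<circ>\<^sub>L b)" "S \<circ>\<^sub>L (S \<circ>\<^sub>L b) = R \<circ>\<^sub>L (R \<circ>\<^sub>L b)" for b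
    by (simp_all only: comp_assoc[symmetric] assms(3,4))
  have "(?D \<circ>\<^sub>L S \<circ>\<^sub>L ?D) + (?D \<circ>\<^sub>L R \<circ>\<^sub>L ?D) = 0"
    by (simp add: comp_ring assms(3,4) SR)
  then have "?D \<circ>\<^sub>L S \<circ>\<^sub>L ?D = 0" "?D \<circ>\<^sub>L R \<circ>\<^sub>L ?D = 0"
    using nonneg_sum_zero[of "?D \<circ>\<^sub>L S \<circ>\<^sub>L ?D"] nonneg_conj assms(1,2) sa by fastforce+
  then have "(?D \<circ>\<^sub>L ?D) \<circ>\<^sub>L ?D = 0"
    by (simp add: comp_ring)
  then have "(?D \<circ>\<^sub>L ?D) \<circ>\<^sub>L (?D \<circ>\<^sub>L ?D) = 0"
    by (simp add: comp_assoc[symmetric])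
  then have "?D \<circ>\<^sub>L ?D = 0"
    by (intro self_adjoint_comp_self_zero[of "?D \<circ>\<^sub>L ?D"] self_adjoint_square sa)
  then have "?D = 0"
    by (intro self_adjoint_comp_self_zero[OF sa])
  then show ?thesis
    by simp
qed

text \<open>Any root commutes with its own square \<open>T\<close>, hence with the root constructed
  above, so uniqueness among commuting roots makes the definite description well defined.\<close>

lemma op_sqrt_eqI:
  assumes "nonneg_op T" "nonneg_op S" "S \<circ>\<^sub>L S = T"
  shows "op_sqrt T = S"
proof -
  obtain R where R: "nonneg_op R" "R \<circ>\<^sub>L R = T" "\<And>b. T \<circ>\<^sub>L b = b \<circ>\<^sub>L T \<Longrightarrow> R \<circ>\<^sub>L b = b \<circ>\<^sub>L R"
    using nonneg_sqrt_exists[OF assms(1)] by metis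
  have "S' = R" if "nonneg_op S'" "S' \<circ>\<^sub>L S' = T" for S'
  proof -
    have "R \<circ>\<^sub>L S' = S' \<circ>\<^sub>L R"
      by (rule R(3)) (simp add: that(2)[symmetric] comp_assoc)
    then show ?thesis
      using nonneg_sqrt_unique[OF that(1) R(1) trans[OF that(2) R(2)[symmetric]]] by simp
  qed
  then show ?thesis
    unfolding op_sqrt_def using assms by (intro the_equality) auto
qed

lemma op_sqrt:
  assumes "nonneg_op T"
  shows nonneg_op_sqrt: "nonneg_op (op_sqrt T)"
    and op_sqrt_comp_self: "op_sqrt T \<circ>\<^sub>L op_sqrt T = T"
    and op_sqrt_commute: "T \<circ>\<^sub>L b = b \<circ>\<^sub>L T \<Longrightarrow> op_sqrt T \<circ>\<^sub>L b = b \<circ>\<^sub>L op_sqrt T"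
proof -
  obtain R where R: "nonneg_op R" "R \<circ>\<^sub>L R = T" "\<And>b. T \<circ>\<^sub>L b = b \<circ>\<^sub>L T \<Longrightarrow> R \<circ>\<^sub>L b = b \<circ>\<^sub>L R"
    using nonneg_sqrt_exists[OF assms] by metis
  have eq: "op_sqrt T = R"
    by (rule op_sqrt_eqI[OF assms R(1,2)])
  show "nonneg_op (op_sqrt T)" "op_sqrt T \<circ>\<^sub>L op_sqrt T = T"
    "T \<circ>\<^sub>L b = b \<circ>\<^sub>L T \<Longrightarrow> op_sqrt T \<circ>\<^sub>L b = b \<circ>\<^sub>L op_sqrt T"
    unfolding eq by (fact R)+
qed

lemma op_sqrt_self_commute:
  assumes "nonneg_op T" shows "T \<circ>\<^sub>L op_sqrt T = op_sqrt T \<circ>\<^sub>L T"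
  using comp_assoc[of "op_sqrt T" "op_sqrt T" "op_sqrt T"] op_sqrt_comp_self[OF assms] by simp

subsection \<open>Inverses\<close>

lemma op_inverse_eqI:
  assumes "S \<circ>\<^sub>L T = id_blinfun" "T \<circ>\<^sub>L S = id_blinfun"
  shows "op_inverse T = S"
  unfolding op_inverse_def
proof (rule the_equality)
  fix S' assume "S' \<circ>\<^sub>L T = id_blinfun \<and> T \<circ>\<^sub>L S' = id_blinfun"
  then have "S' \<circ>\<^sub>L (T \<circ>\<^sub>L S) = S"
    by (simp add: comp_assoc[symmetric])
  then show "S' = S"
    by (simp add: assms)
qed (simp add: assms)

text \<open>Partial sums with \<open>n\<close> terms, \<open>1 + ... + a^(n-1)\<close>, in Horner
  form: a limit \<open>N\<close> then satisfies \<open>N = 1 + a N\<close> by continuity.\<close>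

primrec neumann :: "'h::complex_hilbert_space op \<Rightarrow> nat \<Rightarrow> 'h op" where
  "neumann a 0 = 0"
| "neumann a (Suc n) = id_blinfun + a \<circ>\<^sub>L neumann a n"

lemma neumann_commute:
  assumes "a \<circ>\<^sub>L b = b \<circ>\<^sub>L a" shows "neumann a n \<circ>\<^sub>L b = b \<circ>\<^sub>L neumann a n"
proof (induction n)
  case (Suc n)
  have "a \<circ>\<^sub>L (b \<circ>\<^sub>L neumann a n) = b \<circ>\<^sub>L (a \<circ>\<^sub>L neumann a n)"
    by (simp add: comp_assoc comp_cong_left[OF assms])
  then show ?case
    by (simp add: comp_ring Suc)
qed simp

lemma neumann_convergent:
  assumes "norm a < 1"
  obtains N where "neumann a \<longlonglongrightarrow> N" "N \<circ>\<^sub>L (id_blinfun - a) = id_blinfun"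
    "(id_blinfun - a) \<circ>\<^sub>L N = id_blinfun"
proof -
  have step: "norm (neumann a (Suc n) - neumann a n) \<le> norm a ^ n" for n
  proof (induction n)
    case (Suc n)
    have "neumann a (Suc (Suc n)) - neumann a (Suc n) = a \<circ>\<^sub>L (neumann a (Suc n) - neumann a n)"
      by (simp add: comp_diff_right)
    also have "norm \<dots> \<le> norm a * norm (neumann a (Suc n) - neumann a n)"
      by (rule norm_blinfun_compose)
    also have "\<dots> \<le> norm a ^ Suc n"
      using Suc by (simp add: mult_left_mono)
    finally show ?case .
  qed (simp add: norm_blinfun_id_le)
  have "summable (\<lambda>n. neumann a (Suc n) - neumann a n)"
    using step assms by (intro summable_comparison_test'[OF summable_geometric[of "norm a"]]) auto
  then have "convergent (neumann a)"
    unfolding summable_iff_convergent sum_lessThan_telescope by simp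
  then obtain N where N: "neumann a \<longlonglongrightarrow> N"
    by (auto simp: convergent_def)
  have "(\<lambda>n. neumann a (Suc n)) \<longlonglongrightarrow> id_blinfun + a \<circ>\<^sub>L N"
    by (simp only: neumann.simps) (intro tendsto_intros tendsto_comp N)
  then have eq: "N = id_blinfun + a \<circ>\<^sub>L N"
    by (rule LIMSEQ_unique[OF LIMSEQ_Suc[OF N]])
  then have r: "(id_blinfun - a) \<circ>\<^sub>L N = id_blinfun"
    by (simp add: comp_diff_left diff_eq_eq)
  have "(\<lambda>n. neumann a n \<circ>\<^sub>L a) \<longlonglongrightarrow> N \<circ>\<^sub>L a" "(\<lambda>n. a \<circ>\<^sub>L neumann a n) \<longlonglongrightarrow> a \<circ>\<^sub>L N"
    by (intro tendsto_comp N tendsto_const)+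
  then have "N \<circ>\<^sub>L a = a \<circ>\<^sub>L N"
    unfolding neumann_commute[of a a, OF refl] by (rule LIMSEQ_unique)
  then have "N \<circ>\<^sub>L (id_blinfun - a) = id_blinfun"
    using r by (simp add: comp_ring)
  then show ?thesis
    using that N r by blast
qed

definition invertible_op :: "'h::complex_hilbert_space op \<Rightarrow> bool" where
  "invertible_op T \<longleftrightarrow> (\<exists>S. S \<circ>\<^sub>L T = id_blinfun \<and> T \<circ>\<^sub>L S = id_blinfun)"

lemma op_inverse:
  assumes "invertible_op T"
  shows op_inverse_left: "op_inverse T \<circ>\<^sub>L T = id_blinfun"
    and op_inverse_right: "T \<circ>\<^sub>L op_inverse T = id_blinfun"
proof -
  obtain S where S: "S \<circ>\<^sub>L T = id_blinfun" "T \<circ>\<^sub>L S = id_blinfun"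
    using assms by (auto simp: invertible_op_def)
  then show "op_inverse T \<circ>\<^sub>L T = id_blinfun" "T \<circ>\<^sub>L op_inverse T = id_blinfun"
    by (simp_all add: op_inverse_eqI)
qed

lemma op_inverse_commute:
  assumes "invertible_op T" "T \<circ>\<^sub>L b = b \<circ>\<^sub>L T"
  shows "op_inverse T \<circ>\<^sub>L b = b \<circ>\<^sub>L op_inverse T"
proof -
  have "op_inverse T \<circ>\<^sub>L (T \<circ>\<^sub>L b) \<circ>\<^sub>L op_inverse T = op_inverse T \<circ>\<^sub>L (b \<circ>\<^sub>L T) \<circ>\<^sub>L op_inverse T"
    by (simp only: assms(2))
  then show ?thesis
    by (simp add: comp_assoc op_inverse_right[OF assms(1)] comp_cong_left[OF op_inverse_left[OF assms(1)]])
qed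

lemma clinear_op_inverse:
  assumes "invertible_op T" "clinear_op T" shows "clinear_op (op_inverse T)"
proof (rule clinear_opI)
  fix c x
  have l: "op_inverse T (T y) = y" and r: "T (op_inverse T y) = y" for y
    using op_inverse[OF assms(1)] by (metis blinfun_apply_blinfun_compose blinfun_apply_id_blinfun)+
  then show "op_inverse T (c *\<^sub>C x) = c *\<^sub>C op_inverse T x"
    by (metis assms(2) clinear_opD)
qed

lemma self_adjoint_op_inverse:
  assumes "invertible_op T" "self_adjoint T" shows "self_adjoint (op_inverse T)"
proof -
  have l: "op_inverse T (T y) = y" and r: "T (op_inverse T y) = y" for y
    using op_inverse[OF assms(1)] by (metis blinfun_apply_blinfun_compose blinfun_apply_id_blinfun)+
  then have "inner (op_inverse T x) y = inner x (op_inverse T y)" for x y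
    by (metis assms(2) self_adjointD)
  then show ?thesis
    using assms clinear_op_inverse[of T] self_adjoint_clinear[of T]
    by (auto simp: self_adjoint_iff[of "op_inverse T"])
qed

lemma nonneg_op_inverse:
  assumes "invertible_op T" "nonneg_op T" shows "nonneg_op (op_inverse T)"
proof -
  have "op_inverse T \<circ>\<^sub>L T \<circ>\<^sub>L op_inverse T = op_inverse T"
    using op_inverse[OF assms(1)] by simp
  then show ?thesis
    using nonneg_conj[OF assms(2) self_adjoint_op_inverse[OF assms(1) nonneg_self_adjoint[OF assms(2)]]]
    by simp
qed

text \<open>The operator form of a spectrum bounded away from \<open>0\<close>; it yields an inverse
  that is a norm limit of polynomials in \<open>T\<close>.\<close>

definition pos_op :: "'h::complex_hilbert_space op \<Rightarrow> bool" where
  "pos_op T \<longleftrightarrow> (\<exists>e>0. nonneg_op (T - e *\<^sub>R id_blinfun))"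

lemma pos_op_nonneg:
  assumes "pos_op T" shows "nonneg_op T"
proof -
  obtain e where "e > 0" "nonneg_op (T - e *\<^sub>R id_blinfun)"
    using assms by (auto simp: pos_op_def)
  then have "nonneg_op ((T - e *\<^sub>R id_blinfun) + e *\<^sub>R id_blinfun)"
    by (intro nonneg_add nonneg_scaleR) auto
  then show ?thesis by simp
qed

lemma pos_op_id_add: "nonneg_op T \<Longrightarrow> e > 0 \<Longrightarrow> pos_op (e *\<^sub>R id_blinfun + T)"
  unfolding pos_op_def by (intro exI[of _ e]) simp

text \<open>Dividing by a large constant puts a strictly positive operator in the range of the Neumann
  series; the partial sums are kept in the statement because limits of polynomials are needed.\<close>

lemma pos_op_neumann:
  assumes "pos_op T"
  obtains c where "c > 0" "(\<lambda>n. c *\<^sub>R neumann (id_blinfun - c *\<^sub>R T) n) \<longlonglongrightarrow> op_inverse T"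
    "invertible_op T"
proof -
  obtain e where e: "e > 0" "nonneg_op (T - e *\<^sub>R id_blinfun)"
    using assms by (auto simp: pos_op_def)
  define M where "M = norm T + e"
  define a where "a = id_blinfun - (1/M) *\<^sub>R T"
  have M: "M > 0" "M \<ge> e"
    using e(1) by (auto simp: M_def add_nonneg_pos)
  have "nonneg_op ((1/M) *\<^sub>R ((norm T *\<^sub>R id_blinfun - T) + e *\<^sub>R id_blinfun))"
    using M e(1) nonneg_self_adjoint[OF pos_op_nonneg[OF assms]]
    by (intro nonneg_scaleR nonneg_add inner_id_diff_nonneg nonneg_id) auto
  also have "(1/M) *\<^sub>R ((norm T *\<^sub>R id_blinfun - T) + e *\<^sub>R id_blinfun)
      = (1/M) *\<^sub>R (M *\<^sub>R id_blinfun - T)"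
    by (simp add: M_def algebra_simps)
  also have "\<dots> = a"
    using M by (simp add: a_def algebra_simps)
  finally have 1: "nonneg_op a" .
  have "nonneg_op ((1/M) *\<^sub>R (T - e *\<^sub>R id_blinfun))"
    using e M by (intro nonneg_scaleR) auto
  then have "nonneg_op ((1 - e/M) *\<^sub>R id_blinfun - a)"
    by (simp add: a_def algebra_simps)
  then have "norm a \<le> 1 - e/M"
    using 1 M by (intro nonneg_norm_le) auto
  then have "norm a < 1"
    using e M by (smt (verit) divide_pos_pos)
  then obtain N where N: "neumann a \<longlonglongrightarrow> N" "N \<circ>\<^sub>L (id_blinfun - a) = id_blinfun"
    "(id_blinfun - a) \<circ>\<^sub>L N = id_blinfun"
    by (rule neumann_convergent)
  then have inv: "((1/M) *\<^sub>R N) \<circ>\<^sub>L T = id_blinfun" "T \<circ>\<^sub>L ((1/M) *\<^sub>R N) = id_blinfun"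
    by (simp_all add: a_def comp_ring)
  then have "op_inverse T = (1/M) *\<^sub>R N"
    by (rule op_inverse_eqI)
  then have "(\<lambda>n. (1/M) *\<^sub>R neumann a n) \<longlonglongrightarrow> op_inverse T"
    using N(1) by (auto intro: tendsto_intros)
  then show ?thesis
    using that[of "1/M"] inv M unfolding a_def invertible_op_def by auto
qed

lemma pos_op_invertible: "pos_op T \<Longrightarrow> invertible_op T"
  using pos_op_neumann by blast

lemma invertible_op_sqrt:
  assumes "pos_op T" shows "invertible_op (op_sqrt T)"
proof -
  note inv = op_inverse[OF pos_op_invertible[OF assms]]
  note sq = op_sqrt_comp_self[OF pos_op_nonneg[OF assms]]
  have "op_inverse T \<circ>\<^sub>L op_sqrt T = op_sqrt T \<circ>\<^sub>L op_inverse T"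
    by (rule op_inverse_commute[OF pos_op_invertible[OF assms] op_sqrt_self_commute[OF pos_op_nonneg[OF assms]]])
  then have "op_sqrt T \<circ>\<^sub>L (op_inverse T \<circ>\<^sub>L op_sqrt T) = (op_sqrt T \<circ>\<^sub>L op_sqrt T) \<circ>\<^sub>L op_inverse T"
    by (simp add: comp_assoc)
  then have "op_sqrt T \<circ>\<^sub>L (op_inverse T \<circ>\<^sub>L op_sqrt T) = id_blinfun"
    by (simp add: sq inv)
  moreover have "(op_inverse T \<circ>\<^sub>L op_sqrt T) \<circ>\<^sub>L op_sqrt T = id_blinfun"
    by (simp add: comp_assoc sq inv)
  ultimately show ?thesis
    unfolding invertible_op_def by blast
qed

subsection \<open>Polynomials in an operator\<close>

text \<open>Coefficients are real, so that polynomials in a self-adjoint operator stay self-adjoint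
  and have real states.\<close>

definition opoly :: "real poly \<Rightarrow> 'h::complex_hilbert_space op \<Rightarrow> 'h op" where
  "opoly p T = fold_coeffs (\<lambda>a S. a *\<^sub>R id_blinfun + T \<circ>\<^sub>L S) p 0"

lemma opoly_0 [simp]: "opoly 0 T = 0"
  by (simp add: opoly_def)

lemma opoly_pCons [simp]: "opoly (pCons a p) T = a *\<^sub>R id_blinfun + T \<circ>\<^sub>L opoly p T"
  by (cases "p = 0 \<and> a = 0") (auto simp: opoly_def)

lemma opoly_add [simp]: "opoly (p + q) T = opoly p T + opoly q T"
  by (induction p q rule: poly_induct2) (simp_all add: comp_ring algebra_simps)

lemma opoly_smult [simp]: "opoly (smult c p) T = c *\<^sub>R opoly p T"
  by (induction p) (simp_all add: comp_ring algebra_simps)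

lemma opoly_mult [simp]: "opoly (p * q) T = opoly p T \<circ>\<^sub>L opoly q T"
  by (induction p) (simp_all add: comp_ring)

lemma opoly_1 [simp]: "opoly 1 T = id_blinfun"
  by (simp add: one_pCons)

lemma opoly_minus [simp]: "opoly (- p) T = - opoly p T"
  using opoly_smult[of "-1" p T] by simp

lemma opoly_diff [simp]: "opoly (p - q) T = opoly p T - opoly q T"
  using opoly_add[of p "- q" T] by simp

lemma opoly_sum: "opoly (\<Sum>i\<in>I. f i) T = (\<Sum>i\<in>I. opoly (f i) T)"
  by (induction I rule: infinite_finite_induct) auto

lemma opoly_commute:
  assumes "T \<circ>\<^sub>L b = b \<circ>\<^sub>L T" shows "opoly p T \<circ>\<^sub>L b = b \<circ>\<^sub>L opoly p T"
proof (induction p)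
  case (pCons a p)
  have "T \<circ>\<^sub>L (b \<circ>\<^sub>L opoly p T) = b \<circ>\<^sub>L (T \<circ>\<^sub>L opoly p T)"
    by (simp add: comp_assoc comp_cong_left[OF assms])
  with pCons show ?case
    by (simp add: comp_ring)
qed simp

lemma self_adjoint_opoly:
  assumes "self_adjoint T" shows "self_adjoint (opoly p T)"
proof (induction p)
  case (pCons a p)
  moreover have "opoly p T \<circ>\<^sub>L T = T \<circ>\<^sub>L opoly p T"
    by (rule opoly_commute) simp
  ultimately show ?case
    using assms by (auto intro!: self_adjoint_add self_adjoint_scaleR self_adjoint_comp)
qed simp

lemma opoly_monom: "opoly (monom 1 n) T = op_power T n"
  by (induction n) (simp_all add: monom_Suc op_power_def)

section \<open>Von Neumann algebras and traces\<close>

text \<open>Von Neumann algebras are defined by the bicommutant, so membership reduces to commuting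
  with the commutant. Norm limits, inverses and square roots all enter the algebra this way.\<close>

lemma vn_memI:
  assumes "von_neumann_algebra A" "clinear_op T" "\<And>S. S \<in> commutant A \<Longrightarrow> T \<circ>\<^sub>L S = S \<circ>\<^sub>L T"
  shows "T \<in> A"
proof -
  have "T \<in> commutant (commutant A)"
    using assms(2,3) by (simp add: commutant_def)
  then show ?thesis
    using assms(1) by (simp add: von_neumann_algebra_def)
qed

lemma vn_clinear:
  assumes "von_neumann_algebra A" "T \<in> A" shows "clinear_op T"
proof -
  have "T \<in> commutant (commutant A)"
    using assms by (simp add: von_neumann_algebra_def)
  then show ?thesis
    by (simp add: commutant_def)
qed

lemma commutantD: "S \<in> commutant A \<Longrightarrow> T \<in> A \<Longrightarrow> T \<circ>\<^sub>L S = S \<circ>\<^sub>L T"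
  by (auto simp: commutant_def)

lemma commutant_clinear: "S \<in> commutant A \<Longrightarrow> clinear_op S"
  by (auto simp: commutant_def)

context
  fixes A :: "'h::complex_hilbert_space op set"
  assumes vn: "von_neumann_algebra A"
begin

lemma vn_id: "id_blinfun \<in> A"
  by (rule vn_memI[OF vn]) auto

lemma vn_zero: "0 \<in> A"
  by (rule vn_memI[OF vn]) auto

lemma vn_add: "S \<in> A \<Longrightarrow> T \<in> A \<Longrightarrow> S + T \<in> A"
  by (rule vn_memI[OF vn]) (simp_all add: clinear_add vn_clinear[OF vn] comp_ring commutantD)

lemma vn_diff: "S \<in> A \<Longrightarrow> T \<in> A \<Longrightarrow> S - T \<in> A"
  by (rule vn_memI[OF vn]) (simp_all add: clinear_diff vn_clinear[OF vn] comp_ring commutantD)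

lemma vn_scaleR: "T \<in> A \<Longrightarrow> r *\<^sub>R T \<in> A"
  by (rule vn_memI[OF vn]) (simp_all add: clinear_scaleR vn_clinear[OF vn] comp_ring commutantD)

lemma vn_scaleC:
  assumes "T \<in> A" shows "op_scaleC c T \<in> A"
proof (rule vn_memI[OF vn])
  fix S assume S: "S \<in> commutant A"
  show "op_scaleC c T \<circ>\<^sub>L S = S \<circ>\<^sub>L op_scaleC c T"
  proof (rule blinfun_eqI)
    fix x
    have "T (S x) = S (T x)"
      using commutantD[OF S assms] by (metis blinfun_apply_blinfun_compose)
    then show "blinfun_apply (op_scaleC c T \<circ>\<^sub>L S) x = blinfun_apply (S \<circ>\<^sub>L op_scaleC c T) x"
      using clinear_opD[OF commutant_clinear[OF S]] by (simp add: op_scaleC.rep_eq)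
  qed
qed (simp add: clinear_scaleC vn_clinear[OF vn] assms)

lemma vn_comp:
  assumes "S \<in> A" "T \<in> A" shows "S \<circ>\<^sub>L T \<in> A"
proof (rule vn_memI[OF vn])
  fix R assume R: "R \<in> commutant A"
  show "S \<circ>\<^sub>L T \<circ>\<^sub>L R = R \<circ>\<^sub>L (S \<circ>\<^sub>L T)"
    by (simp add: comp_assoc commutantD[OF R assms(2)] comp_cong_left[OF commutantD[OF R assms(1)]])
qed (simp add: clinear_comp vn_clinear[OF vn] assms)

lemma vn_sum: "(\<And>i. i \<in> I \<Longrightarrow> f i \<in> A) \<Longrightarrow> (\<Sum>i\<in>I. f i) \<in> A"
  by (induction I rule: infinite_finite_induct) (auto intro: vn_add vn_zero)

lemma vn_adjoint:
  assumes "S \<in> A" obtains T where "T \<in> A" "adjoint_ops S T"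
  using assms vn by (auto simp: von_neumann_algebra_def)

lemma vn_limit:
  assumes "\<And>n. f n \<in> A" "f \<longlonglongrightarrow> T" shows "T \<in> A"
proof (rule vn_memI[OF vn])
  show "clinear_op T"
    using clinear_limit[OF _ assms(2)] vn_clinear[OF vn] assms(1) by blast
  fix S assume S: "S \<in> commutant A"
  have "(\<lambda>n. f n \<circ>\<^sub>L S) \<longlonglongrightarrow> T \<circ>\<^sub>L S" "(\<lambda>n. S \<circ>\<^sub>L f n) \<longlonglongrightarrow> S \<circ>\<^sub>L T"
    by (intro tendsto_comp assms(2) tendsto_const)+
  then show "T \<circ>\<^sub>L S = S \<circ>\<^sub>L T"
    unfolding commutantD[OF S assms(1)] by (rule LIMSEQ_unique)
qed

lemma vn_op_inverse: "T \<in> A \<Longrightarrow> invertible_op T \<Longrightarrow> op_inverse T \<in> A"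
  by (rule vn_memI[OF vn])
    (simp_all add: clinear_op_inverse vn_clinear[OF vn] commutantD op_inverse_commute)

lemma vn_op_sqrt: "T \<in> A \<Longrightarrow> nonneg_op T \<Longrightarrow> op_sqrt T \<in> A"
  by (rule vn_memI[OF vn])
    (simp_all add: self_adjoint_clinear nonneg_self_adjoint nonneg_op_sqrt commutantD op_sqrt_commute)

lemma vn_opoly: "T \<in> A \<Longrightarrow> opoly p T \<in> A"
  by (induction p) (auto intro: vn_add vn_zero vn_scaleR vn_id vn_comp)

end

lemma cinner_diff_left: "cinner (x - y) z = cinner x z - cinner y z"
  for x :: "'h::complex_hilbert_space"
  using cinner_add_left[of "x - y" y z] by simp

lemma cinner_diff_right: "cinner x (y - z) = cinner x y - cinner x z"
  for x :: "'h::complex_hilbert_space"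
  using cinner_add_right[of x "y - z" z] by simp

text \<open>For \<open>c > 0\<close> the value at \<open>- b / c\<close> gives the bound. In the
  case \<open>c = 0\<close> a nonzero slope would produce the value \<open>-1\<close> at
  \<open>- (a + 1) / (2 * b)\<close>; this case is the one behind the orthogonality of conditional
  expectations.\<close>

lemma nonneg_quadratic:
  fixes a b c :: real
  assumes "\<And>t. 0 \<le> a + 2 * b * t + c * t\<^sup>2" "0 \<le> c"
  shows "b\<^sup>2 \<le> a * c"
proof (cases "c = 0")
  case True
  have "b = 0"
  proof (rule ccontr)
    assume "b \<noteq> 0"
    then show False
      using assms(1)[of "- (a + 1) / (2 * b)"] True by simp
  qed
  then show ?thesis
    using True by simp
next
  case False
  then have "c > 0"
    using assms(2) by simp
  then show ?thesis
    using assms(1)[of "- b / c"] by (simp add: field_simps power2_eq_square)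
qed

lemma norm_diff_adjoint_comp_nonneg:
  assumes "adjoint_ops S S'" "clinear_op S" "clinear_op S'"
  shows "nonneg_op ((norm S)\<^sup>2 *\<^sub>R id_blinfun - S' \<circ>\<^sub>L S)"
  unfolding nonneg_op_iff
proof (intro conjI allI)
  show "self_adjoint ((norm S)\<^sup>2 *\<^sub>R id_blinfun - S' \<circ>\<^sub>L S)"
    using nonneg_self_adjoint[OF nonneg_adjoint_comp[OF assms]]
    by (intro self_adjoint_diff self_adjoint_scaleR self_adjoint_id)
  fix x
  have "inner x (S' (S x)) = (norm (S x))\<^sup>2"
    using adjoint_ops_inner[OF assms(1), of x "S x"] by (simp add: power2_norm_eq_inner)
  also have "\<dots> \<le> (norm S * norm x)\<^sup>2"
    by (intro power_mono norm_blinfun) auto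
  also have "\<dots> = (norm S)\<^sup>2 * inner x x"
    by (simp add: power_mult_distrib power2_norm_eq_inner)
  finally show "0 \<le> inner x (((norm S)\<^sup>2 *\<^sub>R id_blinfun - S' \<circ>\<^sub>L S) x)"
    by (simp add: blinfun.bilinear_simps inner_diff_right)
qed

section \<open>The real trace and its Cauchy-Schwarz inequality\<close>

context W_star_probability_space
begin

definition tr :: "'h op \<Rightarrow> real" where "tr T = Re (\<phi> T)"

lemmas A_id = vn_id[OF von_neumann]
  and A_zero = vn_zero[OF von_neumann]
  and A_add = vn_add[OF von_neumann]
  and A_diff = vn_diff[OF von_neumann]
  and A_scaleR = vn_scaleR[OF von_neumann]
  and A_comp = vn_comp[OF von_neumann]
  and A_sum = vn_sum[OF von_neumann]
  and A_limit = vn_limit[OF von_neumann]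
  and A_op_inverse = vn_op_inverse[OF von_neumann]
  and A_op_sqrt = vn_op_sqrt[OF von_neumann]
  and A_opoly = vn_opoly[OF von_neumann]
  and A_clinear = vn_clinear[OF von_neumann]

lemmas A_intros = A_id A_zero A_add A_diff A_scaleR A_comp A_sum A_opoly

lemma tr_add: "S \<in> A \<Longrightarrow> T \<in> A \<Longrightarrow> tr (S + T) = tr S + tr T"
  by (simp add: tr_def state_add)

lemma tr_scaleR: "T \<in> A \<Longrightarrow> tr (r *\<^sub>R T) = r * tr T"
  using state_scale[of T "complex_of_real r"] by (simp add: tr_def op_scaleC_of_real)

lemma tr_diff: "S \<in> A \<Longrightarrow> T \<in> A \<Longrightarrow> tr (S - T) = tr S - tr T"
  using tr_add[of S "(-1) *\<^sub>R T"] tr_scaleR[of T "-1"] A_scaleR[of T "-1"] by simp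

lemma tr_zero [simp]: "tr 0 = 0"
  using tr_scaleR[of 0 0] A_zero by simp

lemma tr_id [simp]: "tr id_blinfun = 1"
  by (simp add: tr_def state_unit)

lemma tr_sum: "(\<And>i. i \<in> I \<Longrightarrow> f i \<in> A) \<Longrightarrow> tr (\<Sum>i\<in>I. f i) = (\<Sum>i\<in>I. tr (f i))"
  by (induction I rule: infinite_finite_induct) (auto simp: tr_add A_sum)

lemma tr_commute: "S \<in> A \<Longrightarrow> T \<in> A \<Longrightarrow> tr (S \<circ>\<^sub>L T) = tr (T \<circ>\<^sub>L S)"
  by (simp add: tr_def state_tracial)

lemma tr_nonneg: "T \<in> A \<Longrightarrow> nonneg_op T \<Longrightarrow> 0 \<le> tr T"
  using state_nonneg[of T] by (simp add: tr_def complex_nonneg_Reals_iff)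

text \<open>The axioms make the state real on nonnegative elements. Adding \<open>norm T\<close>
  times the identity makes \<open>T\<close> nonnegative and leaves the imaginary part of its state
  unchanged.\<close>

lemma state_self_adjoint:
  assumes "T \<in> A" "self_adjoint T" shows "\<phi> T = complex_of_real (tr T)"
proof -
  let ?S = "norm T *\<^sub>R id_blinfun + T"
  have "\<phi> ?S \<in> nonneg_Reals"
    by (intro state_nonneg inner_id_diff_nonneg assms A_add A_scaleR A_id)
  moreover have "\<phi> ?S = complex_of_real (norm T) + \<phi> T"
    using state_scale[OF A_id, of "complex_of_real (norm T)"]
    by (simp add: state_add A_scaleR A_id assms state_unit op_scaleC_of_real)
  ultimately show ?thesis
    by (simp add: complex_nonneg_Reals_iff complex_eq_iff tr_def)
qed

lemma tr_faithful:
  assumes "T \<in> A" "nonneg_op T" "tr T = 0" shows "T = 0"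
  using state_faithful[OF assms(1,2)] state_self_adjoint[OF assms(1) nonneg_self_adjoint[OF assms(2)]]
    assms(3) by simp

lemma tr_faithful_square:
  assumes "T \<in> A" "self_adjoint T" "tr (T \<circ>\<^sub>L T) = 0" shows "T = 0"
  using tr_faithful[OF A_comp[OF assms(1,1)] nonneg_square[OF assms(2)] assms(3)]
    self_adjoint_comp_self_zero[OF assms(2)] by simp

text \<open>\<open>S - T\<close> is skew-adjoint, so \<open>\<i>\<close> times it is self-adjoint
  and has a real state; hence the real part of \<open>\<phi> (S - T)\<close> vanishes.\<close>

lemma tr_adjoint:
  assumes "S \<in> A" "T \<in> A" "adjoint_ops S T" shows "tr T = tr S"
proof -
  let ?D = "op_scaleC \<i> (S - T)"
  have "adjoint_ops ?D ?D"
    unfolding adjoint_ops_def op_scaleC.rep_eq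
    using assms(3) adjoint_ops_commute[OF assms(3)]
    by (simp add: adjoint_ops_def cinner_scaleC_left cinner_scaleC_right blinfun.bilinear_simps
        cinner_diff_left cinner_diff_right right_diff_distrib)
  then have "self_adjoint ?D"
    by (simp add: self_adjoint_def clinear_scaleC clinear_diff A_clinear assms)
  moreover have "?D \<in> A"
    by (intro vn_scaleC[OF von_neumann] A_diff assms)
  ultimately have "\<phi> ?D = complex_of_real (tr ?D)"
    by (rule state_self_adjoint[rotated])
  moreover have "\<phi> ?D = \<i> * \<phi> (S - T)"
    by (intro state_scale A_diff assms)
  ultimately have "Re (\<phi> (S - T)) = 0"
    by (metis Im_complex_of_real Im_i_times)
  then show ?thesis
    using tr_diff[OF assms(1,2)] by (simp add: tr_def)
qed

text \<open>Adjoints enter as witnesses \<open>S'\<close>, \<open>T'\<close> because adjointness is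
  a relation here. Expanding at \<open>S + t T\<close> with real \<open>t\<close> suffices, since
  the two cross terms have equal real trace.\<close>

lemma tr_Cauchy_Schwarz:
  assumes "S \<in> A" "S' \<in> A" "T \<in> A" "T' \<in> A" "adjoint_ops S S'" "adjoint_ops T T'"
  shows "(tr (S' \<circ>\<^sub>L T))\<^sup>2 \<le> tr (S' \<circ>\<^sub>L S) * tr (T' \<circ>\<^sub>L T)"
proof (rule nonneg_quadratic)
  show "0 \<le> tr (T' \<circ>\<^sub>L T)"
    by (intro tr_nonneg nonneg_adjoint_comp A_clinear A_comp assms)
  fix t :: real
  let ?Z = "S + t *\<^sub>R T" and ?Z' = "S' + t *\<^sub>R T'"
  have mem: "?Z \<in> A" "?Z' \<in> A"
    by (intro A_intros assms)+
  have "adjoint_ops ?Z ?Z'"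
    using adjoint_ops_inner[OF assms(5)] adjoint_ops_inner[OF assms(6)] A_clinear[OF mem(1)]
    by (intro adjoint_opsI) (simp_all add: blinfun.bilinear_simps inner_add_left inner_add_right)
  then have "0 \<le> tr (?Z' \<circ>\<^sub>L ?Z)"
    by (intro tr_nonneg nonneg_adjoint_comp A_clinear A_comp mem)
  also have "?Z' \<circ>\<^sub>L ?Z = S' \<circ>\<^sub>L S + t *\<^sub>R (S' \<circ>\<^sub>L T) + t *\<^sub>R (T' \<circ>\<^sub>L S) + t\<^sup>2 *\<^sub>R (T' \<circ>\<^sub>L T)"
    by (simp add: comp_ring algebra_simps power2_eq_square)
  also have "tr \<dots> = tr (S' \<circ>\<^sub>L S) + t * tr (S' \<circ>\<^sub>L T) + t * tr (T' \<circ>\<^sub>L S) + t\<^sup>2 * tr (T' \<circ>\<^sub>L T)"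
    by (simp add: tr_add tr_scaleR A_intros assms)
  also have "tr (T' \<circ>\<^sub>L S) = tr (S' \<circ>\<^sub>L T)"
    by (rule tr_adjoint) (intro A_comp assms adjoint_ops_comp adjoint_ops_commute[OF assms(5)])+
  finally show "0 \<le> tr (S' \<circ>\<^sub>L S) + 2 * tr (S' \<circ>\<^sub>L T) * t + tr (T' \<circ>\<^sub>L T) * t\<^sup>2"
    by (simp add: algebra_simps)
qed

lemma self_adjoint_adjoint_ops: "self_adjoint T \<Longrightarrow> adjoint_ops T T"
  by (simp add: self_adjoint_def)

lemma tr_Cauchy_Schwarz_self_adjoint:
  assumes "S \<in> A" "self_adjoint S" "T \<in> A" "self_adjoint T"
  shows "(tr (S \<circ>\<^sub>L T))\<^sup>2 \<le> tr (S \<circ>\<^sub>L S) * tr (T \<circ>\<^sub>L T)"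
  using assms by (intro tr_Cauchy_Schwarz self_adjoint_adjoint_ops)

lemma tr_abs_le_norm:
  assumes "T \<in> A" shows "\<bar>tr T\<bar> \<le> norm T"
proof -
  obtain T' where T': "T' \<in> A" "adjoint_ops T T'"
    using vn_adjoint[OF von_neumann assms] by blast
  have "(tr (id_blinfun \<circ>\<^sub>L T))\<^sup>2 \<le> tr (id_blinfun \<circ>\<^sub>L id_blinfun) * tr (T' \<circ>\<^sub>L T)"
    by (intro tr_Cauchy_Schwarz A_id assms T' adjoint_ops_id)
  moreover have "0 \<le> tr ((norm T)\<^sup>2 *\<^sub>R id_blinfun - T' \<circ>\<^sub>L T)"
    by (intro tr_nonneg norm_diff_adjoint_comp_nonneg A_intros A_clinear assms T')
  ultimately have "(tr T)\<^sup>2 \<le> (norm T)\<^sup>2"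
    by (simp add: tr_diff tr_scaleR A_intros assms T')
  then show ?thesis
    using abs_le_square_iff[of "tr T" "norm T"] by simp
qed

lemma tr_tendsto:
  assumes "\<And>n. f n \<in> A" "f \<longlonglongrightarrow> T" shows "(\<lambda>n. tr (f n)) \<longlonglongrightarrow> tr T"
proof (rule LIM_zero_cancel, rule Lim_null_comparison)
  have T: "T \<in> A"
    using A_limit assms by blast
  show "\<forall>\<^sub>F n in sequentially. norm (tr (f n) - tr T) \<le> norm (f n - T)"
    using tr_abs_le_norm[of "f _ - T"] assms(1) T by (simp add: tr_diff A_diff)
  show "(\<lambda>n. norm (f n - T)) \<longlonglongrightarrow> 0"
    using assms(2) by (simp add: LIM_zero tendsto_norm_zero)
qed

text \<open>Noncommuting nonnegative factors need not have a nonnegative product, but traciality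
  moves one root of \<open>T\<close> to the front and leaves a conjugation of
  \<open>S\<close>.\<close>

lemma tr_comp_nonneg:
  assumes "S \<in> A" "T \<in> A" "nonneg_op S" "nonneg_op T" shows "0 \<le> tr (S \<circ>\<^sub>L T)"
proof -
  let ?R = "op_sqrt T"
  have R: "?R \<in> A" "self_adjoint ?R" "?R \<circ>\<^sub>L ?R = T"
    using assms by (auto simp: A_op_sqrt nonneg_op_sqrt nonneg_self_adjoint op_sqrt_comp_self)
  have "tr (S \<circ>\<^sub>L T) = tr ((S \<circ>\<^sub>L ?R) \<circ>\<^sub>L ?R)"
    by (simp add: comp_assoc R(3))
  also have "\<dots> = tr (?R \<circ>\<^sub>L (S \<circ>\<^sub>L ?R))"
    by (intro tr_commute A_comp assms R)
  also have "\<dots> = tr (?R \<circ>\<^sub>L S \<circ>\<^sub>L ?R)"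
    by (simp add: comp_assoc)
  finally show ?thesis
    using tr_nonneg[OF _ nonneg_conj[OF assms(3) R(2)]] A_comp assms R by simp
qed

end

section \<open>Distributions of self-adjoint elements\<close>

lemma poly_approximation:
  fixes f :: "real \<Rightarrow> real"
  assumes "continuous_on {a..b} f" "e > 0"
  obtains p where "\<And>x. x \<in> {a..b} \<Longrightarrow> \<bar>f x - poly p x\<bar> < e"
proof -
  obtain g where g: "real_polynomial_function g" "\<And>x. x \<in> {a..b} \<Longrightarrow> \<bar>f x - g x\<bar> < e"
    using Stone_Weierstrass_real_polynomial_function[OF compact_Icc assms] by blast
  then obtain c n where "g = (\<lambda>x. \<Sum>i\<le>n. c i * x ^ i)"
    using real_polynomial_function_iff_sum by blast
  then have "g x = poly (\<Sum>i\<le>n. monom (c i) i) x" for x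
    by (simp add: poly_sum poly_monom)
  then show ?thesis
    using that g(2) by metis
qed

locale bounded_distribution = prob_space \<mu> for \<mu> :: "real measure" +
  fixes a b :: real
  assumes sets_eq [measurable_cong]: "sets \<mu> = sets borel"
    and AE_range: "AE t in \<mu>. t \<in> {a..b}"
begin

lemma integrable_bounded_on:
  fixes f :: "real \<Rightarrow> real"
  assumes "f \<in> borel_measurable borel" "\<And>t. t \<in> {a..b} \<Longrightarrow> \<bar>f t\<bar> \<le> K"
  shows "integrable \<mu> f"
proof (rule integrable_const_bound[where B = K])
  show "AE t in \<mu>. norm (f t) \<le> K"
    using AE_range by eventually_elim (use assms(2) in auto)
  show "f \<in> borel_measurable \<mu>"
    using assms(1) by measurable
qed

lemma integrable_continuous:
  fixes f :: "real \<Rightarrow> real"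
  assumes "f \<in> borel_measurable borel" "continuous_on {a..b} f"
  shows "integrable \<mu> f"
proof -
  have "bounded (f ` {a..b})"
    using compact_continuous_image[OF assms(2)] compact_imp_bounded by blast
  then obtain K where "\<forall>x\<in>f ` {a..b}. norm x \<le> K"
    unfolding bounded_iff by blast
  then show ?thesis
    by (intro integrable_bounded_on[OF assms(1), of K]) simp
qed

lemma poly_measurable: "poly p \<in> borel_measurable borel" for p :: "real poly"
  by (intro borel_measurable_continuous_onI continuous_intros)

lemma integrable_poly: "integrable \<mu> (poly p)"
  by (intro integrable_continuous poly_measurable continuous_intros)

lemma integral_mono_on:
  fixes f :: "real \<Rightarrow> real"
  assumes "integrable \<mu> f" "integrable \<mu> g" "\<And>t. t \<in> {a..b} \<Longrightarrow> f t \<le> g t"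
  shows "(\<integral>t. f t \<partial>\<mu>) \<le> (\<integral>t. g t \<partial>\<mu>)"
proof (rule integral_mono_AE[OF assms(1,2)])
  show "AE t in \<mu>. f t \<le> g t"
    using AE_range by eventually_elim (rule assms(3))
qed

lemma integral_cong_on:
  fixes f :: "real \<Rightarrow> real"
  assumes "f \<in> borel_measurable borel" "g \<in> borel_measurable borel" "\<And>t. t \<in> {a..b} \<Longrightarrow> f t = g t"
  shows "(\<integral>t. f t \<partial>\<mu>) = (\<integral>t. g t \<partial>\<mu>)"
proof (rule integral_cong_AE)
  show "AE t in \<mu>. f t = g t"
    using AE_range by eventually_elim (rule assms(3))
qed (use assms(1,2) in measurable)

lemma integral_abs_le:
  fixes f :: "real \<Rightarrow> real"
  assumes "f \<in> borel_measurable borel" "\<And>t. t \<in> {a..b} \<Longrightarrow> \<bar>f t\<bar> \<le> K"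
  shows "\<bar>\<integral>t. f t \<partial>\<mu>\<bar> \<le> K"
proof -
  have f: "integrable \<mu> f"
    by (rule integrable_bounded_on[OF assms])
  have "(\<integral>t. f t \<partial>\<mu>) \<le> (\<integral>t. K \<partial>\<mu>)"
    using assms(2) by (intro integral_mono_on[OF f]) (auto simp: abs_le_iff)
  moreover have "(\<integral>t. - K \<partial>\<mu>) \<le> (\<integral>t. f t \<partial>\<mu>)"
    using assms(2) by (intro integral_mono_on[OF _ f]) (auto simp: abs_le_iff minus_le_iff)
  ultimately show ?thesis
    using prob_space by simp
qed

lemma range_nonempty: "a \<le> b"
proof (rule ccontr)
  assume "\<not> a \<le> b"
  have "AE t in \<mu>. False"
    using AE_range by (rule eventually_mono) (use \<open>\<not> a \<le> b\<close> in auto)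
  then show False
    by (simp add: AE_False)
qed

end

text \<open>The part of the compact carrier lying in the closed half-line is covered by finitely many open
  null sets; what remains is compact in the open half-line.\<close>

lemma positive_distribution_bounded:
  assumes "has_distribution \<phi> X \<mu>" "measure_support \<mu> \<subseteq> {0<..}"
  obtains a b where "0 < a" "bounded_distribution \<mu> a b"
proof -
  obtain K where K: "compact K" "emeasure \<mu> (- K) = 0" and ps: "prob_space \<mu>"
    and sets: "sets \<mu> = sets borel"
    using assms(1) by (auto simp: has_distribution_def)
  interpret prob_space \<mu> by (rule ps)
  let ?G = "{G. open G \<and> emeasure \<mu> G = 0}"
  have "K \<inter> {..0} \<subseteq> \<Union>?G"
  proof
    fix x assume "x \<in> K \<inter> {..0}"
    then have "x \<notin> measure_support \<mu>"
      using assms(2) by auto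
    then show "x \<in> \<Union>?G"
      by (auto simp: measure_support_def)
  qed
  then obtain D where D: "D \<subseteq> ?G" "finite D" "K \<inter> {..0} \<subseteq> \<Union>D"
    using compactE[of "K \<inter> {..0}" ?G] K(1) by (metis (no_types, lifting) closed_atMost compact_Int_closed mem_Collect_eq)
  have "- K \<in> null_sets \<mu>"
    using K by (simp add: null_sets_def sets compact_imp_closed)
  moreover have "(\<Union>G\<in>D. G) \<in> null_sets \<mu>"
    using D(1) by (intro null_sets_UN' countable_finite D(2)) (auto simp: null_sets_def sets)
  ultimately have "AE t in \<mu>. t \<notin> - K" "AE t in \<mu>. t \<notin> \<Union>D"
    using AE_not_in[of "- K" \<mu>] AE_not_in[of "\<Union>D" \<mu>] by simp_all
  then have ae: "AE t in \<mu>. t \<in> K - \<Union>D"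
    by eventually_elim simp
  have cp: "compact (K - \<Union>D)"
    using K(1) D(1) by (intro compact_diff open_Union) auto
  have ne: "K - \<Union>D \<noteq> {}"
  proof
    assume "K - \<Union>D = {}"
    have "AE t in \<mu>. False"
      using ae by (rule eventually_mono) (simp add: \<open>K - \<Union>D = {}\<close>)
    then show False by (simp add: AE_False)
  qed
  obtain a where a: "a \<in> K - \<Union>D" "\<And>t. t \<in> K - \<Union>D \<Longrightarrow> a \<le> t"
    using compact_attains_inf[OF cp ne] by blast
  obtain b where b: "\<And>t. t \<in> K - \<Union>D \<Longrightarrow> t \<le> b"
    using compact_attains_sup[OF cp ne] by blast
  have "0 < a"
  proof (rule ccontr)
    assume "\<not> 0 < a"
    then have "a \<in> \<Union>D"
      using a(1) by (intro subsetD[OF D(3)]) simp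
    then show False
      using a(1) by simp
  qed
  moreover have "bounded_distribution \<mu> a b"
  proof
    show "AE t in \<mu>. t \<in> {a..b}"
      using ae by eventually_elim (use a b in auto)
  qed (rule sets)
  ultimately show ?thesis
    using that by blast
qed

context W_star_probability_space
begin

lemma has_distribution_opoly:
  assumes "X \<in> A" "bounded_distribution \<mu> a b" "has_distribution \<phi> X \<mu>"
  shows "tr (opoly p X) = (\<integral>t. poly p t \<partial>\<mu>)"
proof -
  interpret bounded_distribution \<mu> a b by fact
  have pow: "op_power X n \<in> A" for n
    using A_opoly[OF assms(1), of "monom 1 n"] by (simp add: opoly_monom)
  \<comment> \<open>The extra power \<open>k\<close> lets the induction over the coefficients absorb
    the factor \<open>X\<close> of each Horner step.\<close>
  have "tr (op_power X k \<circ>\<^sub>L opoly p X) = (\<integral>t. t ^ k * poly p t \<partial>\<mu>)" for k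
  proof (induction p arbitrary: k)
    case (pCons c p)
    have Suc: "op_power X k \<circ>\<^sub>L X = op_power X (Suc k)"
      using opoly_mult[of "monom 1 k" "monom 1 1" X]
      by (simp add: opoly_monom mult_monom) (simp add: op_power_def)
    have "op_power X k \<circ>\<^sub>L opoly (pCons c p) X = c *\<^sub>R op_power X k + op_power X (Suc k) \<circ>\<^sub>L opoly p X"
      by (simp add: comp_add_right comp_scaleR_right flip: Suc) (simp add: comp_assoc)
    then have "tr (op_power X k \<circ>\<^sub>L opoly (pCons c p) X)
        = c * tr (op_power X k) + (\<integral>t. t ^ Suc k * poly p t \<partial>\<mu>)"
      by (simp add: tr_add tr_scaleR pow A_intros assms(1) pCons.IH)
    also have "tr (op_power X k) = (\<integral>t. t ^ k \<partial>\<mu>)"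
      using assms(3) by (simp add: has_distribution_def tr_def)
    also have "c * (\<integral>t. t ^ k \<partial>\<mu>) + (\<integral>t. t ^ Suc k * poly p t \<partial>\<mu>)
        = (\<integral>t. c * t ^ k + t ^ Suc k * poly p t \<partial>\<mu>)"
    proof (subst Bochner_Integration.integral_add)
      show "integrable \<mu> (\<lambda>t. c * t ^ k)" "integrable \<mu> (\<lambda>t. t ^ Suc k * poly p t)"
        by (intro integrable_continuous borel_measurable_continuous_onI continuous_intros)+
    qed simp
    also have "\<dots> = (\<integral>t. t ^ k * poly (pCons c p) t \<partial>\<mu>)"
      by (simp add: algebra_simps)
    finally show ?case .
  qed simp
  from this[of 0] show ?thesis
    by (simp add: op_power_def)
qed

text \<open>Writing \<open>X - a\<close> as a limit, in the norm of the trace, of squares of polynomials in \<open>X\<close> shows that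
  \<open>T = X - a\<close> pairs nonnegatively with \<open>Z\<^sup>2\<close> for \<open>Z = |T| - T\<close>; but \<open>T Z\<^sup>2 = - Z |T| Z\<close>, so \<open>Z = 0\<close>.\<close>

lemma nonneg_of_distribution:
  assumes "X \<in> A" "self_adjoint X" "bounded_distribution \<mu> a b" "has_distribution \<phi> X \<mu>"
  shows "nonneg_op (X - a *\<^sub>R id_blinfun)"
proof -
  interpret bounded_distribution \<mu> a b by fact
  define T where "T = X - a *\<^sub>R id_blinfun"
  have T: "T \<in> A" "self_adjoint T"
    by (auto simp: T_def intro!: A_intros assms self_adjoint_diff self_adjoint_scaleR)
  have pair: "0 \<le> tr (T \<circ>\<^sub>L Q)" if Q: "Q \<in> A" "nonneg_op Q" for Q
  proof (rule ccontr)
    assume neg: "\<not> 0 \<le> tr (T \<circ>\<^sub>L Q)"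
    have "tr (Q \<circ>\<^sub>L Q) \<ge> 0"
      by (intro tr_comp_nonneg Q)
    \<comment> \<open>Makes \<open>e * sqrt (tr (Q \<circ>\<^sub>L Q))\<close> strictly smaller than
      \<open>- tr (T \<circ>\<^sub>L Q)\<close>, so that an approximation error of size
      \<open>e\<close> cannot hide a negative pairing.\<close>
    define e where "e = - tr (T \<circ>\<^sub>L Q) / (1 + sqrt (tr (Q \<circ>\<^sub>L Q)))"
    have e: "e > 0" "e * (1 + sqrt (tr (Q \<circ>\<^sub>L Q))) = - tr (T \<circ>\<^sub>L Q)"
      using neg \<open>tr (Q \<circ>\<^sub>L Q) \<ge> 0\<close> by (auto simp: e_def add_pos_nonneg divide_neg_pos)
        (smt (verit) real_sqrt_ge_zero)
    \<comment> \<open>For \<open>r \<le> 1\<close>, \<open>M\<close> bounds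
      \<open>sqrt (t - a) + poly v t\<close>; the error of the squared approximation is then at most
      \<open>r * M\<close>, hence at most \<open>e\<close>.\<close>
    define M where "M = 2 * (sqrt (b - a) + 1)"
    define r where "r = min 1 (e / M)"
    have "M > 0"
      using range_nonempty by (simp add: M_def add_nonneg_pos)
    then have r: "r > 0" "r \<le> 1" "r * M \<le> e"
      using e(1) by (auto simp: r_def field_simps min_def)
    have "continuous_on {a..b} (\<lambda>t. sqrt (t - a))"
      by (intro continuous_intros)
    then obtain v where v: "\<And>t. t \<in> {a..b} \<Longrightarrow> \<bar>sqrt (t - a) - poly v t\<bar> < r"
      using poly_approximation r(1) by blast
    let ?d = "[:-a, 1:] - v * v"
    have d: "\<bar>poly ?d t\<bar> \<le> e" if t: "t \<in> {a..b}" for t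
    proof -
      let ?s = "sqrt (t - a)"
      have s: "0 \<le> ?s" "?s \<le> sqrt (b - a)" "?s * ?s = t - a"
        using t by auto
      have "\<bar>poly ?d t\<bar> = \<bar>?s - poly v t\<bar> * \<bar>?s + poly v t\<bar>"
        using s(3) by (simp add: algebra_simps flip: abs_mult)
      also have "\<dots> \<le> r * M"
      proof (rule mult_mono)
        show "\<bar>?s - poly v t\<bar> \<le> r"
          using v[OF t] by simp
        have "?s - poly v t < r" "poly v t - ?s < r"
          using v[OF t] by (auto simp: abs_less_iff)
        then show "\<bar>?s + poly v t\<bar> \<le> M"
          using s(1,2) r(2) unfolding M_def by (intro abs_leI) argo+
      qed (use r in auto)
      finally show ?thesis
        using r(3) by simp
    qed
    have "\<bar>poly (?d * ?d) t\<bar> \<le> e\<^sup>2" if "t \<in> {a..b}" for t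
      using mult_mono[OF d[OF that] d[OF that]] e(1)
      by (simp only: poly_mult[of ?d ?d] abs_mult power2_eq_square)
    then have "\<bar>\<integral>t. poly (?d * ?d) t \<partial>\<mu>\<bar> \<le> e\<^sup>2"
      by (intro integral_abs_le poly_measurable)
    then have "tr (opoly ?d X \<circ>\<^sub>L opoly ?d X) \<le> e\<^sup>2"
      using has_distribution_opoly[OF assms(1,3,4), of "?d * ?d"] by (simp only: opoly_mult)
    then have "(tr (opoly ?d X \<circ>\<^sub>L Q))\<^sup>2 \<le> e\<^sup>2 * tr (Q \<circ>\<^sub>L Q)"
      using tr_Cauchy_Schwarz_self_adjoint[of "opoly ?d X" Q] A_opoly[OF assms(1), of ?d]
        self_adjoint_opoly[OF assms(2), of ?d] Q nonneg_self_adjoint[OF Q(2)]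
        mult_right_mono[OF _ \<open>tr (Q \<circ>\<^sub>L Q) \<ge> 0\<close>] order_trans
      by blast
    then have "\<bar>tr (opoly ?d X \<circ>\<^sub>L Q)\<bar> \<le> e * sqrt (tr (Q \<circ>\<^sub>L Q))"
      using e(1) real_sqrt_le_mono[of "(tr (opoly ?d X \<circ>\<^sub>L Q))\<^sup>2" "e\<^sup>2 * tr (Q \<circ>\<^sub>L Q)"]
      by (simp add: real_sqrt_mult)
    also have "\<dots> < - tr (T \<circ>\<^sub>L Q)"
      using e by (simp add: algebra_simps)
    finally have "\<bar>tr (opoly ?d X \<circ>\<^sub>L Q)\<bar> < - tr (T \<circ>\<^sub>L Q)" .
    moreover have "opoly ?d X = T - opoly v X \<circ>\<^sub>L opoly v X"
      by (simp add: T_def)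
    moreover have "tr ((T - opoly v X \<circ>\<^sub>L opoly v X) \<circ>\<^sub>L Q) = tr (T \<circ>\<^sub>L Q) - tr ((opoly v X \<circ>\<^sub>L opoly v X) \<circ>\<^sub>L Q)"
      by (simp add: comp_diff_left tr_diff A_intros T Q assms(1))
    moreover have "0 \<le> tr ((opoly v X \<circ>\<^sub>L opoly v X) \<circ>\<^sub>L Q)"
      by (intro tr_comp_nonneg A_intros assms(1) Q nonneg_square self_adjoint_opoly assms(2))
    ultimately show False
      by simp
  qed
  have sq: "nonneg_op (T \<circ>\<^sub>L T)" "T \<circ>\<^sub>L T \<in> A"
    by (intro nonneg_square T A_comp)+
  define R where "R = op_sqrt (T \<circ>\<^sub>L T)"
  have R: "R \<in> A" "nonneg_op R" "R \<circ>\<^sub>L R = T \<circ>\<^sub>L T" "R \<circ>\<^sub>L T = T \<circ>\<^sub>L R"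
    unfolding R_def using sq
    by (auto intro: A_op_sqrt nonneg_op_sqrt op_sqrt_comp_self op_sqrt_commute simp: comp_assoc)
  define Z where "Z = R - T"
  have Z: "Z \<in> A" "self_adjoint Z"
    unfolding Z_def by (intro A_diff R T self_adjoint_diff nonneg_self_adjoint)+
  have RZ: "R \<circ>\<^sub>L Z = Z \<circ>\<^sub>L R" and TZ: "T \<circ>\<^sub>L Z = - (R \<circ>\<^sub>L Z)"
    by (simp_all add: Z_def comp_ring R(3,4))
  have ZRZ: "nonneg_op (Z \<circ>\<^sub>L R \<circ>\<^sub>L Z)" "Z \<circ>\<^sub>L R \<circ>\<^sub>L Z \<in> A"
    by (intro nonneg_conj A_comp R Z)+
  have eq: "T \<circ>\<^sub>L (Z \<circ>\<^sub>L Z) = - (Z \<circ>\<^sub>L R \<circ>\<^sub>L Z)"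
    by (simp only: comp_cong_left[OF TZ] comp_minus_left RZ)
  have "0 \<le> tr (T \<circ>\<^sub>L (Z \<circ>\<^sub>L Z))"
    by (intro pair A_comp Z nonneg_square)
  then have "tr (Z \<circ>\<^sub>L R \<circ>\<^sub>L Z) = 0"
    using tr_nonneg[OF ZRZ(2,1)] tr_scaleR[OF ZRZ(2), of "-1"] by (simp add: eq)
  then have 0: "Z \<circ>\<^sub>L R \<circ>\<^sub>L Z = 0"
    by (rule tr_faithful[OF ZRZ(2,1)])
  have "(R \<circ>\<^sub>L Z) \<circ>\<^sub>L (R \<circ>\<^sub>L Z) = R \<circ>\<^sub>L (Z \<circ>\<^sub>L R \<circ>\<^sub>L Z)"
    by (simp add: comp_assoc)
  then have "R \<circ>\<^sub>L Z = 0"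
    using self_adjoint_comp_self_zero[OF self_adjoint_comp[OF nonneg_self_adjoint[OF R(2)] Z(2) RZ]] 0
    by simp
  then have "Z \<circ>\<^sub>L Z = 0"
    using TZ by (simp add: Z_def comp_diff_left)
  then have "Z = 0"
    using self_adjoint_comp_self_zero[OF Z(2)] by blast
  then show ?thesis
    using R(2) by (simp add: Z_def T_def)
qed

text \<open>Moments only speak about polynomials. If \<open>r\<close> is uniformly close to
  \<open>1 / d\<close>, then \<open>1 - d * r\<close> is small in the norm of the trace, and
  multiplying it by the inverse \<open>?S\<close> gives \<open>?S\<close> minus
  \<open>opoly r X\<close>; Cauchy-Schwarz bounds the trace of this difference.\<close>

lemma tr_op_inverse_opoly:
  assumes "X \<in> A" "self_adjoint X" "bounded_distribution \<mu> a b" "has_distribution \<phi> X \<mu>"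
    and d: "invertible_op (opoly d X)" "\<And>t. t \<in> {a..b} \<Longrightarrow> poly d t \<noteq> 0"
  shows "tr (op_inverse (opoly d X)) = (\<integral>t. 1 / poly d t \<partial>\<mu>)"
proof -
  interpret bounded_distribution \<mu> a b by fact
  let ?D = "opoly d X"
  let ?S = "op_inverse ?D"
  have DA: "?D \<in> A"
    by (intro A_opoly assms)
  have S: "?S \<in> A" "self_adjoint ?S"
    by (intro A_op_inverse A_opoly self_adjoint_op_inverse self_adjoint_opoly assms)+
  have meas: "(\<lambda>t. 1 / poly d t) \<in> borel_measurable borel"
    using poly_measurable[of d] by measurable
  have cont: "continuous_on {a..b} (\<lambda>t. 1 / poly d t)"
    using d(2) by (intro continuous_intros) auto
  have "bounded (poly d ` {a..b})"
    by (intro compact_imp_bounded compact_continuous_image continuous_intros) simp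
  then obtain M where "\<forall>x\<in>poly d ` {a..b}. norm x \<le> M"
    unfolding bounded_iff by blast
  then have M: "\<bar>poly d t\<bar> \<le> M" if "t \<in> {a..b}" for t
    using that by simp
  have "M \<ge> 0"
    using M[of a] range_nonempty by simp
  define C where "C = M * sqrt (tr (?S \<circ>\<^sub>L ?S)) + 1"
  have bound: "\<bar>tr ?S - (\<integral>t. 1 / poly d t \<partial>\<mu>)\<bar> \<le> C * e" if e: "e > 0" for e
  proof -
    obtain r where r: "\<And>t. t \<in> {a..b} \<Longrightarrow> \<bar>1 / poly d t - poly r t\<bar> < e"
      using poly_approximation[OF cont e] by blast
    let ?q = "1 - d * r"
    have q: "\<bar>poly ?q t\<bar> \<le> M * e" if t: "t \<in> {a..b}" for t
    proof -
      have "poly ?q t = poly d t * (1 / poly d t - poly r t)"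
        using d(2)[OF t] by (simp add: algebra_simps)
      then have "\<bar>poly ?q t\<bar> = \<bar>poly d t\<bar> * \<bar>1 / poly d t - poly r t\<bar>"
        by (simp only: abs_mult)
      also have "\<dots> \<le> M * e"
        using M[OF t] r[OF t] by (intro mult_mono) auto
      finally show ?thesis .
    qed
    have "\<bar>poly (?q * ?q) t\<bar> \<le> (M * e)\<^sup>2" if "t \<in> {a..b}" for t
      using mult_mono[OF q[OF that] q[OF that]] \<open>M \<ge> 0\<close> e
      by (simp only: poly_mult[of ?q ?q] abs_mult power2_eq_square) simp
    then have "\<bar>\<integral>t. poly (?q * ?q) t \<partial>\<mu>\<bar> \<le> (M * e)\<^sup>2"
      by (intro integral_abs_le poly_measurable)
    then have q2: "tr (opoly ?q X \<circ>\<^sub>L opoly ?q X) \<le> (M * e)\<^sup>2"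
      using has_distribution_opoly[OF assms(1,3,4), of "?q * ?q"] by (simp only: opoly_mult)
    have "?S \<circ>\<^sub>L opoly ?q X = ?S - opoly r X"
      by (simp add: comp_diff_right comp_cong_left[OF op_inverse_left[OF d(1)]])
    then have "tr ?S - tr (opoly r X) = tr (?S \<circ>\<^sub>L opoly ?q X)"
      by (simp add: tr_diff S A_opoly assms(1))
    moreover have "(tr (?S \<circ>\<^sub>L opoly ?q X))\<^sup>2 \<le> tr (?S \<circ>\<^sub>L ?S) * tr (opoly ?q X \<circ>\<^sub>L opoly ?q X)"
      by (intro tr_Cauchy_Schwarz_self_adjoint S A_opoly self_adjoint_opoly assms)
    moreover have "\<dots> \<le> tr (?S \<circ>\<^sub>L ?S) * (M * e)\<^sup>2"
      by (intro mult_left_mono q2 tr_nonneg nonneg_square A_comp S)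
    ultimately have "(tr ?S - tr (opoly r X))\<^sup>2 \<le> tr (?S \<circ>\<^sub>L ?S) * (M * e)\<^sup>2"
      by simp
    then have "\<bar>tr ?S - tr (opoly r X)\<bar> \<le> M * sqrt (tr (?S \<circ>\<^sub>L ?S)) * e"
      using real_sqrt_le_mono[of "(tr ?S - tr (opoly r X))\<^sup>2" "tr (?S \<circ>\<^sub>L ?S) * (M * e)\<^sup>2"] \<open>M \<ge> 0\<close> e
      by (simp add: real_sqrt_mult mult_ac)
    moreover have "\<bar>(\<integral>t. 1 / poly d t \<partial>\<mu>) - tr (opoly r X)\<bar> \<le> e"
    proof -
      have "(\<integral>t. 1 / poly d t \<partial>\<mu>) - tr (opoly r X) = (\<integral>t. 1 / poly d t - poly r t \<partial>\<mu>)"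
        unfolding has_distribution_opoly[OF assms(1,3,4)]
        by (intro Bochner_Integration.integral_diff[symmetric] integrable_continuous meas cont integrable_poly)
      also have "\<bar>\<dots>\<bar> \<le> e"
      proof (rule integral_abs_le)
        show "(\<lambda>t. 1 / poly d t - poly r t) \<in> borel_measurable borel"
          by (intro borel_measurable_diff meas poly_measurable)
      qed (use r in fastforce)
      finally show ?thesis .
    qed
    ultimately show ?thesis
      by (simp add: C_def algebra_simps)
  qed
  have "C > 0"
    using \<open>M \<ge> 0\<close> tr_nonneg[OF A_comp[OF S(1) S(1)] nonneg_square[OF S(2)]]
    by (auto simp: C_def intro: add_nonneg_pos)
  have "\<bar>tr ?S - (\<integral>t. 1 / poly d t \<partial>\<mu>)\<bar> \<le> 0"
  proof (rule field_le_epsilon)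
    fix e :: real assume "e > 0"
    then show "\<bar>tr ?S - (\<integral>t. 1 / poly d t \<partial>\<mu>)\<bar> \<le> 0 + e"
      using bound[of "e / C"] \<open>C > 0\<close> by simp
  qed
  then show ?thesis by simp
qed

end

section \<open>Conditional expectations are orthogonal projections\<close>

text \<open>Bernstein polynomials as formal polynomials, so that operators can be inserted; at
  operators between \<open>0\<close> and the identity they are nonnegative.\<close>

definition bern :: "nat \<Rightarrow> nat \<Rightarrow> real poly" where
  "bern n k = smult (real (n choose k)) ([:0, 1:] ^ k * [:1, -1:] ^ (n - k))"

lemma poly_bern: "poly (bern n k) x = Bernstein n k x"
  by (simp add: bern_def Bernstein_def)

lemma sum_bern: "(\<Sum>k\<le>n. bern n k) = 1"
  by (simp add: poly_eq_poly_eq_iff[symmetric] fun_eq_iff poly_sum poly_bern)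

lemma sum_k_bern:
  assumes "n > 0" shows "(\<Sum>k\<le>n. smult (real k / real n) (bern n k)) = [:0, 1:]"
proof -
  have "(\<Sum>k\<le>n. (real k / real n) * Bernstein n k x) = x" for x
    using sum_k_Bernstein[of n x] assms by (simp add: sum_divide_distrib[symmetric])
  then show ?thesis
    by (simp add: poly_eq_poly_eq_iff[symmetric] fun_eq_iff poly_sum poly_bern)
qed

lemma sum_kk_bern:
  assumes "n > 0"
  shows "(\<Sum>k\<le>n. smult ((real k / real n)\<^sup>2) (bern n k)) = [:0, 1 / real n, 1 - 1 / real n:]"
proof -
  have "(\<Sum>k\<le>n. (real k / real n)\<^sup>2 * Bernstein n k x) = x / n + (1 - 1 / n) * x\<^sup>2" for x
  proof -
    have "(\<Sum>k\<le>n. (real k)\<^sup>2 * Bernstein n k x)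
        = (\<Sum>k\<le>n. real k * (real k - 1) * Bernstein n k x) + (\<Sum>k\<le>n. real k * Bernstein n k x)"
      unfolding sum.distrib[symmetric] by (rule sum.cong) (simp_all add: power2_eq_square algebra_simps)
    also have "\<dots> = real n * (real n - 1) * x\<^sup>2 + n * x"
      by simp
    finally have "(\<Sum>k\<le>n. (real k)\<^sup>2 * Bernstein n k x) / (real n)\<^sup>2 = x / n + (1 - 1 / n) * x\<^sup>2"
      using assms by (simp add: field_simps power2_eq_square)
    then show ?thesis
      by (simp add: sum_divide_distrib power_divide)
  qed
  then show ?thesis
    by (simp add: poly_eq_poly_eq_iff[symmetric] fun_eq_iff poly_sum poly_bern
        power2_eq_square algebra_simps)
qed

lemma opoly_opoly_commute: "opoly p T \<circ>\<^sub>L opoly q T = opoly q T \<circ>\<^sub>L opoly p T"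
  by (simp add: mult.commute flip: opoly_mult)

lemma nonneg_opoly_power: "nonneg_op (opoly p T) \<Longrightarrow> nonneg_op (opoly (p ^ k) T)"
proof (induction k)
  case (Suc k)
  then have "nonneg_op (opoly p T \<circ>\<^sub>L opoly (p ^ k) T)"
    by (intro nonneg_comp opoly_opoly_commute)
  then show ?case
    by simp
qed simp

lemma nonneg_bern:
  assumes "nonneg_op T" "nonneg_op (id_blinfun - T)" shows "nonneg_op (opoly (bern n k) T)"
proof -
  have "nonneg_op (opoly [:0, 1:] T)" "nonneg_op (opoly [:1, -1:] T)"
    using assms by (simp_all add: comp_ring)
  then have "nonneg_op (opoly ([:0, 1:] ^ k) T \<circ>\<^sub>L opoly ([:1, -1:] ^ (n - k)) T)"
    by (intro nonneg_comp nonneg_opoly_power opoly_opoly_commute)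
  then have "nonneg_op (real (n choose k) *\<^sub>R (opoly ([:0, 1:] ^ k) T \<circ>\<^sub>L opoly ([:1, -1:] ^ (n - k)) T))"
    by (intro nonneg_scaleR) simp_all
  then show ?thesis
    by (simp only: bern_def opoly_smult opoly_mult)
qed

lemma diff_plus_add_eq: "(u - y) + (u + y) = 2 *\<^sub>R u" for u y :: "'a::real_vector"
  by (simp add: scaleR_2)

context conditional_expectation
begin

lemma B_A: "T \<in> B \<Longrightarrow> T \<in> A"
  using subalgebra by blast

lemma cexp_A: "T \<in> A \<Longrightarrow> E T \<in> A"
  by (rule B_A[OF cexp_range])

lemma cexp_scaleR: "T \<in> A \<Longrightarrow> E (r *\<^sub>R T) = r *\<^sub>R E T"
  using cexp_scale[of T "complex_of_real r"] by (simp add: op_scaleC_of_real)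

lemma cexp_diff: "S \<in> A \<Longrightarrow> T \<in> A \<Longrightarrow> E (S - T) = E S - E T"
  using cexp_add[of S "(-1) *\<^sub>R T"] cexp_scaleR[of T "-1"] A_scaleR[of T "-1"] by simp

lemma cexp_unit: "E id_blinfun = id_blinfun"
  by (intro cexp_id vn_id sub_von_neumann)

lemma cexp_sum: "(\<And>i. i \<in> I \<Longrightarrow> f i \<in> A) \<Longrightarrow> E (\<Sum>i\<in>I. f i) = (\<Sum>i\<in>I. E (f i))"
proof (induction I rule: infinite_finite_induct)
  case (insert i I)
  then show ?case by (simp add: cexp_add A_sum)
qed (use cexp_scaleR[OF A_zero, of 0] in auto)

lemma tr_cexp: "T \<in> A \<Longrightarrow> tr (E T) = tr T"
  by (simp add: tr_def cexp_preserves)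

text \<open>\<open>f \<otimes> g \<mapsto> tr (E (f y) g (E y))\<close> is nonnegative on nonnegative polynomials on the unit interval,
  hence by Bernstein approximation on \<open>(s - t)\<^sup>2\<close>.\<close>

lemma cexp_contraction_unit_interval:
  assumes "y \<in> A" "nonneg_op y" "nonneg_op (id_blinfun - y)"
  shows "tr (E y \<circ>\<^sub>L E y) \<le> tr (y \<circ>\<^sub>L y)"
proof -
  define e where "e = E y"
  have e: "e \<in> A" "nonneg_op e" "nonneg_op (id_blinfun - e)"
    using assms cexp_nonneg[of y] cexp_nonneg[of "id_blinfun - y"]
    by (auto simp: e_def cexp_A cexp_diff cexp_unit A_intros)
  have key: "0 \<le> (tr (y \<circ>\<^sub>L y) - tr (e \<circ>\<^sub>L e)) + (2 * tr y - tr (y \<circ>\<^sub>L y) - tr (e \<circ>\<^sub>L e)) / real n"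
    if n: "n > 0" for n
  proof -
    \<comment> \<open>\<open>F\<close> and \<open>G\<close> are two nonnegative partitions of the
      identity: \<open>F\<close> applies \<open>E\<close> after the polynomial, \<open>G\<close>
      before it.\<close>
    define F where "F i = E (opoly (bern n i) y)" for i
    define G where "G j = opoly (bern n j) e" for j
    define q where "q = [:0, 1 / real n, 1 - 1 / real n:]"
    have mem: "F i \<in> A" "G i \<in> A" for i
      by (auto simp: F_def G_def intro!: cexp_A A_opoly assms e)
    have F: "(\<Sum>i\<le>n. c i *\<^sub>R F i) = E (opoly (\<Sum>i\<le>n. smult (c i) (bern n i)) y)" for c
      by (simp add: F_def opoly_sum cexp_sum A_scaleR A_opoly assms(1) cexp_scaleR)
    have G: "(\<Sum>i\<le>n. c i *\<^sub>R G i) = opoly (\<Sum>i\<le>n. smult (c i) (bern n i)) e" for c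
      by (simp add: G_def opoly_sum)
    have FG: "(\<Sum>i\<le>n. \<Sum>j\<le>n. c i * d j * tr (F i \<circ>\<^sub>L G j))
        = tr ((\<Sum>i\<le>n. c i *\<^sub>R F i) \<circ>\<^sub>L (\<Sum>j\<le>n. d j *\<^sub>R G j))" for c d
    proof -
      have "(\<Sum>i\<le>n. c i *\<^sub>R F i) \<circ>\<^sub>L (\<Sum>j\<le>n. d j *\<^sub>R G j)
          = (\<Sum>i\<le>n. \<Sum>j\<le>n. (c i * d j) *\<^sub>R (F i \<circ>\<^sub>L G j))"
        unfolding comp_sum_left unfolding comp_sum_right
        by (simp add: comp_scaleR_left comp_scaleR_right mult.commute)
      then show ?thesis
        by (simp add: tr_sum tr_scaleR A_sum A_scaleR A_comp mem)
    qed
    have F0: "(\<Sum>i\<le>n. 1 *\<^sub>R F i) = id_blinfun"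
      and F1: "(\<Sum>i\<le>n. (real i / real n) *\<^sub>R F i) = e"
      and F2: "(\<Sum>i\<le>n. (real i / real n)\<^sup>2 *\<^sub>R F i) = E (opoly q y)"
      unfolding F using sum_bern[of n] sum_k_bern[OF n] sum_kk_bern[OF n]
      by (simp_all add: cexp_unit e_def q_def)
    have G0: "(\<Sum>i\<le>n. 1 *\<^sub>R G i) = id_blinfun"
      and G1: "(\<Sum>i\<le>n. (real i / real n) *\<^sub>R G i) = e"
      and G2: "(\<Sum>i\<le>n. (real i / real n)\<^sup>2 *\<^sub>R G i) = opoly q e"
      unfolding G using sum_bern[of n] sum_k_bern[OF n] sum_kk_bern[OF n]
      by (simp_all add: q_def)
    have tq: "tr (opoly q z) = tr z / n + (1 - 1 / n) * tr (z \<circ>\<^sub>L z)" if "z \<in> A" for z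
      using that by (simp add: q_def comp_ring tr_add tr_scaleR A_comp A_scaleR tr_diff A_add A_diff algebra_simps)
    \<comment> \<open>Expanding the square leaves the Bernstein moments of orders \<open>0\<close>,
      \<open>1\<close> and \<open>2\<close>; the last one reproduces a square only up to the
      \<open>1 / n\<close> terms of \<open>q\<close>, which vanish in the limit.\<close>
    have "0 \<le> (\<Sum>i\<le>n. \<Sum>j\<le>n. (real i / real n - real j / real n)\<^sup>2 * tr (F i \<circ>\<^sub>L G j))"
      by (intro sum_nonneg mult_nonneg_nonneg zero_le_power2 tr_comp_nonneg mem)
        (auto simp: F_def G_def intro!: cexp_nonneg A_opoly nonneg_bern assms e)
    also have "\<dots> = (\<Sum>i\<le>n. \<Sum>j\<le>n. (real i / real n)\<^sup>2 * 1 * tr (F i \<circ>\<^sub>L G j))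
        - 2 * (\<Sum>i\<le>n. \<Sum>j\<le>n. (real i / real n) * (real j / real n) * tr (F i \<circ>\<^sub>L G j))
        + (\<Sum>i\<le>n. \<Sum>j\<le>n. 1 * (real j / real n)\<^sup>2 * tr (F i \<circ>\<^sub>L G j))"
      unfolding sum_distrib_left sum_subtractf[symmetric] sum.distrib[symmetric]
      by (intro sum.cong refl) (simp add: power2_eq_square algebra_simps)
    also have "\<dots> = tr (E (opoly q y)) - 2 * tr (e \<circ>\<^sub>L e) + tr (opoly q e)"
      unfolding FG F0 F1 F2 G0 G1 G2 by simp
    also have "tr (E (opoly q y)) = tr (opoly q y)"
      by (intro tr_cexp A_opoly assms)
    also have "tr (opoly q y) = tr y / n + (1 - 1 / n) * tr (y \<circ>\<^sub>L y)"
      by (rule tq) (fact assms)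
    also have "tr (opoly q e) = tr y / n + (1 - 1 / n) * tr (e \<circ>\<^sub>L e)"
      using tq[OF e(1)] tr_cexp[OF assms(1)] by (simp add: e_def)
    finally show ?thesis
      by (simp add: algebra_simps add_divide_distrib diff_divide_distrib)
  qed
  define D C where "D = tr (y \<circ>\<^sub>L y) - tr (e \<circ>\<^sub>L e)" and "C = 2 * tr y - tr (y \<circ>\<^sub>L y) - tr (e \<circ>\<^sub>L e)"
  have "(\<lambda>n. D + C * inverse (real (Suc n))) \<longlonglongrightarrow> D + C * 0"
    by (intro tendsto_intros LIMSEQ_inverse_real_of_nat)
  moreover have "0 \<le> D + C * inverse (real (Suc n))" for n
    using key[of "Suc n"] by (simp only: D_def C_def divide_inverse)
  ultimately have "0 \<le> D + C * 0"
    by (intro LIMSEQ_le_const) auto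
  then show ?thesis
    by (simp add: D_def e_def)
qed

text \<open>The affine change to \<open>z = (c + y) / (2 c)\<close> reduces to the unit interval. It
  commutes with \<open>E\<close>, and the linear terms agree on both sides because \<open>E\<close>
  preserves the trace.\<close>

lemma cexp_contraction:
  assumes "y \<in> A" "self_adjoint y"
  shows "tr (E y \<circ>\<^sub>L E y) \<le> tr (y \<circ>\<^sub>L y)"
proof -
  define c where "c = norm y + 1"
  have c: "c > 0" by (simp add: c_def add_nonneg_pos)
  define z where "z = (1 / (2 * c)) *\<^sub>R (c *\<^sub>R id_blinfun + y)"
  have z: "z \<in> A"
    by (auto simp: z_def intro!: A_intros assms)
  have "nonneg_op ((1 / (2 * c)) *\<^sub>R ((norm y *\<^sub>R id_blinfun + y) + id_blinfun))"
    using c by (intro nonneg_scaleR nonneg_add inner_id_diff_nonneg assms nonneg_id) auto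
  also have "(norm y *\<^sub>R id_blinfun + y) + id_blinfun = c *\<^sub>R id_blinfun + y"
    by (simp add: c_def algebra_simps)
  finally have z0: "nonneg_op z"
    by (simp only: z_def)
  have "nonneg_op ((1 / (2 * c)) *\<^sub>R ((norm y *\<^sub>R id_blinfun - y) + id_blinfun))"
    using c by (intro nonneg_scaleR nonneg_add inner_id_diff_nonneg assms nonneg_id) auto
  also have "(norm y *\<^sub>R id_blinfun - y) + id_blinfun = c *\<^sub>R id_blinfun - y"
    by (simp add: c_def algebra_simps)
  also have "(1 / (2 * c)) *\<^sub>R (c *\<^sub>R id_blinfun - y) = id_blinfun - z"
  proof -
    have "(1 / (2 * c)) *\<^sub>R (c *\<^sub>R id_blinfun - y) + z
        = (1 / (2 * c)) *\<^sub>R ((c *\<^sub>R id_blinfun - y) + (c *\<^sub>R id_blinfun + y))"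
      unfolding z_def by (rule scaleR_add_right[symmetric])
    also have "(c *\<^sub>R id_blinfun - y) + (c *\<^sub>R id_blinfun + y) = (2 * c) *\<^sub>R id_blinfun"
      by (simp only: diff_plus_add_eq scaleR_scaleR)
    finally have "(1 / (2 * c)) *\<^sub>R (c *\<^sub>R id_blinfun - y) + z = id_blinfun"
      using c by simp
    then show ?thesis
      by (simp only: eq_diff_eq)
  qed
  finally have z1: "nonneg_op (id_blinfun - z)" .
  have sq: "tr (((1 / (2 * c)) *\<^sub>R (c *\<^sub>R id_blinfun + w)) \<circ>\<^sub>L ((1 / (2 * c)) *\<^sub>R (c *\<^sub>R id_blinfun + w)))
      = (1 / (2 * c))\<^sup>2 * (c\<^sup>2 + 2 * c * tr w + tr (w \<circ>\<^sub>L w))" if "w \<in> A" for w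
  proof -
    have "((1 / (2 * c)) *\<^sub>R (c *\<^sub>R id_blinfun + w)) \<circ>\<^sub>L ((1 / (2 * c)) *\<^sub>R (c *\<^sub>R id_blinfun + w))
        = (1 / (2 * c))\<^sup>2 *\<^sub>R (c\<^sup>2 *\<^sub>R id_blinfun + (2 * c) *\<^sub>R w + w \<circ>\<^sub>L w)"
      by (simp add: comp_ring power2_eq_square algebra_simps) (simp add: scaleR_add_left[symmetric])
    then show ?thesis
      using that by (simp add: tr_add tr_scaleR A_intros)
  qed
  have Ez: "E z = (1 / (2 * c)) *\<^sub>R (c *\<^sub>R id_blinfun + E y)"
    by (simp add: z_def cexp_scaleR cexp_add cexp_unit A_intros assms)
  have "tr (E z \<circ>\<^sub>L E z) \<le> tr (z \<circ>\<^sub>L z)"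
    by (rule cexp_contraction_unit_interval[OF z z0 z1])
  then have "(1 / (2 * c))\<^sup>2 * (c\<^sup>2 + 2 * c * tr (E y) + tr (E y \<circ>\<^sub>L E y))
      \<le> (1 / (2 * c))\<^sup>2 * (c\<^sup>2 + 2 * c * tr y + tr (y \<circ>\<^sub>L y))"
    unfolding Ez unfolding z_def by (simp only: sq assms cexp_A)
  then have "c\<^sup>2 + 2 * c * tr (E y) + tr (E y \<circ>\<^sub>L E y) \<le> c\<^sup>2 + 2 * c * tr y + tr (y \<circ>\<^sub>L y)"
    by (rule mult_left_le_imp_le) (use c in simp)
  then show ?thesis
    by (simp add: tr_cexp assms)
qed

text \<open>Contraction is applied to \<open>w + t b\<close>, where \<open>w = v - c\<close> lies in
  the kernel of \<open>E\<close>. The terms quadratic in \<open>t\<close> cancel, so an affine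
  function of \<open>t\<close> is bounded below and its slope, twice \<open>tr (w b)\<close>, is
  zero. This is the instance of the bimodule property that the regression conditions call
  for.\<close>

lemma tr_comp_cexp_scalar:
  assumes "v \<in> A" "self_adjoint v" "E v = c *\<^sub>R id_blinfun" "b \<in> B" "self_adjoint b"
  shows "tr (v \<circ>\<^sub>L b) = c * tr b"
proof -
  define w where "w = v - c *\<^sub>R id_blinfun"
  have b: "b \<in> A"
    by (rule B_A) fact
  have w: "w \<in> A" "self_adjoint w" "E w = 0"
    using assms by (simp_all add: w_def cexp_diff cexp_scaleR cexp_unit A_id A_scaleR A_diff
        self_adjoint_diff self_adjoint_scaleR)
  have "0 \<le> tr (w \<circ>\<^sub>L w) + 2 * tr (w \<circ>\<^sub>L b) * t + 0 * t\<^sup>2" for t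
  proof -
    let ?y = "w + t *\<^sub>R b"
    have "E ?y = t *\<^sub>R b"
      by (simp add: cexp_add cexp_scaleR w b A_scaleR cexp_id assms(4))
    moreover have "tr (E ?y \<circ>\<^sub>L E ?y) \<le> tr (?y \<circ>\<^sub>L ?y)"
      by (intro cexp_contraction A_intros w b self_adjoint_add self_adjoint_scaleR assms)
    moreover have "?y \<circ>\<^sub>L ?y = w \<circ>\<^sub>L w + t *\<^sub>R (w \<circ>\<^sub>L b) + t *\<^sub>R (b \<circ>\<^sub>L w) + (t *\<^sub>R b) \<circ>\<^sub>L (t *\<^sub>R b)"
      by (simp add: comp_ring algebra_simps)
    ultimately have "0 \<le> tr (w \<circ>\<^sub>L w) + t * tr (w \<circ>\<^sub>L b) + t * tr (b \<circ>\<^sub>L w)"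
      by (simp add: tr_add tr_scaleR A_intros w b)
    then show ?thesis
      by (simp add: tr_commute[OF b w(1)] algebra_simps)
  qed
  from nonneg_quadratic[OF this] have "tr (w \<circ>\<^sub>L b) = 0"
    by simp
  then show ?thesis
    by (simp add: w_def comp_ring tr_diff tr_scaleR A_comp A_scaleR b assms)
qed

end

section \<open>Freeness and subordination\<close>

text \<open>The norm closure is small enough for freeness to extend to it by continuity from
  polynomials, and large enough to contain the inverses of its strictly positive elements, in
  particular the resolvents of \<open>X\<close> and of \<open>Y\<close>.\<close>

definition poly_closure :: "'h::complex_hilbert_space op \<Rightarrow> 'h op set" where
  "poly_closure X = closure (range (\<lambda>p. opoly p X))"

lemma poly_closure_sequence:
  assumes "T \<in> poly_closure X"
  obtains p where "(\<lambda>n. opoly (p n) X) \<longlonglongrightarrow> T"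
proof -
  obtain f where f: "\<forall>n. f n \<in> range (\<lambda>p. opoly p X)" "f \<longlonglongrightarrow> T"
    using assms unfolding poly_closure_def closure_sequential by blast
  from f(1) have "\<forall>n. \<exists>p. f n = opoly p X"
    by blast
  then obtain p where "\<forall>n. f n = opoly (p n) X"
    by (rule choice[THEN exE])
  then have "f = (\<lambda>n. opoly (p n) X)"
    by auto
  then show ?thesis
    using f(2) that by simp
qed

lemma poly_closure_limit:
  assumes "\<And>n. f n \<in> poly_closure X" "f \<longlonglongrightarrow> T" shows "T \<in> poly_closure X"
  using closed_sequentially[OF closed_closure] assms unfolding poly_closure_def by blast

lemma poly_closure_opoly: "opoly p X \<in> poly_closure X"
  unfolding poly_closure_def by (rule subsetD[OF closure_subset rangeI])

lemma poly_closure_id: "id_blinfun \<in> poly_closure X"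
  using poly_closure_opoly[of 1 X] by simp

lemma poly_closure_self: "X \<in> poly_closure X"
  using poly_closure_opoly[of "[:0, 1:]" X] by simp

lemma poly_closure_add:
  assumes "S \<in> poly_closure X" "T \<in> poly_closure X" shows "S + T \<in> poly_closure X"
proof -
  obtain p q where "(\<lambda>n. opoly (p n) X) \<longlonglongrightarrow> S" "(\<lambda>n. opoly (q n) X) \<longlonglongrightarrow> T"
    using poly_closure_sequence assms by metis
  then have "(\<lambda>n. opoly (p n + q n) X) \<longlonglongrightarrow> S + T"
    unfolding opoly_add by (rule tendsto_add)
  then show ?thesis
    by (rule poly_closure_limit[OF poly_closure_opoly])
qed

lemma poly_closure_comp:
  assumes "S \<in> poly_closure X" "T \<in> poly_closure X" shows "S \<circ>\<^sub>L T \<in> poly_closure X"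
proof -
  obtain p q where "(\<lambda>n. opoly (p n) X) \<longlonglongrightarrow> S" "(\<lambda>n. opoly (q n) X) \<longlonglongrightarrow> T"
    using poly_closure_sequence assms by metis
  then have "(\<lambda>n. opoly (p n * q n) X) \<longlonglongrightarrow> S \<circ>\<^sub>L T"
    unfolding opoly_mult by (rule tendsto_comp)
  then show ?thesis
    by (rule poly_closure_limit[OF poly_closure_opoly])
qed

lemma poly_closure_scaleR:
  assumes "T \<in> poly_closure X" shows "r *\<^sub>R T \<in> poly_closure X"
  using poly_closure_comp[OF poly_closure_opoly[of "[:r:]"] assms] by (simp add: comp_scaleR_left)

lemma poly_closure_diff:
  assumes "S \<in> poly_closure X" "T \<in> poly_closure X" shows "S - T \<in> poly_closure X"
  using poly_closure_add[OF assms(1) poly_closure_scaleR[OF assms(2), of "-1"]] by simp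

lemma poly_closure_op_inverse:
  assumes "T \<in> poly_closure X" "pos_op T" shows "op_inverse T \<in> poly_closure X"
proof -
  obtain c where c: "(\<lambda>n. c *\<^sub>R neumann (id_blinfun - c *\<^sub>R T) n) \<longlonglongrightarrow> op_inverse T"
    using pos_op_neumann[OF assms(2)] by blast
  have "neumann (id_blinfun - c *\<^sub>R T) n \<in> poly_closure X" for n
  proof (induction n)
    case 0
    then show ?case
      using poly_closure_opoly[of 0 X] by simp
  next
    case (Suc n)
    then show ?case
      unfolding neumann.simps
      by (intro poly_closure_add poly_closure_comp poly_closure_diff poly_closure_id
          poly_closure_scaleR assms(1))
  qed
  then show ?thesis
    by (intro poly_closure_limit[OF _ c] poly_closure_scaleR)
qed

lemma poly_closure_self_adjoint:
  assumes "self_adjoint X" "T \<in> poly_closure X" shows "self_adjoint T"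
proof -
  obtain p where "(\<lambda>n. opoly (p n) X) \<longlonglongrightarrow> T"
    using poly_closure_sequence[OF assms(2)] .
  then show ?thesis
    by (rule self_adjoint_limit[OF self_adjoint_opoly[OF assms(1)]])
qed

lemma poly_closure_commute:
  assumes "S \<in> poly_closure X" "X \<circ>\<^sub>L T = T \<circ>\<^sub>L X" shows "S \<circ>\<^sub>L T = T \<circ>\<^sub>L S"
proof -
  obtain p where p: "(\<lambda>n. opoly (p n) X) \<longlonglongrightarrow> S"
    using poly_closure_sequence[OF assms(1)] .
  have "(\<lambda>n. opoly (p n) X \<circ>\<^sub>L T) \<longlonglongrightarrow> S \<circ>\<^sub>L T" "(\<lambda>n. T \<circ>\<^sub>L opoly (p n) X) \<longlonglongrightarrow> T \<circ>\<^sub>L S"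
    by (intro tendsto_comp p tendsto_const)+
  then show ?thesis
    unfolding opoly_commute[OF assms(2)] by (rule LIMSEQ_unique)
qed

lemma opoly_unital_star_algebra:
  assumes "unital_star_algebra \<A>" "X \<in> \<A>" shows "opoly p X \<in> \<A>"
proof (induction p)
  case 0
  have "op_scaleC (complex_of_real 0) id_blinfun \<in> \<A>"
    using assms by (simp only: unital_star_algebra_def)
  then show ?case
    unfolding op_scaleC_of_real by simp
next
  case (pCons a p)
  have "op_scaleC (complex_of_real a) id_blinfun \<in> \<A>"
    using assms by (simp only: unital_star_algebra_def)
  with pCons show ?case
    using assms unfolding op_scaleC_of_real by (simp add: unital_star_algebra_def)
qed

lemma opoly_hull: "opoly p X \<in> unital_star_algebra hull {X}"
  unfolding hull_def using opoly_unital_star_algebra by auto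

definition comp_list :: "'h::complex_hilbert_space op list \<Rightarrow> 'h op" where
  "comp_list xs = foldr (o\<^sub>L) xs id_blinfun"

lemma comp_list_simps [simp]:
  "comp_list [] = id_blinfun" "comp_list (x # xs) = x \<circ>\<^sub>L comp_list xs"
  by (simp_all add: comp_list_def)

lemma comp_list_append: "comp_list (xs @ ys) = comp_list xs \<circ>\<^sub>L comp_list ys"
  by (induction xs) (simp_all add: comp_assoc)

lemma comp_list_tendsto:
  assumes "\<And>x. x \<in> set w \<Longrightarrow> (\<lambda>n. f x n) \<longlonglongrightarrow> g x"
  shows "(\<lambda>n. comp_list (map (\<lambda>x. f x n) w)) \<longlonglongrightarrow> comp_list (map g w)"
  using assms by (induction w) (auto intro: tendsto_comp)

section \<open>Alternating words in two free elements\<close>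

locale free_pair = W_star_probability_space A \<phi>
  for A :: "'h::complex_hilbert_space op set" and \<phi> :: "'h op \<Rightarrow> complex" +
  fixes X Y :: "'h op"
  assumes X_A: "X \<in> A" and Y_A: "Y \<in> A"
    and X_sa: "self_adjoint X" and Y_sa: "self_adjoint Y"
    and free: "free_variables \<phi> X Y"
begin

definition C :: "bool \<Rightarrow> 'h op set" where
  "C b = poly_closure (if b then X else Y)"

lemma C_A: assumes "T \<in> C b" shows "T \<in> A"
proof -
  obtain p where p: "(\<lambda>n. opoly (p n) (if b then X else Y)) \<longlonglongrightarrow> T"
    using poly_closure_sequence[OF assms[unfolded C_def]] .
  then show ?thesis
    using X_A Y_A by (intro A_limit[OF A_opoly p]) auto
qed

lemma C_self_adjoint: "T \<in> C b \<Longrightarrow> self_adjoint T"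
  using poly_closure_self_adjoint X_sa Y_sa by (cases b) (auto simp: C_def)

lemma C_id: "id_blinfun \<in> C b"
  and C_add: "S \<in> C b \<Longrightarrow> T \<in> C b \<Longrightarrow> S + T \<in> C b"
  and C_diff: "S \<in> C b \<Longrightarrow> T \<in> C b \<Longrightarrow> S - T \<in> C b"
  and C_comp: "S \<in> C b \<Longrightarrow> T \<in> C b \<Longrightarrow> S \<circ>\<^sub>L T \<in> C b"
  and C_scaleR: "T \<in> C b \<Longrightarrow> r *\<^sub>R T \<in> C b"
  unfolding C_def
  by (fact poly_closure_id poly_closure_add poly_closure_diff poly_closure_comp poly_closure_scaleR)+

definition centered :: "bool \<Rightarrow> 'h op \<Rightarrow> bool" where
  "centered b a \<longleftrightarrow> a \<in> C b \<and> tr a = 0"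

lemma centered_A: "centered b a \<Longrightarrow> a \<in> A"
  by (auto simp: centered_def intro: C_A)

lemma centered_diff_tr: "a \<in> C b \<Longrightarrow> centered b (a - tr a *\<^sub>R id_blinfun)"
  by (simp add: centered_def C_diff C_scaleR C_id tr_diff tr_scaleR C_A A_id A_scaleR)

definition alternating :: "(bool \<times> 'h op) list \<Rightarrow> bool" where
  "alternating w \<longleftrightarrow> successively (\<lambda>p q. fst p \<noteq> fst q) w \<and> (\<forall>(i, a) \<in> set w. centered i a)"

text \<open>Each approximating polynomial is recentred by its own trace; continuity of the trace
  sends these corrections to \<open>tr a = 0\<close>.\<close>

lemma centered_approximation:
  assumes "centered i a"
  obtains h where "\<And>n. h n \<in> unital_star_algebra hull {if i then X else Y}" "\<And>n. \<phi> (h n) = 0"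
    "\<And>n. h n \<in> A" "h \<longlonglongrightarrow> a"
proof -
  let ?Z = "if i then X else Y"
  have Z: "?Z \<in> A" "self_adjoint ?Z"
    using X_A Y_A X_sa Y_sa by auto
  obtain p where p: "(\<lambda>n. opoly (p n) ?Z) \<longlonglongrightarrow> a"
    using assms poly_closure_sequence by (auto simp: centered_def C_def)
  define q where "q n = p n - [:tr (opoly (p n) ?Z):]" for n
  define h where "h n = opoly (q n) ?Z" for n
  have mem: "opoly r ?Z \<in> A" for r
    by (rule A_opoly[OF Z(1)])
  have h: "h n = opoly (p n) ?Z - tr (opoly (p n) ?Z) *\<^sub>R id_blinfun" for n
    by (simp add: h_def q_def)
  have "tr (h n) = 0" for n
    unfolding h by (simp add: tr_diff tr_scaleR mem A_id A_scaleR)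
  moreover have "\<phi> (h n) = complex_of_real (tr (h n))" for n
    unfolding h_def by (intro state_self_adjoint mem self_adjoint_opoly Z)
  ultimately have "\<phi> (h n) = 0" for n
    by simp
  moreover have "(\<lambda>n. tr (opoly (p n) ?Z)) \<longlonglongrightarrow> tr a"
    by (rule tr_tendsto[OF mem p])
  then have "h \<longlonglongrightarrow> a - tr a *\<^sub>R id_blinfun"
    unfolding h by (intro tendsto_intros p)
  then have "h \<longlonglongrightarrow> a"
    using assms by (simp add: centered_def)
  ultimately show ?thesis
    using that[of h] mem opoly_hull unfolding h_def by blast
qed

text \<open>Freeness is assumed for polynomials. Every letter is replaced by centred polynomials
  converging to it, and both the finite product and the trace are norm continuous.\<close>

lemma alternating_tr:
  assumes "alternating w" "w \<noteq> []" shows "tr (comp_list (map snd w)) = 0"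
proof -
  have "\<forall>x\<in>set w. \<exists>h. (\<forall>n. h n \<in> unital_star_algebra hull {if fst x then X else Y} \<and> \<phi> (h n) = 0
      \<and> h n \<in> A) \<and> h \<longlonglongrightarrow> snd x"
  proof
    fix x assume "x \<in> set w"
    then have "centered (fst x) (snd x)"
      using assms(1) by (auto simp: alternating_def)
    from centered_approximation[OF this] show "\<exists>h. (\<forall>n. h n \<in> unital_star_algebra hull
        {if fst x then X else Y} \<and> \<phi> (h n) = 0 \<and> h n \<in> A) \<and> h \<longlonglongrightarrow> snd x"
      by metis
  qed
  from bchoice[OF this] obtain H where H:
    "\<And>x n. x \<in> set w \<Longrightarrow> H x n \<in> unital_star_algebra hull {if fst x then X else Y}"
    "\<And>x n. x \<in> set w \<Longrightarrow> \<phi> (H x n) = 0" "\<And>x n. x \<in> set w \<Longrightarrow> H x n \<in> A"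
    "\<And>x. x \<in> set w \<Longrightarrow> H x \<longlonglongrightarrow> snd x"
    by blast
  let ?W = "\<lambda>n. map (\<lambda>x. (fst x, H x n)) w"
  have snd: "map snd (?W n) = map (\<lambda>x. H x n) w" for n
    by simp
  have "\<phi> (comp_list (map snd (?W n))) = 0" for n
  proof -
    have "successively (\<lambda>p q. fst p \<noteq> fst q) (?W n)"
      using assms(1) by (simp add: alternating_def successively_map)
    moreover have "\<forall>(i, a) \<in> set (?W n). a \<in> unital_star_algebra hull {if i then X else Y} \<and> \<phi> a = 0"
      using H(1,2) by auto
    ultimately show ?thesis
      using free assms(2) unfolding free_variables_def free_algebras_def comp_list_def by blast
  qed
  then have "tr (comp_list (map (\<lambda>x. H x n) w)) = 0" for n
    unfolding snd by (simp add: tr_def)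
  moreover have "(\<lambda>n. tr (comp_list (map (\<lambda>x. H x n) w))) \<longlonglongrightarrow> tr (comp_list (map snd w))"
  proof (rule tr_tendsto)
    have "comp_list xs \<in> A" if "\<forall>x\<in>set xs. x \<in> A" for xs
      using that by (induction xs) (auto intro: A_id A_comp)
    then show "comp_list (map (\<lambda>x. H x n) w) \<in> A" for n
      using H(3) by simp
    show "(\<lambda>n. comp_list (map (\<lambda>x. H x n) w)) \<longlonglongrightarrow> comp_list (map snd w)"
      by (rule comp_list_tendsto) (rule H(4))
  qed
  ultimately show ?thesis
    using LIMSEQ_unique[OF _ tendsto_const] by force
qed

text \<open>\<open>alt_null b e u\<close>: up to linear combinations, \<open>u\<close> is an alternating word whose first letter has
  index \<open>b\<close> and whose last letter has index \<open>e\<close>.\<close>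

definition alt_null :: "bool \<Rightarrow> bool \<Rightarrow> 'h op \<Rightarrow> bool" where
  "alt_null b e u \<longleftrightarrow> u \<in> A \<and>
     (\<forall>l r. alternating l \<and> alternating r \<and> (l = [] \<or> fst (last l) \<noteq> b) \<and> (r = [] \<or> fst (hd r) \<noteq> e) \<longrightarrow>
        tr (comp_list (map snd l) \<circ>\<^sub>L u \<circ>\<^sub>L comp_list (map snd r)) = 0)"

lemma alt_null_A: "alt_null b e u \<Longrightarrow> u \<in> A"
  by (simp add: alt_null_def)

lemma alternating_A: "alternating w \<Longrightarrow> comp_list (map snd w) \<in> A"
proof (induction w)
  case (Cons x w)
  then have "alternating w" "snd x \<in> A"
    using centered_A[of "fst x" "snd x"] by (auto simp: alternating_def successively_Cons)
  with Cons.IH show ?case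
    by (auto intro: A_comp)
qed (simp add: A_id)

lemma alternating_append:
  "alternating (l @ r) \<longleftrightarrow> alternating l \<and> alternating r \<and>
     (l = [] \<or> r = [] \<or> fst (last l) \<noteq> fst (hd r))"
  by (auto simp: alternating_def successively_append_iff)

lemma alternating_single: "alternating [(b, a)] \<longleftrightarrow> centered b a"
  by (simp add: alternating_def)

lemma alternating_Cons:
  "alternating ((b, a) # r) \<longleftrightarrow> centered b a \<and> alternating r \<and> (r = [] \<or> b \<noteq> fst (hd r))"
  using alternating_append[of "[(b, a)]" r] by (auto simp: alternating_single)

lemma alt_null_centered: "centered b a \<Longrightarrow> alt_null b b a"
  unfolding alt_null_def
proof (intro conjI allI impI)
  assume a: "centered b a"
  then show "a \<in> A"
    by (rule centered_A)
  fix l r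
  assume "alternating l \<and> alternating r \<and> (l = [] \<or> fst (last l) \<noteq> b) \<and> (r = [] \<or> fst (hd r) \<noteq> b)"
  then have "alternating (l @ [(b, a)] @ r)"
    using a by (auto simp: alternating_append alternating_Cons)
  from alternating_tr[OF this] show "tr (comp_list (map snd l) \<circ>\<^sub>L a \<circ>\<^sub>L comp_list (map snd r)) = 0"
    by (simp add: comp_list_append comp_assoc)
qed

lemma alt_null_add: "alt_null b e u \<Longrightarrow> alt_null b e v \<Longrightarrow> alt_null b e (u + v)"
  by (simp add: alt_null_def comp_add_left comp_add_right tr_add A_add A_comp alternating_A)

lemma alt_null_scaleR: "alt_null b e u \<Longrightarrow> alt_null b e (c *\<^sub>R u)"
  by (simp add: alt_null_def comp_scaleR_left comp_scaleR_right tr_scaleR A_scaleR A_comp alternating_A)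

lemma alt_null_left:
  assumes "centered b a" "alt_null (\<not> b) e u" shows "alt_null b e (a \<circ>\<^sub>L u)"
  unfolding alt_null_def
proof (intro conjI allI impI)
  show "a \<circ>\<^sub>L u \<in> A"
    using assms by (intro A_comp centered_A alt_null_A)
  fix l r
  assume *: "alternating l \<and> alternating r \<and> (l = [] \<or> fst (last l) \<noteq> b) \<and> (r = [] \<or> fst (hd r) \<noteq> e)"
  then have "alternating (l @ [(b, a)])"
    using assms(1) by (auto simp: alternating_append alternating_single)
  then have "tr (comp_list (map snd (l @ [(b, a)])) \<circ>\<^sub>L u \<circ>\<^sub>L comp_list (map snd r)) = 0"
    using assms(2) * unfolding alt_null_def by (metis fst_conv last_snoc)
  then show "tr (comp_list (map snd l) \<circ>\<^sub>L (a \<circ>\<^sub>L u) \<circ>\<^sub>L comp_list (map snd r)) = 0"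
    by (simp add: comp_list_append comp_assoc)
qed

lemma alt_null_right:
  assumes "centered e a" "alt_null b (\<not> e) u" shows "alt_null b e (u \<circ>\<^sub>L a)"
  unfolding alt_null_def
proof (intro conjI allI impI)
  show "u \<circ>\<^sub>L a \<in> A"
    using assms by (intro A_comp centered_A alt_null_A)
  fix l r
  assume *: "alternating l \<and> alternating r \<and> (l = [] \<or> fst (last l) \<noteq> b) \<and> (r = [] \<or> fst (hd r) \<noteq> e)"
  then have "alternating ((e, a) # r)"
    using assms(1) by (auto simp: alternating_Cons)
  then have "tr (comp_list (map snd l) \<circ>\<^sub>L u \<circ>\<^sub>L comp_list (map snd ((e, a) # r))) = 0"
    using assms(2) * unfolding alt_null_def by (metis fst_conv list.sel(1))
  then show "tr (comp_list (map snd l) \<circ>\<^sub>L (u \<circ>\<^sub>L a) \<circ>\<^sub>L comp_list (map snd r)) = 0"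
    by (simp add: comp_assoc)
qed

lemma alt_null_tr: "alt_null b e u \<Longrightarrow> tr u = 0"
  unfolding alt_null_def
  by (drule conjunct2, drule spec[of _ "[]"], drule spec[of _ "[]"]) (simp add: alternating_def)

lemma tr_comp_alt_null:
  assumes "h \<in> C b" "alt_null (\<not> b) e u" shows "tr (h \<circ>\<^sub>L u) = 0"
proof -
  let ?h = "h - tr h *\<^sub>R id_blinfun"
  have "tr (?h \<circ>\<^sub>L u) = 0"
    by (rule alt_null_tr[OF alt_null_left[OF centered_diff_tr[OF assms(1)] assms(2)]])
  moreover have "tr (?h \<circ>\<^sub>L u) = tr (h \<circ>\<^sub>L u) - tr h * tr u"
    using C_A[OF assms(1)] alt_null_A[OF assms(2)]
    by (simp add: comp_ring tr_diff tr_scaleR A_comp A_scaleR)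
  ultimately show ?thesis
    using alt_null_tr[OF assms(2)] by simp
qed

lemma tr_comp_free:
  assumes "h \<in> C b" "k \<in> C (\<not> b)" shows "tr (h \<circ>\<^sub>L k) = tr h * tr k"
proof -
  have "tr (h \<circ>\<^sub>L (k - tr k *\<^sub>R id_blinfun)) = 0"
    by (rule tr_comp_alt_null[OF assms(1) alt_null_centered[OF centered_diff_tr[OF assms(2)]]])
  then show ?thesis
    using C_A[OF assms(1)] C_A[OF assms(2)]
    by (simp add: comp_ring tr_diff tr_scaleR A_comp A_scaleR)
qed

end

section \<open>Powers of a product of two centred free elements\<close>

locale centered_pair = free_pair +
  fixes p q :: "'a op"
  assumes cp: "centered True p" and cq: "centered False q"
begin

primrec D :: "nat \<Rightarrow> 'a op" where
  "D 0 = id_blinfun"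
| "D (Suc n) = p \<circ>\<^sub>L (q \<circ>\<^sub>L D n)"

primrec D_adj :: "nat \<Rightarrow> 'a op" where
  "D_adj 0 = id_blinfun"
| "D_adj (Suc n) = (D_adj n \<circ>\<^sub>L q) \<circ>\<^sub>L p"

lemma pq_A: "p \<in> A" "q \<in> A" and pq_sa: "self_adjoint p" "self_adjoint q"
  using cp cq C_A C_self_adjoint by (auto simp: centered_def)

lemma D_A: "D n \<in> A" "D_adj n \<in> A"
  by (induction n) (auto intro: A_id A_comp pq_A)

lemma D_adjoint: "adjoint_ops (D n) (D_adj n)"
proof (induction n)
  case (Suc n)
  then show ?case
    using adjoint_ops_comp[OF _ adjoint_ops_comp[OF _ Suc]] pq_sa[THEN self_adjoint_adjoint_ops]
    by simp
qed (simp add: adjoint_ops_id)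

lemma alt_null_D: "alt_null True False (D (Suc n))"
proof (induction n)
  case 0
  show ?case
    using alt_null_left[OF cp] alt_null_centered[OF cq] by simp
next
  case (Suc n)
  have "alt_null False False (q \<circ>\<^sub>L D (Suc n))"
    by (rule alt_null_left[OF cq]) (simp add: Suc del: D.simps)
  then show ?case
    unfolding D.simps(2)[of "Suc n"] by (intro alt_null_left[OF cp]) simp
qed

lemma alt_null_qD: "alt_null False False (q \<circ>\<^sub>L D n)"
proof (cases n)
  case 0
  then show ?thesis
    using alt_null_centered[OF cq] by simp
next
  case (Suc m)
  then show ?thesis
    using alt_null_left[OF cq, of False "D n"] alt_null_D[of m] by simp
qed

text \<open>For the centred part of \<open>k\<close>, the word \<open>k D\<close> alternates and
  starts with index \<open>False\<close>. For the scalar part, \<open>h\<close> merges with the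
  leading \<open>p\<close> into one element of \<open>C True\<close>, and what follows starts with
  \<open>q\<close>.\<close>

lemma tr_comp_comp_D:
  assumes "h \<in> C True" "k \<in> C False" shows "tr (h \<circ>\<^sub>L (k \<circ>\<^sub>L D (Suc n))) = 0"
proof -
  let ?k = "k - tr k *\<^sub>R id_blinfun"
  have "alt_null False False (?k \<circ>\<^sub>L D (Suc n))"
    by (rule alt_null_left[OF centered_diff_tr[OF assms(2)]]) (simp add: alt_null_D del: D.simps)
  then have 1: "tr (h \<circ>\<^sub>L (?k \<circ>\<^sub>L D (Suc n))) = 0"
    using tr_comp_alt_null[OF assms(1)] by simp
  have "h \<circ>\<^sub>L p \<in> C True"
    using cp assms(1) by (auto simp: centered_def intro: C_comp)
  then have "tr ((h \<circ>\<^sub>L p) \<circ>\<^sub>L (q \<circ>\<^sub>L D n)) = 0"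
    using tr_comp_alt_null[of _ True False] alt_null_qD by simp
  then have 2: "tr (h \<circ>\<^sub>L D (Suc n)) = 0"
    by (simp add: comp_assoc)
  have "h \<circ>\<^sub>L (k \<circ>\<^sub>L D (Suc n)) = h \<circ>\<^sub>L (?k \<circ>\<^sub>L D (Suc n)) + tr k *\<^sub>R (h \<circ>\<^sub>L D (Suc n))"
    by (simp add: comp_ring del: D.simps)
  also have "tr \<dots> = 0"
    using C_A[OF assms(1)] C_A[OF assms(2)] D_A(1)[of "Suc n"]
    by (simp add: tr_add tr_scaleR 1 2 A_comp A_diff A_scaleR A_id del: D.simps)
  finally show ?thesis .
qed

lemma tr_D_conj_alt_null:
  assumes "alt_null False False v" shows "tr (D_adj n \<circ>\<^sub>L (v \<circ>\<^sub>L D n)) = 0"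
  using assms
proof (induction n arbitrary: v)
  case 0
  then show ?case
    using alt_null_tr by simp
next
  case (Suc n)
  have "alt_null True True (p \<circ>\<^sub>L v \<circ>\<^sub>L p)"
    by (intro alt_null_right[OF cp] alt_null_left[OF cp]) (simp add: Suc.prems)
  then have "alt_null False False (q \<circ>\<^sub>L (p \<circ>\<^sub>L v \<circ>\<^sub>L p) \<circ>\<^sub>L q)"
    by (intro alt_null_right[OF cq] alt_null_left[OF cq]) simp
  from Suc.IH[OF this] show ?case
    by (simp add: comp_assoc)
qed

text \<open>In the middle of the word, \<open>q p p q\<close> equals \<open>s * t\<close> plus a
  term \<open>v\<close> that starts and ends with index \<open>False\<close> and contributes
  nothing, so each step splits off the factor \<open>s * t\<close>. The decay is thus governed by
  the variances, whatever the operator norms of \<open>p\<close> and \<open>q\<close> are.\<close>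

lemma tr_D_adj_D: "tr (D_adj n \<circ>\<^sub>L D n) = (tr (p \<circ>\<^sub>L p) * tr (q \<circ>\<^sub>L q)) ^ n"
proof (induction n)
  case (Suc n)
  define s t where "s = tr (p \<circ>\<^sub>L p)" and "t = tr (q \<circ>\<^sub>L q)"
  define e f where "e = p \<circ>\<^sub>L p - s *\<^sub>R id_blinfun" and "f = q \<circ>\<^sub>L q - t *\<^sub>R id_blinfun"
  have e: "centered True e" and f: "centered False f"
    unfolding e_def f_def s_def t_def using cp cq
    by (auto simp: centered_def[of True p] centered_def[of False q] intro!: centered_diff_tr C_comp)
  define v where "v = s *\<^sub>R f + q \<circ>\<^sub>L e \<circ>\<^sub>L q"
  have "alt_null False True (q \<circ>\<^sub>L e)"
    using alt_null_left[OF cq, of True e] alt_null_centered[OF e] by simp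
  then have "alt_null False False (q \<circ>\<^sub>L e \<circ>\<^sub>L q)"
    using alt_null_right[OF cq, of False] by simp
  then have v: "alt_null False False v"
    unfolding v_def by (intro alt_null_add alt_null_scaleR alt_null_centered[OF f])
  have "q \<circ>\<^sub>L (p \<circ>\<^sub>L (p \<circ>\<^sub>L (q \<circ>\<^sub>L D n))) = (s * t) *\<^sub>R D n + v \<circ>\<^sub>L D n"
    by (simp add: v_def e_def f_def comp_ring algebra_simps)
  then have "D_adj (Suc n) \<circ>\<^sub>L D (Suc n) = (s * t) *\<^sub>R (D_adj n \<circ>\<^sub>L D n) + D_adj n \<circ>\<^sub>L (v \<circ>\<^sub>L D n)"
    by (simp add: comp_assoc) (simp add: comp_add_right comp_scaleR_right)
  then have "tr (D_adj (Suc n) \<circ>\<^sub>L D (Suc n)) = s * t * tr (D_adj n \<circ>\<^sub>L D n)"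
    using tr_D_conj_alt_null[OF v, of n] alt_null_A[OF v]
    by (simp only: tr_add tr_scaleR A_comp A_scaleR D_A)
  then show ?case
    by (simp add: Suc s_def t_def)
qed simp

end

context free_pair
begin

text \<open>The formula \<open>P R = q \<Delta>\<^sub>n p + P \<kappa>\<^sup>n R p\<^sup>-\<^sup>1 (p\<^sub>0 q\<^sub>0)\<^sup>n p\<close> with \<open>\<Delta>\<^sub>n = \<Sum>k<n. \<kappa>\<^sup>k (p\<^sub>0 q\<^sub>0)\<^sup>k\<close>
  is a geometric series that converges in the norm of the trace only; by freeness just its first
  term survives against \<open>h\<close>.\<close>

theorem subordination:
  fixes \<kappa> P :: real
  assumes p: "p \<in> C True" "tr p = P" and q: "q \<in> C False" "tr q = P"
    and "P \<noteq> 0" and p': "p' \<in> A" "p' \<circ>\<^sub>L p = id_blinfun"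
    and R: "R \<in> A" "R \<circ>\<^sub>L T = id_blinfun"
    and T: "p \<circ>\<^sub>L T \<circ>\<^sub>L q = P *\<^sub>R (id_blinfun - \<kappa> *\<^sub>R ((p - P *\<^sub>R id_blinfun) \<circ>\<^sub>L (q - P *\<^sub>R id_blinfun)))"
    and \<kappa>: "\<kappa>\<^sup>2 * ((tr (p \<circ>\<^sub>L p) - P\<^sup>2) * (tr (q \<circ>\<^sub>L q) - P\<^sup>2)) < 1"
    and h: "h \<in> C True"
  shows "tr (h \<circ>\<^sub>L R) = tr (h \<circ>\<^sub>L p)"
proof -
  let ?p = "p - P *\<^sub>R id_blinfun" and ?q = "q - P *\<^sub>R id_blinfun"
  interpret centered_pair A \<phi> X Y ?p ?q
    using centered_diff_tr[OF p(1)] centered_diff_tr[OF q(1)] p(2) q(2)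
    by unfold_locales auto
  have mem: "p \<in> A" "q \<in> A" "h \<in> A"
    using C_A p q h by auto
  define \<Delta> where "\<Delta> n = (\<Sum>k<n. \<kappa> ^ k *\<^sub>R D k)" for n
  have \<Delta>_A: "\<Delta> n \<in> A" for n
    unfolding \<Delta>_def by (intro A_sum A_scaleR D_A)
  have geo: "\<Delta> n - \<kappa> *\<^sub>R (?p \<circ>\<^sub>L (?q \<circ>\<^sub>L \<Delta> n)) = id_blinfun - \<kappa> ^ n *\<^sub>R D n" for n
  proof (induction n)
    case (Suc n)
    have "\<Delta> (Suc n) = \<Delta> n + \<kappa> ^ n *\<^sub>R D n"
      by (simp add: \<Delta>_def)
    then have "\<Delta> (Suc n) - \<kappa> *\<^sub>R (?p \<circ>\<^sub>L (?q \<circ>\<^sub>L \<Delta> (Suc n)))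
        = (\<Delta> n - \<kappa> *\<^sub>R (?p \<circ>\<^sub>L (?q \<circ>\<^sub>L \<Delta> n))) + \<kappa> ^ n *\<^sub>R D n
          - \<kappa> *\<^sub>R (\<kappa> ^ n *\<^sub>R (?p \<circ>\<^sub>L (?q \<circ>\<^sub>L D n)))"
      by (simp only: comp_add_right comp_scaleR_right scaleR_add_right) simp
    then show ?case
      by (simp add: Suc)
  qed (simp add: \<Delta>_def)
  \<comment> \<open>Cancelling \<open>p\<close> by \<open>p'\<close> and \<open>T\<close> by
    \<open>R\<close> isolates \<open>q \<Delta>\<close>; the factor \<open>p\<close> put on the
    right then removes the \<open>p'\<close> that stays behind \<open>R\<close> in the main
    term.\<close>
  have expand: "P *\<^sub>R R = q \<circ>\<^sub>L (\<Delta> n \<circ>\<^sub>L p) + (P * \<kappa> ^ n) *\<^sub>R (R \<circ>\<^sub>L (p' \<circ>\<^sub>L (D n \<circ>\<^sub>L p)))" for n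
  proof -
    have "p \<circ>\<^sub>L (T \<circ>\<^sub>L (q \<circ>\<^sub>L \<Delta> n)) = (p \<circ>\<^sub>L T \<circ>\<^sub>L q) \<circ>\<^sub>L \<Delta> n"
      by (simp add: comp_assoc)
    also have "\<dots> = P *\<^sub>R (\<Delta> n - \<kappa> *\<^sub>R (?p \<circ>\<^sub>L (?q \<circ>\<^sub>L \<Delta> n)))"
      unfolding T by (simp only: comp_scaleR_left comp_diff_left[of id_blinfun] comp_id comp_assoc)
    finally have 1: "p \<circ>\<^sub>L (T \<circ>\<^sub>L (q \<circ>\<^sub>L \<Delta> n)) = P *\<^sub>R (id_blinfun - \<kappa> ^ n *\<^sub>R D n)"
      by (simp only: geo)
    have "T \<circ>\<^sub>L (q \<circ>\<^sub>L \<Delta> n) = P *\<^sub>R (p' - \<kappa> ^ n *\<^sub>R (p' \<circ>\<^sub>L D n))"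
      using arg_cong[OF 1, of "\<lambda>z. p' \<circ>\<^sub>L z"]
      by (simp add: comp_cong_left[OF p'(2)] comp_scaleR_right comp_diff_right)
    then have "q \<circ>\<^sub>L \<Delta> n = P *\<^sub>R (R \<circ>\<^sub>L p' - \<kappa> ^ n *\<^sub>R (R \<circ>\<^sub>L (p' \<circ>\<^sub>L D n)))"
      using comp_cong_left[OF R(2), of "q \<circ>\<^sub>L \<Delta> n"] by (simp add: comp_scaleR_right comp_diff_right)
    then have "q \<circ>\<^sub>L (\<Delta> n \<circ>\<^sub>L p) = (P *\<^sub>R (R \<circ>\<^sub>L p' - \<kappa> ^ n *\<^sub>R (R \<circ>\<^sub>L (p' \<circ>\<^sub>L D n)))) \<circ>\<^sub>L p"
      by (simp only: comp_assoc[symmetric])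
    then show ?thesis
      by (simp add: comp_scaleR_left comp_diff_left comp_assoc p'(2) scaleR_diff_right)
  qed
  let ?G = "p \<circ>\<^sub>L (h \<circ>\<^sub>L (R \<circ>\<^sub>L p'))"
  have G: "?G \<in> A"
    by (intro A_comp mem R p')
  obtain S where S: "S \<in> A" "adjoint_ops ?G S"
    using vn_adjoint[OF von_neumann G] .
  have main: "tr (h \<circ>\<^sub>L R) - tr (h \<circ>\<^sub>L p) = \<kappa> ^ Suc n * tr (?G \<circ>\<^sub>L D (Suc n))" for n
  proof -
    let ?N = "Suc n"
    have ph: "p \<circ>\<^sub>L h \<in> C True"
      by (intro C_comp p h)
    \<comment> \<open>Traciality moves \<open>p\<close> next to \<open>h\<close>. For
      \<open>k = 0\<close> the trace factorises by freeness, for \<open>k > 0\<close> it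
      vanishes.\<close>
    have summand: "tr (h \<circ>\<^sub>L (q \<circ>\<^sub>L (D k \<circ>\<^sub>L p))) = (if k = 0 then P * tr (h \<circ>\<^sub>L p) else 0)" for k
    proof -
      have "tr (h \<circ>\<^sub>L (q \<circ>\<^sub>L (D k \<circ>\<^sub>L p))) = tr ((h \<circ>\<^sub>L (q \<circ>\<^sub>L D k)) \<circ>\<^sub>L p)"
        by (simp add: comp_assoc)
      also have "\<dots> = tr (p \<circ>\<^sub>L (h \<circ>\<^sub>L (q \<circ>\<^sub>L D k)))"
        by (intro tr_commute A_comp mem D_A)
      also have "\<dots> = tr ((p \<circ>\<^sub>L h) \<circ>\<^sub>L (q \<circ>\<^sub>L D k))"
        by (simp add: comp_assoc)
      also have "\<dots> = (if k = 0 then P * tr (h \<circ>\<^sub>L p) else 0)"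
      proof (cases k)
        case 0
        then show ?thesis
          using tr_comp_free[OF ph, of q] q tr_commute[OF mem(1,3)] by simp
      next
        case (Suc m)
        then show ?thesis
          using tr_comp_comp_D[OF ph q(1), of m] by (simp del: D.simps)
      qed
      finally show ?thesis .
    qed
    have "h \<circ>\<^sub>L (q \<circ>\<^sub>L (\<Delta> ?N \<circ>\<^sub>L p)) = (\<Sum>k<?N. \<kappa> ^ k *\<^sub>R (h \<circ>\<^sub>L (q \<circ>\<^sub>L (D k \<circ>\<^sub>L p))))"
      unfolding \<Delta>_def
      by (simp only: comp_sum_left comp_sum_right comp_scaleR_left comp_scaleR_right)
    then have "tr (h \<circ>\<^sub>L (q \<circ>\<^sub>L (\<Delta> ?N \<circ>\<^sub>L p))) = (\<Sum>k<?N. \<kappa> ^ k * tr (h \<circ>\<^sub>L (q \<circ>\<^sub>L (D k \<circ>\<^sub>L p))))"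
      by (simp only: tr_sum tr_scaleR A_scaleR A_comp mem D_A)
    also have "\<dots> = (\<Sum>k<?N. if k = 0 then P * tr (h \<circ>\<^sub>L p) else 0)"
      unfolding summand by (rule sum.cong) auto
    also have "\<dots> = P * tr (h \<circ>\<^sub>L p)"
      by simp
    finally have 1: "tr (h \<circ>\<^sub>L (q \<circ>\<^sub>L (\<Delta> ?N \<circ>\<^sub>L p))) = P * tr (h \<circ>\<^sub>L p)" .
    have "tr (h \<circ>\<^sub>L (R \<circ>\<^sub>L (p' \<circ>\<^sub>L (D ?N \<circ>\<^sub>L p)))) = tr ((h \<circ>\<^sub>L (R \<circ>\<^sub>L (p' \<circ>\<^sub>L D ?N))) \<circ>\<^sub>L p)"
      by (simp only: comp_assoc)
    also have "\<dots> = tr (p \<circ>\<^sub>L (h \<circ>\<^sub>L (R \<circ>\<^sub>L (p' \<circ>\<^sub>L D ?N))))"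
      by (intro tr_commute A_comp mem D_A R p')
    finally have 2: "tr (h \<circ>\<^sub>L (R \<circ>\<^sub>L (p' \<circ>\<^sub>L (D ?N \<circ>\<^sub>L p)))) = tr (?G \<circ>\<^sub>L D ?N)"
      by (simp only: comp_assoc)
    have "P * tr (h \<circ>\<^sub>L R) = tr (h \<circ>\<^sub>L (P *\<^sub>R R))"
      by (simp add: comp_scaleR_right tr_scaleR A_comp mem R)
    also have "\<dots> = tr (h \<circ>\<^sub>L (q \<circ>\<^sub>L (\<Delta> ?N \<circ>\<^sub>L p))) + P * \<kappa> ^ ?N * tr (h \<circ>\<^sub>L (R \<circ>\<^sub>L (p' \<circ>\<^sub>L (D ?N \<circ>\<^sub>L p))))"
      unfolding expand[of ?N] comp_add_right comp_scaleR_right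
      by (simp only: tr_add tr_scaleR A_comp A_scaleR mem \<Delta>_A D_A R p')
    finally have "P * (tr (h \<circ>\<^sub>L R) - tr (h \<circ>\<^sub>L p)) = P * (\<kappa> ^ ?N * tr (?G \<circ>\<^sub>L D ?N))"
      unfolding 1 2 by (simp add: algebra_simps)
    then show ?thesis
      by (rule mult_left_cancel[OF \<open>P \<noteq> 0\<close>, THEN iffD1])
  qed
  define \<rho> where "\<rho> = \<kappa>\<^sup>2 * (tr (?p \<circ>\<^sub>L ?p) * tr (?q \<circ>\<^sub>L ?q))"
  have sq: "tr ((z - P *\<^sub>R id_blinfun) \<circ>\<^sub>L (z - P *\<^sub>R id_blinfun)) = tr (z \<circ>\<^sub>L z) - P\<^sup>2"
    if "z \<in> A" "tr z = P" for z
    using that by (simp add: comp_ring tr_diff tr_scaleR A_comp A_scaleR A_diff A_id)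
      (simp add: power2_eq_square algebra_simps)
  have "\<rho> < 1"
    using \<kappa> sq[OF mem(1) p(2)] sq[OF mem(2) q(2)] by (simp add: \<rho>_def)
  moreover have "\<rho> \<ge> 0"
    unfolding \<rho>_def
    by (intro mult_nonneg_nonneg tr_nonneg nonneg_square A_comp pq_A pq_sa zero_le_power2)
  ultimately have lim: "(\<lambda>n. tr (?G \<circ>\<^sub>L S) * \<rho> ^ Suc n) \<longlonglongrightarrow> tr (?G \<circ>\<^sub>L S) * 0"
    by (intro tendsto_intros LIMSEQ_Suc LIMSEQ_power_zero) auto
  have "(tr (h \<circ>\<^sub>L R) - tr (h \<circ>\<^sub>L p))\<^sup>2 \<le> tr (?G \<circ>\<^sub>L S) * \<rho> ^ Suc n" for n
  proof -
    have "(tr (?G \<circ>\<^sub>L D (Suc n)))\<^sup>2 \<le> tr (?G \<circ>\<^sub>L S) * tr (D_adj (Suc n) \<circ>\<^sub>L D (Suc n))"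
      by (intro tr_Cauchy_Schwarz S G D_A D_adjoint adjoint_ops_commute[OF S(2)])
    then have "(\<kappa> ^ Suc n)\<^sup>2 * (tr (?G \<circ>\<^sub>L D (Suc n)))\<^sup>2
        \<le> (\<kappa> ^ Suc n)\<^sup>2 * (tr (?G \<circ>\<^sub>L S) * (tr (?p \<circ>\<^sub>L ?p) * tr (?q \<circ>\<^sub>L ?q)) ^ Suc n)"
      unfolding tr_D_adj_D by (intro mult_left_mono) auto
    also have pw: "(\<kappa> ^ Suc n)\<^sup>2 = (\<kappa>\<^sup>2) ^ Suc n"
      by (simp only: power_mult[symmetric] mult.commute)
    also have "(\<kappa>\<^sup>2) ^ Suc n * (tr (?G \<circ>\<^sub>L S) * (tr (?p \<circ>\<^sub>L ?p) * tr (?q \<circ>\<^sub>L ?q)) ^ Suc n)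
        = tr (?G \<circ>\<^sub>L S) * \<rho> ^ Suc n"
      unfolding \<rho>_def power_mult_distrib[of "\<kappa>\<^sup>2"] by (simp only: mult_ac)
    finally show ?thesis
      by (simp only: main[of n] power_mult_distrib pw)
  qed
  then have "(tr (h \<circ>\<^sub>L R) - tr (h \<circ>\<^sub>L p))\<^sup>2 \<le> tr (?G \<circ>\<^sub>L S) * 0"
    by (intro LIMSEQ_le_const[OF lim]) auto
  then show ?thesis
    by simp
qed

end

section \<open>The regression equations\<close>

context W_star_probability_space
begin

text \<open>\<open>p - p p = p k p\<close> is nonnegative and nonzero, so faithfulness makes its
  trace strictly positive. The variance of \<open>p\<close> therefore stays strictly below
  \<open>P - P\<^sup>2\<close> with \<open>P = tr p\<close>, the bound that makes the geometric
  series converge.\<close>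

lemma tr_square_bounds:
  assumes "p \<in> A" "self_adjoint p" "k \<in> A" "nonneg_op k" "k \<noteq> 0"
    and inv: "p \<circ>\<^sub>L (id_blinfun + k) = id_blinfun" "(id_blinfun + k) \<circ>\<^sub>L p = id_blinfun"
  shows "(tr p)\<^sup>2 \<le> tr (p \<circ>\<^sub>L p)" "tr (p \<circ>\<^sub>L p) < tr p" "0 < tr p" "tr p < 1"
proof -
  have "(tr (id_blinfun \<circ>\<^sub>L p))\<^sup>2 \<le> tr (id_blinfun \<circ>\<^sub>L id_blinfun) * tr (p \<circ>\<^sub>L p)"
    by (intro tr_Cauchy_Schwarz_self_adjoint assms A_id self_adjoint_id)
  then show 1: "(tr p)\<^sup>2 \<le> tr (p \<circ>\<^sub>L p)"
    by simp
  have pkp: "p \<circ>\<^sub>L k \<circ>\<^sub>L p \<in> A" "nonneg_op (p \<circ>\<^sub>L k \<circ>\<^sub>L p)"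
    by (intro A_comp assms nonneg_conj)+
  have "p \<circ>\<^sub>L ((id_blinfun + k) \<circ>\<^sub>L p) = p"
    by (simp add: inv)
  then have eq: "p \<circ>\<^sub>L k \<circ>\<^sub>L p = p - p \<circ>\<^sub>L p"
    by (simp add: comp_ring eq_diff_eq add.commute)
  have "tr (p \<circ>\<^sub>L k \<circ>\<^sub>L p) \<noteq> 0"
  proof
    assume "tr (p \<circ>\<^sub>L k \<circ>\<^sub>L p) = 0"
    then have "p \<circ>\<^sub>L k \<circ>\<^sub>L p = 0"
      by (rule tr_faithful[OF pkp])
    then have "(id_blinfun + k) \<circ>\<^sub>L (p \<circ>\<^sub>L k \<circ>\<^sub>L p) \<circ>\<^sub>L (id_blinfun + k) = 0"
      by simp
    then have "k = 0"
      by (simp only: comp_assoc inv comp_cong_left[OF inv(2)] comp_id)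
    then show False
      using assms(5) by simp
  qed
  then have "0 < tr (p \<circ>\<^sub>L k \<circ>\<^sub>L p)"
    using tr_nonneg[OF pkp] by simp
  then show 2: "tr (p \<circ>\<^sub>L p) < tr p"
    unfolding eq by (simp add: tr_diff assms A_comp)
  with 1 have "0 \<le> tr (p \<circ>\<^sub>L p)" "(tr p)\<^sup>2 < tr p"
    using order_trans[OF zero_le_power2 1] by auto
  with 2 show "0 < tr p" by linarith
  with \<open>(tr p)\<^sup>2 < tr p\<close> show "tr p < 1"
    by (simp add: power2_eq_square)
qed

end

locale regression = free_pair A \<phi> X Y + conditional_expectation A \<phi> B E
  for A :: "'h::complex_hilbert_space op set" and \<phi> X Y B E +
  fixes U V :: "'h op" and \<alpha> \<beta> :: real
  assumes X_pos: "pos_op X" and Y_pos: "pos_op Y"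
    and U_def: "U = op_inverse (op_sqrt (id_blinfun + X)) \<circ>\<^sub>L Y \<circ>\<^sub>L op_inverse (op_sqrt (id_blinfun + X))"
    and V_def: "V = op_sqrt (id_blinfun + U) \<circ>\<^sub>L X \<circ>\<^sub>L op_sqrt (id_blinfun + U)"
    and U_B: "U \<in> B"
    and E_V: "E V = \<alpha> *\<^sub>R id_blinfun" and E_V_inverse: "E (op_inverse V) = \<beta> *\<^sub>R id_blinfun"
begin

definition "Q = op_sqrt (id_blinfun + X)"
definition "Q' = op_inverse Q"
definition "S = op_sqrt (id_blinfun + U)"
definition "S' = op_inverse S"
definition "X' = op_inverse X"
definition "W = op_inverse (id_blinfun + X)"

lemma pos_id_X: "pos_op (id_blinfun + X)"
  using pos_op_id_add[OF pos_op_nonneg[OF X_pos], of 1] by simp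

lemma Q_inverse: "Q' \<circ>\<^sub>L Q = id_blinfun" "Q \<circ>\<^sub>L Q' = id_blinfun"
  unfolding Q_def Q'_def by (intro op_inverse invertible_op_sqrt pos_id_X)+

lemma Q_square: "Q \<circ>\<^sub>L Q = id_blinfun + X"
  unfolding Q_def by (intro op_sqrt_comp_self pos_op_nonneg pos_id_X)

lemma Q_sa: "self_adjoint Q" "self_adjoint Q'"
  unfolding Q_def Q'_def
  by (intro self_adjoint_op_inverse invertible_op_sqrt pos_id_X nonneg_self_adjoint nonneg_op_sqrt pos_op_nonneg)+

lemma id_X_A: "id_blinfun + X \<in> A"
  by (intro A_add A_id X_A)

lemma Q_A: "Q \<in> A" "Q' \<in> A"
  unfolding Q_def Q'_def
  by (intro A_op_inverse A_op_sqrt invertible_op_sqrt pos_id_X pos_op_nonneg id_X_A)+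

lemma W_inverse: "W \<circ>\<^sub>L (id_blinfun + X) = id_blinfun" "(id_blinfun + X) \<circ>\<^sub>L W = id_blinfun"
  unfolding W_def by (intro op_inverse pos_op_invertible pos_id_X)+

lemma W_A: "W \<in> A" and W_nonneg: "nonneg_op W"
  unfolding W_def
  by (intro A_op_inverse nonneg_op_inverse pos_op_invertible pos_id_X id_X_A pos_op_nonneg)+

lemma Q'_square: "Q' \<circ>\<^sub>L Q' = W"
proof -
  have "(Q' \<circ>\<^sub>L Q') \<circ>\<^sub>L (Q \<circ>\<^sub>L Q) = id_blinfun"
    by (simp add: comp_assoc comp_cong_left[OF Q_inverse(1)] Q_inverse)
  then have "((Q' \<circ>\<^sub>L Q') \<circ>\<^sub>L (id_blinfun + X)) \<circ>\<^sub>L W = W"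
    by (simp add: Q_square)
  then show ?thesis
    by (simp add: comp_assoc W_inverse)
qed

lemma X_inverse: "X' \<circ>\<^sub>L X = id_blinfun" "X \<circ>\<^sub>L X' = id_blinfun"
  unfolding X'_def by (intro op_inverse pos_op_invertible X_pos)+

lemma X'_A: "X' \<in> A" and X'_sa: "self_adjoint X'"
  unfolding X'_def
  by (intro A_op_inverse self_adjoint_op_inverse pos_op_invertible X_pos X_A X_sa)+

lemma U_eq: "U = Q' \<circ>\<^sub>L Y \<circ>\<^sub>L Q'"
  by (simp add: U_def Q'_def Q_def)

lemma U_nonneg: "nonneg_op U" and U_A: "U \<in> A"
  unfolding U_eq by (intro nonneg_conj pos_op_nonneg Y_pos Q_sa A_comp Q_A Y_A)+

lemma pos_id_U: "pos_op (id_blinfun + U)"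
  using pos_op_id_add[OF U_nonneg, of 1] by simp

lemma S_inverse: "S' \<circ>\<^sub>L S = id_blinfun" "S \<circ>\<^sub>L S' = id_blinfun"
  unfolding S_def S'_def by (intro op_inverse invertible_op_sqrt pos_id_U)+

lemma S_square: "S \<circ>\<^sub>L S = id_blinfun + U"
  unfolding S_def by (intro op_sqrt_comp_self pos_op_nonneg pos_id_U)

lemma S_sa: "self_adjoint S" "self_adjoint S'"
  unfolding S_def S'_def
  by (intro self_adjoint_op_inverse invertible_op_sqrt pos_id_U nonneg_self_adjoint nonneg_op_sqrt pos_op_nonneg)+

lemma S_A: "S \<in> A" "S' \<in> A"
  unfolding S_def S'_def
  by (intro A_op_inverse A_op_sqrt invertible_op_sqrt pos_id_U pos_op_nonneg A_add A_id U_A)+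

lemma V_eq: "V = S \<circ>\<^sub>L X \<circ>\<^sub>L S"
  by (simp add: V_def S_def)

lemma V_inverse_eq: "op_inverse V = S' \<circ>\<^sub>L X' \<circ>\<^sub>L S'"
  by (rule op_inverse_eqI)
    (simp_all add: V_eq comp_assoc comp_cong_left[OF S_inverse(1)] comp_cong_left[OF S_inverse(2)]
      comp_cong_left[OF X_inverse(1)] comp_cong_left[OF X_inverse(2)] S_inverse)

lemma self_adjoint_conj: "self_adjoint T \<Longrightarrow> self_adjoint R \<Longrightarrow> self_adjoint (R \<circ>\<^sub>L T \<circ>\<^sub>L R)" for T R :: "'h op"
  unfolding self_adjoint_iff by (simp add: clinear_comp)

text \<open>The two regression conditions say that the conditional expectations of \<open>X\<close> and \<open>X\<^sup>-\<^sup>1\<close> given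
  \<open>U\<close> are \<open>\<alpha> (1 + U)\<^sup>-\<^sup>1\<close> and \<open>\<beta> (1 + U)\<close>; they are tested against the resolvent of \<open>U\<close>.\<close>

lemma resolvent_equations:
  assumes z: "z < 0" and R: "R = op_inverse (id_blinfun - z *\<^sub>R U)"
  shows "R \<in> A" "R \<circ>\<^sub>L (id_blinfun - z *\<^sub>R U) = id_blinfun"
    and "(1 + z) * tr (X \<circ>\<^sub>L R) - tr X = \<alpha> * z * tr R"
    and "z * tr (X' \<circ>\<^sub>L R) = \<beta> * ((1 + z) * tr R - 1)"
proof -
  have pos: "pos_op (id_blinfun - z *\<^sub>R U)"
    using pos_op_id_add[OF nonneg_scaleR[OF U_nonneg, of "- z"], of 1] z by simp
  note inv = pos_op_invertible[OF pos]
  show RM: "R \<circ>\<^sub>L (id_blinfun - z *\<^sub>R U) = id_blinfun"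
    unfolding R by (rule op_inverse_left[OF inv])
  have MR: "(id_blinfun - z *\<^sub>R U) \<circ>\<^sub>L R = id_blinfun"
    unfolding R by (rule op_inverse_right[OF inv])
  have R_B: "R \<in> B"
    unfolding R
    by (intro vn_op_inverse[OF sub_von_neumann] vn_diff[OF sub_von_neumann] vn_scaleR[OF sub_von_neumann]
        vn_id[OF sub_von_neumann] U_B inv)
  then show R_A: "R \<in> A"
    by (rule B_A)
  have R_sa: "self_adjoint R"
    unfolding R by (intro self_adjoint_op_inverse inv nonneg_self_adjoint pos_op_nonneg pos)
  have "S \<circ>\<^sub>L (S \<circ>\<^sub>L S) = (S \<circ>\<^sub>L S) \<circ>\<^sub>L S"
    by (simp only: comp_assoc)
  then have SU: "U \<circ>\<^sub>L S = S \<circ>\<^sub>L U"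
    unfolding S_square by (simp add: comp_ring)
  have UR: "R \<circ>\<^sub>L U = U \<circ>\<^sub>L R"
    unfolding R by (rule op_inverse_commute[OF inv]) (simp add: comp_ring)
  have RS: "R \<circ>\<^sub>L S = S \<circ>\<^sub>L R"
    unfolding R by (rule op_inverse_commute[OF inv]) (simp add: comp_ring SU)
  have zUR: "z *\<^sub>R (U \<circ>\<^sub>L R) = R - id_blinfun"
    using MR by (simp add: comp_ring algebra_simps)
  \<comment> \<open>As \<open>S\<close> commutes with \<open>R\<close>, traciality turns the trace
    of \<open>V R\<close> into that of \<open>X K\<close>, and the trace of
    \<open>op_inverse V\<close> times \<open>K\<close> into that of \<open>X' R\<close>; moreover
    \<open>z K\<close> is affine in \<open>R\<close>.\<close>
  define K where "K = (id_blinfun + U) \<circ>\<^sub>L R"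
  have K_B: "K \<in> B"
    unfolding K_def
    by (intro vn_comp[OF sub_von_neumann] vn_add[OF sub_von_neumann] vn_id[OF sub_von_neumann] U_B R_B)
  have K_sa: "self_adjoint K"
    unfolding K_def by (intro self_adjoint_comp self_adjoint_add self_adjoint_id R_sa
        nonneg_self_adjoint[OF U_nonneg]) (simp add: comp_ring UR)
  have zK: "z *\<^sub>R K = (1 + z) *\<^sub>R R - id_blinfun"
    unfolding K_def by (simp add: comp_add_left scaleR_add_right zUR scaleR_add_left)
  then have trK: "z * tr K = (1 + z) * tr R - 1"
    using tr_scaleR[OF B_A[OF K_B], of z] by (simp add: tr_diff tr_scaleR R_A A_scaleR A_id)
  have V: "V \<in> A" "self_adjoint V"
    unfolding V_eq by (intro A_comp S_A X_A self_adjoint_conj X_sa S_sa)+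
  have V': "op_inverse V \<in> A" "self_adjoint (op_inverse V)"
    unfolding V_inverse_eq by (intro A_comp S_A X'_A self_adjoint_conj X'_sa S_sa)+
  have "tr (V \<circ>\<^sub>L R) = tr (S \<circ>\<^sub>L (X \<circ>\<^sub>L (S \<circ>\<^sub>L R)))"
    by (simp add: V_eq comp_assoc)
  also have "\<dots> = tr ((X \<circ>\<^sub>L (S \<circ>\<^sub>L R)) \<circ>\<^sub>L S)"
    by (intro tr_commute A_comp S_A X_A R_A)
  also have "\<dots> = tr (X \<circ>\<^sub>L ((S \<circ>\<^sub>L S) \<circ>\<^sub>L R))"
    by (simp only: comp_assoc RS)
  finally have "tr (X \<circ>\<^sub>L K) = \<alpha> * tr R"
    unfolding S_square K_def[symmetric] using tr_comp_cexp_scalar[OF V E_V R_B R_sa] by simp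
  moreover have "X \<circ>\<^sub>L (z *\<^sub>R K) = (1 + z) *\<^sub>R (X \<circ>\<^sub>L R) - X"
    unfolding zK by (simp add: comp_diff_right comp_scaleR_right)
  then have "z * tr (X \<circ>\<^sub>L K) = (1 + z) * tr (X \<circ>\<^sub>L R) - tr X"
    using tr_scaleR[OF A_comp[OF X_A B_A[OF K_B]], of z]
    by (simp add: comp_scaleR_right tr_diff tr_scaleR A_comp A_scaleR X_A R_A)
  ultimately show "(1 + z) * tr (X \<circ>\<^sub>L R) - tr X = \<alpha> * z * tr R"
    by (simp add: mult_ac)
  have "tr (op_inverse V \<circ>\<^sub>L K) = tr (S' \<circ>\<^sub>L (X' \<circ>\<^sub>L (S' \<circ>\<^sub>L ((S \<circ>\<^sub>L S) \<circ>\<^sub>L R))))"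
    by (simp only: V_inverse_eq K_def S_square comp_assoc)
  also have "\<dots> = tr (S' \<circ>\<^sub>L (X' \<circ>\<^sub>L (R \<circ>\<^sub>L S)))"
    by (simp only: comp_assoc comp_cong_left[OF S_inverse(1)] comp_id RS)
  also have "\<dots> = tr ((X' \<circ>\<^sub>L (R \<circ>\<^sub>L S)) \<circ>\<^sub>L S')"
    by (intro tr_commute A_comp S_A X'_A R_A)
  also have "\<dots> = tr (X' \<circ>\<^sub>L R)"
    by (simp only: comp_assoc S_inverse comp_id)
  finally have "tr (X' \<circ>\<^sub>L R) = \<beta> * tr K"
    using tr_comp_cexp_scalar[OF V' E_V_inverse K_B K_sa] by simp
  then show "z * tr (X' \<circ>\<^sub>L R) = \<beta> * ((1 + z) * tr R - 1)"
    by (simp add: trK[symmetric] mult_ac)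
qed

text \<open>\<open>p\<close> is the inverse of \<open>1 - \<omega> W\<close>, because \<open>(1 + x)
  / (1 + x - \<omega>) = 1 + \<omega> / (x + 1 - \<omega>)\<close>. Written through a resolvent of
  \<open>X\<close>, it lies in \<open>C True\<close> and its trace becomes an integral against the
  distribution of \<open>X\<close>.\<close>

lemma resolvent_X:
  assumes "\<omega> < 0" and p: "p = id_blinfun + \<omega> *\<^sub>R op_inverse ((1 - \<omega>) *\<^sub>R id_blinfun + X)"
  shows "p \<in> C True" "X' \<in> C True" "self_adjoint p"
    and "p \<circ>\<^sub>L (id_blinfun - \<omega> *\<^sub>R W) = id_blinfun" "(id_blinfun - \<omega> *\<^sub>R W) \<circ>\<^sub>L p = id_blinfun"
    and "tr (X \<circ>\<^sub>L p) = tr X + 1 + (\<omega> - 1) * tr p"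
    and "(1 - \<omega>) * tr (X' \<circ>\<^sub>L p) = tr X' + 1 - tr p"
proof -
  let ?N = "(1 - \<omega>) *\<^sub>R id_blinfun + X"
  define r where "r = op_inverse ?N"
  have pos: "pos_op ?N"
    using assms(1) by (intro pos_op_id_add pos_op_nonneg X_pos) simp
  note inv = op_inverse[OF pos_op_invertible[OF pos], folded r_def]
  have X_C: "X \<in> C True"
    using poly_closure_self by (simp add: C_def)
  have "?N \<in> C True"
    by (intro C_add C_scaleR C_id X_C)
  then have r_C: "r \<in> C True"
    using poly_closure_op_inverse[OF _ pos] by (simp add: C_def r_def)
  then have r_A: "r \<in> A"
    by (rule C_A)
  have p_r: "p = id_blinfun + \<omega> *\<^sub>R r"
    by (simp only: p r_def)
  show p_C: "p \<in> C True"
    unfolding p_r by (intro C_add C_scaleR C_id r_C)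
  then show "self_adjoint p"
    by (rule C_self_adjoint)
  show "X' \<in> C True"
    using poly_closure_op_inverse[OF poly_closure_self X_pos] by (simp add: C_def X'_def)
  have tr_p: "tr p = 1 + \<omega> * tr r"
    by (simp add: p_r tr_add tr_scaleR A_id A_scaleR r_A)
  have Xr: "X \<circ>\<^sub>L r = id_blinfun - (1 - \<omega>) *\<^sub>R r"
    using inv(2) by (simp add: comp_add_left comp_scaleR_left eq_diff_eq add.commute)
  have rX: "r \<circ>\<^sub>L X = id_blinfun - (1 - \<omega>) *\<^sub>R r"
    using inv(1) by (simp add: comp_add_right comp_scaleR_right eq_diff_eq add.commute)
  have WX: "W \<circ>\<^sub>L X = id_blinfun - W" and XW: "X \<circ>\<^sub>L W = id_blinfun - W"
    using W_inverse by (simp_all add: comp_add_left comp_add_right eq_diff_eq add.commute)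
  have "W \<circ>\<^sub>L (X \<circ>\<^sub>L r) = r - W \<circ>\<^sub>L r"
    by (simp add: comp_cong_left[OF WX] comp_diff_left)
  moreover have "W \<circ>\<^sub>L (X \<circ>\<^sub>L r) = W - (1 - \<omega>) *\<^sub>R (W \<circ>\<^sub>L r)"
    by (simp add: Xr comp_diff_right comp_scaleR_right)
  ultimately have "r - W \<circ>\<^sub>L r = W - (1 - \<omega>) *\<^sub>R (W \<circ>\<^sub>L r)"
    by simp
  then have Wr: "\<omega> *\<^sub>R (W \<circ>\<^sub>L r) = r - W"
    by (simp add: algebra_simps)
  have "r \<circ>\<^sub>L (X \<circ>\<^sub>L W) = r - r \<circ>\<^sub>L W"
    by (simp add: XW comp_diff_right)
  moreover have "r \<circ>\<^sub>L (X \<circ>\<^sub>L W) = W - (1 - \<omega>) *\<^sub>R (r \<circ>\<^sub>L W)"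
    by (simp add: comp_cong_left[OF rX] comp_diff_left comp_scaleR_left)
  ultimately have "r - r \<circ>\<^sub>L W = W - (1 - \<omega>) *\<^sub>R (r \<circ>\<^sub>L W)"
    by simp
  then have rW: "\<omega> *\<^sub>R (r \<circ>\<^sub>L W) = r - W"
    by (simp add: algebra_simps)
  have e: "id_blinfun + \<omega> *\<^sub>R r - \<omega> *\<^sub>R W - \<omega> *\<^sub>R (r - W) = id_blinfun"
    by (simp add: algebra_simps)
  have "p \<circ>\<^sub>L (id_blinfun - \<omega> *\<^sub>R W) = id_blinfun + \<omega> *\<^sub>R r - \<omega> *\<^sub>R W - \<omega> *\<^sub>R (\<omega> *\<^sub>R (r \<circ>\<^sub>L W))"
    by (simp add: p_r comp_ring algebra_simps)
  then show "p \<circ>\<^sub>L (id_blinfun - \<omega> *\<^sub>R W) = id_blinfun"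
    by (simp only: rW e)
  have "(id_blinfun - \<omega> *\<^sub>R W) \<circ>\<^sub>L p = id_blinfun + \<omega> *\<^sub>R r - \<omega> *\<^sub>R W - \<omega> *\<^sub>R (\<omega> *\<^sub>R (W \<circ>\<^sub>L r))"
    by (simp add: p_r comp_ring algebra_simps)
  then show "(id_blinfun - \<omega> *\<^sub>R W) \<circ>\<^sub>L p = id_blinfun"
    by (simp only: Wr e)
  have "X \<circ>\<^sub>L p = X + \<omega> *\<^sub>R (id_blinfun - (1 - \<omega>) *\<^sub>R r)"
    by (simp add: p_r comp_add_right comp_scaleR_right Xr)
  also have "tr \<dots> = tr X + \<omega> * (1 - (1 - \<omega>) * tr r)"
    by (simp add: tr_add tr_diff tr_scaleR A_id A_scaleR A_diff r_A X_A)
  finally show "tr (X \<circ>\<^sub>L p) = tr X + 1 + (\<omega> - 1) * tr p"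
    by (simp add: tr_p algebra_simps)
  have "X' \<circ>\<^sub>L (?N \<circ>\<^sub>L r) = (1 - \<omega>) *\<^sub>R (X' \<circ>\<^sub>L r) + r"
    by (simp add: comp_add_left comp_add_right comp_scaleR_left comp_scaleR_right comp_cong_left[OF X_inverse(1)])
  then have "(1 - \<omega>) *\<^sub>R (X' \<circ>\<^sub>L r) = X' - r"
    by (simp add: inv(2) eq_diff_eq)
  then have "(1 - \<omega>) * tr (X' \<circ>\<^sub>L r) = tr X' - tr r"
    using tr_scaleR[OF A_comp[OF X'_A r_A], of "1 - \<omega>"] by (simp add: tr_diff X'_A r_A)
  moreover have "tr (X' \<circ>\<^sub>L p) = tr X' + \<omega> * tr (X' \<circ>\<^sub>L r)"
    by (simp add: p_r comp_add_right comp_scaleR_right tr_add tr_scaleR A_comp A_scaleR X'_A r_A)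
  ultimately show "(1 - \<omega>) * tr (X' \<circ>\<^sub>L p) = tr X' + 1 - tr p"
    by (simp add: tr_p) algebra
qed

theorem regression_equations:
  assumes neg: "\<omega> < 0" "w < 0"
    and p: "p = id_blinfun + \<omega> *\<^sub>R op_inverse ((1 - \<omega>) *\<^sub>R id_blinfun + X)"
    and q: "q = op_inverse (id_blinfun - w *\<^sub>R Y)"
    and P: "tr p = P" "tr q = P"
  obtains z where "z < 0" "z * (P - 1) = \<omega> * w * P" "0 < P" "P < 1"
    "(1 + z) * (tr X + 1 + (\<omega> - 1) * P) - tr X = \<alpha> * z * P"
    "z * (tr X' + 1 - P) = \<beta> * (1 - \<omega>) * ((1 + z) * P - 1)"
proof -
  note rX = resolvent_X[OF neg(1) p]
  have id0: "(id_blinfun :: 'h op) \<noteq> 0"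
  proof
    assume "(id_blinfun :: 'h op) = 0"
    then have "tr id_blinfun = tr 0"
      by (rule arg_cong)
    then show False
      by simp
  qed
  have W0: "W \<noteq> 0" and Y0: "Y \<noteq> 0"
  proof -
    show "W \<noteq> 0"
      using W_inverse(1) id0 by auto
    show "Y \<noteq> 0"
      using op_inverse_right[OF pos_op_invertible[OF Y_pos]] id0 by auto
  qed
  have p_A: "p \<in> A"
    using C_A rX(1) by blast
  have p_bounds: "P\<^sup>2 \<le> tr (p \<circ>\<^sub>L p)" "tr (p \<circ>\<^sub>L p) < P" "0 < P" "P < 1"
    using tr_square_bounds[OF p_A rX(3), of "(- \<omega>) *\<^sub>R W"] W0 W_A neg(1) rX(4,5) P(1)
      nonneg_scaleR[OF W_nonneg, of "- \<omega>"] A_scaleR[OF W_A, of "- \<omega>"] by auto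
  have pos: "pos_op (id_blinfun - w *\<^sub>R Y)"
    using pos_op_id_add[OF nonneg_scaleR[OF pos_op_nonneg[OF Y_pos], of "- w"], of 1] neg(2) by simp
  note qinv = op_inverse[OF pos_op_invertible[OF pos], folded q]
  have "id_blinfun - w *\<^sub>R Y \<in> poly_closure Y"
    by (intro poly_closure_diff poly_closure_scaleR poly_closure_id poly_closure_self)
  then have q_C: "q \<in> C False"
    using poly_closure_op_inverse[OF _ pos] by (simp add: C_def q)
  then have q_A: "q \<in> A" and q_sa: "self_adjoint q"
    using C_A C_self_adjoint by blast+
  have q_bounds: "P\<^sup>2 \<le> tr (q \<circ>\<^sub>L q)" "tr (q \<circ>\<^sub>L q) < P"
    using tr_square_bounds[OF q_A q_sa, of "(- w) *\<^sub>R Y"] Y0 Y_A neg(2) qinv P(2)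
      nonneg_scaleR[OF pos_op_nonneg[OF Y_pos], of "- w"] A_scaleR[OF Y_A, of "- w"] by auto
  define \<psi> where "\<psi> = P - 1"
  \<comment> \<open>Put \<open>p0 = p - P\<close> and \<open>q0 = q - P\<close>. As
    \<open>\<omega> w p W Y q = (p - 1) (q - 1)\<close>, the ratio
    \<open>z / (\<omega> * w) = P / \<psi>\<close> cancels the terms of
    \<open>p (1 - z W Y) q\<close> that are linear in \<open>p0\<close> and \<open>q0\<close>. What
    remains is \<open>P - p0 q0 / \<psi>\<close>, whence \<open>\<kappa>\<close>.\<close>
  define z where "z = \<omega> * w * P / \<psi>"
  define \<kappa> where "\<kappa> = 1 / (P * \<psi>)"
  have \<psi>: "\<psi> < 0"
    using p_bounds(4) by (auto simp: \<psi>_def)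
  have z: "z < 0" "z * \<psi> = \<omega> * w * P"
    using \<psi> p_bounds(3) neg by (auto simp: z_def divide_pos_neg mult_neg_neg)
  define R where "R = op_inverse (id_blinfun - z *\<^sub>R U)"
  note res = resolvent_equations[OF z(1) R_def]
  \<comment> \<open>\<open>R1\<close> is the resolvent of \<open>W Y\<close>, conjugate to
    \<open>R\<close> by \<open>Q\<close>: subordination concerns \<open>R1\<close>, the regression
    conditions concern \<open>R\<close>.\<close>
  define R1 where "R1 = Q' \<circ>\<^sub>L R \<circ>\<^sub>L Q"
  define T where "T = id_blinfun - z *\<^sub>R (W \<circ>\<^sub>L Y)"
  have "Q' \<circ>\<^sub>L (U \<circ>\<^sub>L Q) = W \<circ>\<^sub>L Y"
    by (simp add: U_eq comp_assoc Q_inverse) (simp add: comp_assoc[symmetric] Q'_square)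
  then have T_eq: "T = Q' \<circ>\<^sub>L (id_blinfun - z *\<^sub>R U) \<circ>\<^sub>L Q"
    by (simp add: T_def comp_ring Q_inverse)
  have R1: "R1 \<in> A" "R1 \<circ>\<^sub>L T = id_blinfun"
  proof -
    show "R1 \<in> A"
      unfolding R1_def by (intro A_comp Q_A res)
    have "R1 \<circ>\<^sub>L T = Q' \<circ>\<^sub>L (R \<circ>\<^sub>L ((id_blinfun - z *\<^sub>R U) \<circ>\<^sub>L Q))"
      unfolding R1_def T_eq by (simp only: comp_assoc comp_cong_left[OF Q_inverse(2)] comp_id)
    then show "R1 \<circ>\<^sub>L T = id_blinfun"
      by (simp only: comp_cong_left[OF res(2)] comp_id Q_inverse)
  qed
  have \<omega>pW: "\<omega> *\<^sub>R (p \<circ>\<^sub>L W) = p - id_blinfun"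
    using rX(4) by (simp add: comp_diff_right comp_scaleR_right) (simp add: algebra_simps)
  have wYq: "w *\<^sub>R (Y \<circ>\<^sub>L q) = q - id_blinfun"
    using qinv(2) by (simp add: comp_diff_left comp_scaleR_left) (simp add: algebra_simps)
  have "p \<circ>\<^sub>L T \<circ>\<^sub>L q = p \<circ>\<^sub>L q - z *\<^sub>R ((p \<circ>\<^sub>L W) \<circ>\<^sub>L (Y \<circ>\<^sub>L q))"
    by (simp add: T_def comp_ring)
  also have "z *\<^sub>R ((p \<circ>\<^sub>L W) \<circ>\<^sub>L (Y \<circ>\<^sub>L q)) = (P / \<psi>) *\<^sub>R ((\<omega> *\<^sub>R (p \<circ>\<^sub>L W)) \<circ>\<^sub>L (w *\<^sub>R (Y \<circ>\<^sub>L q)))"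
    by (simp add: comp_scaleR_left comp_scaleR_right z_def mult_ac)
  also have "\<dots> = (P / \<psi>) *\<^sub>R (p \<circ>\<^sub>L q - p - q + id_blinfun)"
    unfolding \<omega>pW wYq by (simp add: comp_ring algebra_simps)
  finally have 1: "p \<circ>\<^sub>L T \<circ>\<^sub>L q = p \<circ>\<^sub>L q - (P / \<psi>) *\<^sub>R (p \<circ>\<^sub>L q - p - q + id_blinfun)" .
  have 2: "P *\<^sub>R (id_blinfun - \<kappa> *\<^sub>R ((p - P *\<^sub>R id_blinfun) \<circ>\<^sub>L (q - P *\<^sub>R id_blinfun)))
      = P *\<^sub>R id_blinfun - (1 / \<psi>) *\<^sub>R (p \<circ>\<^sub>L q - P *\<^sub>R p - P *\<^sub>R q + (P * P) *\<^sub>R id_blinfun)"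
    using p_bounds(3) by (simp add: comp_ring \<kappa>_def algebra_simps)
  have c: "1 - P / \<psi> = - (1 / \<psi>)" "- (P / \<psi>) = P - P * P / \<psi>"
    using \<psi> by (auto simp: \<psi>_def field_simps)
  have "p \<circ>\<^sub>L q - (P / \<psi>) *\<^sub>R (p \<circ>\<^sub>L q - p - q + id_blinfun)
      = (1 - P / \<psi>) *\<^sub>R (p \<circ>\<^sub>L q) + (P / \<psi>) *\<^sub>R p + (P / \<psi>) *\<^sub>R q + (- (P / \<psi>)) *\<^sub>R id_blinfun"
    by (simp add: algebra_simps)
  also have "\<dots> = (- (1 / \<psi>)) *\<^sub>R (p \<circ>\<^sub>L q) + (P / \<psi>) *\<^sub>R p + (P / \<psi>) *\<^sub>R q + (P - P * P / \<psi>) *\<^sub>R id_blinfun"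
    unfolding c by simp
  also have "\<dots> = P *\<^sub>R id_blinfun - (1 / \<psi>) *\<^sub>R (p \<circ>\<^sub>L q - P *\<^sub>R p - P *\<^sub>R q + (P * P) *\<^sub>R id_blinfun)"
    by (simp add: algebra_simps)
  finally have T_id: "p \<circ>\<^sub>L T \<circ>\<^sub>L q
      = P *\<^sub>R (id_blinfun - \<kappa> *\<^sub>R ((p - P *\<^sub>R id_blinfun) \<circ>\<^sub>L (q - P *\<^sub>R id_blinfun)))"
    unfolding 1 2 .
  \<comment> \<open>Both variances are strictly below \<open>P - P\<^sup>2\<close>, which is the
    absolute value of \<open>1 / \<kappa>\<close>.\<close>
  have \<kappa>: "\<kappa>\<^sup>2 * ((tr (p \<circ>\<^sub>L p) - P\<^sup>2) * (tr (q \<circ>\<^sub>L q) - P\<^sup>2)) < 1"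
  proof -
    have "(tr (p \<circ>\<^sub>L p) - P\<^sup>2) * (tr (q \<circ>\<^sub>L q) - P\<^sup>2) < (P - P\<^sup>2) * (P - P\<^sup>2)"
      using p_bounds q_bounds by (intro mult_strict_mono) auto
    also have "P - P\<^sup>2 = - (P * \<psi>)"
      by (simp add: \<psi>_def power2_eq_square algebra_simps)
    finally have "(tr (p \<circ>\<^sub>L p) - P\<^sup>2) * (tr (q \<circ>\<^sub>L q) - P\<^sup>2) < (P * \<psi>)\<^sup>2"
      by (simp add: power2_eq_square)
    then show ?thesis
      using p_bounds(3) \<psi> by (simp add: \<kappa>_def power_divide pos_divide_less_eq)
  qed
  \<comment> \<open>\<open>h\<close> is a limit of polynomials in \<open>X\<close> and commutes with
    \<open>Q\<close>, so under the trace the similarity between \<open>R\<close> and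
    \<open>R1\<close> disappears.\<close>
  have sub: "tr (h \<circ>\<^sub>L R) = tr (h \<circ>\<^sub>L p)" if h: "h \<in> C True" for h
  proof -
    have hA: "h \<in> A"
      using C_A h by blast
    have "h \<circ>\<^sub>L Q = Q \<circ>\<^sub>L h"
    proof -
      have "X \<circ>\<^sub>L h = h \<circ>\<^sub>L X"
        using poly_closure_commute[of h X X] h by (simp add: C_def)
      then have "(id_blinfun + X) \<circ>\<^sub>L h = h \<circ>\<^sub>L (id_blinfun + X)"
        by (simp add: comp_ring)
      then show ?thesis
        unfolding Q_def using op_sqrt_commute[OF pos_op_nonneg[OF pos_id_X]] by simp
    qed
    then have "Q \<circ>\<^sub>L (h \<circ>\<^sub>L Q') = h"
      using Q_inverse by (simp only: comp_assoc[symmetric] flip: \<open>h \<circ>\<^sub>L Q = Q \<circ>\<^sub>L h\<close>) (simp only: comp_assoc comp_id)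
    then have "tr (h \<circ>\<^sub>L R) = tr (Q \<circ>\<^sub>L ((h \<circ>\<^sub>L Q') \<circ>\<^sub>L R))"
      by (simp only: comp_assoc[symmetric])
    also have "\<dots> = tr (((h \<circ>\<^sub>L Q') \<circ>\<^sub>L R) \<circ>\<^sub>L Q)"
      by (intro tr_commute A_comp Q_A hA res)
    also have "\<dots> = tr (h \<circ>\<^sub>L R1)"
      by (simp only: R1_def comp_assoc)
    also have "\<dots> = tr (h \<circ>\<^sub>L p)"
      using p_bounds(3)
      by (intro subordination[where q = q and P = P and \<kappa> = \<kappa> and T = T and p' = "id_blinfun - \<omega> *\<^sub>R W"]
          rX(1,5) P q_C R1 T_id \<kappa> h A_diff A_id A_scaleR W_A) simp
    finally show ?thesis .
  qed
  have "tr R = P"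
    using sub[OF C_id] P by simp
  moreover have "tr (X \<circ>\<^sub>L R) = tr X + 1 + (\<omega> - 1) * P"
    using sub[of X] poly_closure_self[of X] rX(6) P by (simp add: C_def)
  moreover have "(1 - \<omega>) * tr (X' \<circ>\<^sub>L R) = tr X' + 1 - P"
    using sub[OF rX(2)] rX(7) P by simp
  ultimately have "(1 + z) * (tr X + 1 + (\<omega> - 1) * P) - tr X = \<alpha> * z * P"
    "z * tr (X' \<circ>\<^sub>L R) = \<beta> * ((1 + z) * P - 1)" "tr X' + 1 - P = (1 - \<omega>) * tr (X' \<circ>\<^sub>L R)"
    using res(3,4) by simp_all
  then show ?thesis
    using z p_bounds(3,4) by (intro that[of z]) (simp_all add: \<psi>_def)
qed

end

section \<open>Cauchy transforms and the free Poisson distribution\<close>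

locale bounded_measure = finite_measure M for M :: "real measure" +
  fixes K :: real
  assumes M_sets [measurable_cong]: "sets M = sets borel"
    and M_range: "AE x in M. x \<in> {0..K}"
begin

definition F :: "nat \<Rightarrow> real \<Rightarrow> real" where
  "F n u = (\<integral>x. x ^ n / (1 + u * x) \<partial>M)"

lemma integrable_power: "integrable M (\<lambda>x. x ^ n)"
proof (rule integrable_const_bound[where B = "K ^ n"])
  show "AE x in M. norm (x ^ n) \<le> K ^ n"
    using M_range by eventually_elim (auto intro: power_mono)
qed measurable

lemma integrable_transform:
  assumes "u > 0" shows "integrable M (\<lambda>x. x ^ n / (1 + u * x))"
proof (rule integrable_const_bound[where B = "K ^ n"])
  show "AE x in M. norm (x ^ n / (1 + u * x)) \<le> K ^ n"
    using M_range
  proof eventually_elim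
    case (elim x)
    then have "x ^ n / (1 + u * x) \<le> x ^ n / 1"
      using assms by (intro divide_left_mono) (auto intro!: add_pos_nonneg)
    also have "\<dots> \<le> K ^ n"
      using elim by (auto intro: power_mono)
    finally show ?case
      using elim assms by simp
  qed
qed measurable

lemma F_nonneg: "u > 0 \<Longrightarrow> 0 \<le> F n u"
  unfolding F_def using M_range by (intro integral_nonneg_AE) (auto elim!: eventually_mono)

lemma F_bound:
  assumes "u > 0" shows "F n u \<le> (\<integral>x. x ^ n \<partial>M)"
  unfolding F_def
proof (rule integral_mono_AE[OF integrable_transform[OF assms] integrable_power])
  show "AE x in M. x ^ n / (1 + u * x) \<le> x ^ n"
    using M_range
  proof eventually_elim
    case (elim x)
    then have "x ^ n / (1 + u * x) \<le> x ^ n / 1"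
      using assms by (intro divide_left_mono) (auto intro!: add_pos_nonneg)
    then show ?case by simp
  qed
qed

lemma F_step:
  assumes "u > 0" shows "(\<integral>x. x ^ n \<partial>M) = F n u + u * F (Suc n) u"
proof -
  have "F n u + u * F (Suc n) u = (\<integral>x. x ^ n / (1 + u * x) + u * (x ^ Suc n / (1 + u * x)) \<partial>M)"
    unfolding F_def
    by (simp only: Bochner_Integration.integral_add[OF integrable_transform[OF assms]
          integrable_mult_right[OF integrable_transform[OF assms]]] integral_mult_right_zero)
  also have "\<dots> = (\<integral>x. x ^ n \<partial>M)"
  proof (rule integral_cong_AE)
    show "AE x in M. x ^ n / (1 + u * x) + u * (x ^ Suc n / (1 + u * x)) = x ^ n"
      using M_range
    proof eventually_elim
      case (elim x)
      then have "1 + u * x \<noteq> 0"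
        using assms by (smt (verit) atLeastAtMost_iff mult_nonneg_nonneg)
      then show ?case
        unfolding times_divide_eq_right add_divide_distrib[symmetric]
        by (simp add: nonzero_divide_eq_eq algebra_simps)
    qed
  qed measurable
  finally show ?thesis ..
qed

lemma F_tendsto: "(\<lambda>k. F n (inverse (real (Suc k)))) \<longlonglongrightarrow> (\<integral>x. x ^ n \<partial>M)"
proof (rule real_tendsto_sandwich)
  let ?C = "\<integral>x. x ^ Suc n \<partial>M"
  show "(\<lambda>k. (\<integral>x. x ^ n \<partial>M) - inverse (real (Suc k)) * ?C) \<longlonglongrightarrow> (\<integral>x. x ^ n \<partial>M)"
    using tendsto_diff[OF tendsto_const tendsto_mult[OF LIMSEQ_inverse_real_of_nat tendsto_const]] by simp
  show "\<forall>\<^sub>F k in sequentially. (\<integral>x. x ^ n \<partial>M) - inverse (real (Suc k)) * ?C \<le> F n (inverse (real (Suc k)))"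
  proof (intro always_eventually allI)
    fix k
    let ?u = "inverse (real (Suc k))"
    have u: "?u > 0" by simp
    have "?u * F (Suc n) ?u \<le> ?u * ?C"
      by (intro mult_left_mono F_bound) auto
    then show "(\<integral>x. x ^ n \<partial>M) - ?u * ?C \<le> F n ?u"
      using F_step[OF u, of n] by linarith
  qed
  show "\<forall>\<^sub>F k in sequentially. F n (inverse (real (Suc k))) \<le> (\<integral>x. x ^ n \<partial>M)"
    by (intro always_eventually allI F_bound) simp
qed simp

end

text \<open>Letting \<open>u\<close> tend to \<open>0\<close> recovers the moment of order
  \<open>n\<close> from \<open>F n\<close>, and \<open>F_step\<close> then passes from
  \<open>F n\<close> to \<open>F (Suc n)\<close>. The range \<open>u < 1\<close> corresponds to
  \<open>\<zeta> = - 1 / u < -1\<close>, where the equation of the Kummer case is available.\<close>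

lemma transform_determines_moments:
  assumes "bounded_measure M K" "bounded_measure N K'"
    and eq: "\<And>u. 0 < u \<Longrightarrow> u < 1 \<Longrightarrow> (\<integral>x. 1 / (1 + u * x) \<partial>M) = (\<integral>x. 1 / (1 + u * x) \<partial>N)"
  shows "(\<integral>x. x ^ n \<partial>M) = (\<integral>x. x ^ n \<partial>N)"
proof -
  interpret M: bounded_measure M K by fact
  interpret N: bounded_measure N K' by fact
  have mom: "(\<integral>x. x ^ n \<partial>M) = (\<integral>x. x ^ n \<partial>N)"
    if "\<And>u. 0 < u \<Longrightarrow> u < 1 \<Longrightarrow> M.F n u = N.F n u" for n
  proof -
    \<comment> \<open>\<open>Suc (Suc k)\<close> keeps the argument strictly below
      \<open>1\<close>.\<close>
    have "M.F n (inverse (real (Suc (Suc k)))) = N.F n (inverse (real (Suc (Suc k))))" for k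
      by (intro that) (simp_all add: field_simps)
    then have "(\<lambda>k. N.F n (inverse (real (Suc (Suc k))))) \<longlonglongrightarrow> (\<integral>x. x ^ n \<partial>M)"
      using LIMSEQ_Suc[OF M.F_tendsto[of n]] by simp
    then show ?thesis
      using LIMSEQ_Suc[OF N.F_tendsto[of n]] by (rule LIMSEQ_unique)
  qed
  have "M.F n u = N.F n u" if "0 < u" "u < 1" for n u
    using that
  proof (induction n arbitrary: u)
    case 0
    then show ?case
      using eq by (simp add: M.F_def N.F_def)
  next
    case (Suc n)
    have "(\<integral>x. x ^ n \<partial>M) = (\<integral>x. x ^ n \<partial>N)"
      using Suc.IH by (rule mom)
    then have "u * M.F (Suc n) u = u * N.F (Suc n) u"
      using M.F_step[OF Suc.prems(1), of n] N.F_step[OF Suc.prems(1), of n] Suc.IH[OF Suc.prems] by simp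
    then show ?case
      using Suc.prems(1) by simp
  qed
  then show ?thesis
    by (rule mom)
qed

section \<open>Integrals of semicircular arcs\<close>

definition arc_primitive :: "real \<Rightarrow> real \<Rightarrow> real \<Rightarrow> real" where
  "arc_primitive a b y = sqrt ((y - a) * (b - y)) + (a + b) / 2 * arcsin ((2 * y - a - b) / (b - a))
     - sqrt (a * b) * arcsin (((a + b) * y - 2 * a * b) / (y * (b - a)))"

text \<open>The arguments \<open>f\<close>, \<open>g\<close> of the two arcsines are an affine and a
  Moebius map, both sending \<open>a\<close>, \<open>b\<close> to \<open>-1\<close>,
  \<open>1\<close>. Since \<open>1 - f\<^sup>2\<close> and \<open>1 - g\<^sup>2\<close> are squares
  of multiples of \<open>R\<close>, the three derivatives have \<open>R\<close> as common
  denominator and combine to \<open>R\<^sup>2 / (y * R)\<close>.\<close>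

lemma arc_primitive_deriv:
  assumes "0 < a" "a < y" "y < b"
  shows "(arc_primitive a b has_real_derivative sqrt ((y - a) * (b - y)) / y) (at y)"
proof -
  define R where "R = sqrt ((y - a) * (b - y))"
  have R: "R > 0" "R\<^sup>2 = (y - a) * (b - y)" and y: "y > 0" "b - a > 0" "a * b > 0"
    using assms by (auto simp: R_def)
  define q where "q = sqrt (a * b)"
  have q: "q > 0" "q\<^sup>2 = a * b"
    using y by (auto simp: q_def)
  define f where "f = (2 * y - a - b) / (b - a)"
  define g where "g = ((a + b) * y - 2 * a * b) / (y * (b - a))"
  have f1: "1 - f\<^sup>2 = (2 * R / (b - a))\<^sup>2"
    using y(2) by (simp add: f_def power_divide power_mult_distrib R(2) field_simps)
      (simp add: power2_eq_square algebra_simps)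
  have g1: "1 - g\<^sup>2 = (2 * q * R / (y * (b - a)))\<^sup>2"
    using y by (simp add: g_def power_divide power_mult_distrib R(2) q(2) field_simps)
      (simp add: power2_eq_square algebra_simps)
  have "0 < (2 * R / (b - a))\<^sup>2" "0 < (2 * q * R / (y * (b - a)))\<^sup>2"
    using R(1) q(1) y by simp_all
  then have "f\<^sup>2 < 1" "g\<^sup>2 < 1"
    using f1 g1 by linarith+
  then have fg: "-1 < f" "f < 1" "-1 < g" "g < 1"
    by (auto simp: power2_less_1_iff abs_less_iff)
  have sf: "sqrt (1 - f\<^sup>2) = 2 * R / (b - a)" and sg: "sqrt (1 - g\<^sup>2) = 2 * q * R / (y * (b - a))"
    unfolding f1 g1 using R(1) q(1) y by simp_all
  have d1: "((\<lambda>y. sqrt ((y - a) * (b - y))) has_real_derivative (a + b - 2 * y) / (2 * R)) (at y)"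
    using R(1) unfolding R_def by (auto intro!: derivative_eq_intros simp: field_simps)
  have "((\<lambda>y. 2 * y - a - b) has_real_derivative 2) (at y)"
    by (auto intro!: derivative_eq_intros)
  then have "((\<lambda>y. (2 * y - a - b) / (b - a)) has_real_derivative 2 / (b - a)) (at y)"
    by (rule DERIV_cdivide)
  then have d2: "((\<lambda>y. arcsin ((2 * y - a - b) / (b - a))) has_real_derivative
      inverse (sqrt (1 - f\<^sup>2)) * (2 / (b - a))) (at y)"
    using fg unfolding f_def by (intro DERIV_chain2[OF DERIV_arcsin]) auto
  have "((\<lambda>y. ((a + b) * y - 2 * a * b) / (y * (b - a))) has_real_derivative
      ((a + b) * (y * (b - a)) - ((a + b) * y - 2 * a * b) * (b - a)) / ((y * (b - a)) * (y * (b - a)))) (at y)"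
    using y by (intro DERIV_divide) (auto intro!: derivative_eq_intros)
  also have "(a + b) * (y * (b - a)) - ((a + b) * y - 2 * a * b) * (b - a) = (2 * a * b) * (b - a)"
    by (simp add: algebra_simps)
  also have "(2 * a * b) * (b - a) / ((y * (b - a)) * (y * (b - a))) = 2 * a * b / (y\<^sup>2 * (b - a))"
    using y by (simp add: power2_eq_square)
  finally have "((\<lambda>y. ((a + b) * y - 2 * a * b) / (y * (b - a))) has_real_derivative
      2 * a * b / (y\<^sup>2 * (b - a))) (at y)" .
  then have d3: "((\<lambda>y. arcsin (((a + b) * y - 2 * a * b) / (y * (b - a)))) has_real_derivative
      inverse (sqrt (1 - g\<^sup>2)) * (2 * a * b / (y\<^sup>2 * (b - a)))) (at y)"
    using fg unfolding g_def by (intro DERIV_chain2[OF DERIV_arcsin]) auto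
  have "((\<lambda>y. arc_primitive a b y) has_real_derivative
      (a + b - 2 * y) / (2 * R) + (a + b) / 2 * (inverse (sqrt (1 - f\<^sup>2)) * (2 / (b - a)))
      - q * (inverse (sqrt (1 - g\<^sup>2)) * (2 * a * b / (y\<^sup>2 * (b - a))))) (at y)"
    unfolding arc_primitive_def q_def by (intro DERIV_diff DERIV_add DERIV_cmult d1 d2 d3)
  moreover have "(a + b - 2 * y) / (2 * R) + (a + b) / 2 * (inverse (sqrt (1 - f\<^sup>2)) * (2 / (b - a)))
      - q * (inverse (sqrt (1 - g\<^sup>2)) * (2 * a * b / (y\<^sup>2 * (b - a)))) = R / y"
  proof -
    have "(a + b) / 2 * (inverse (sqrt (1 - f\<^sup>2)) * (2 / (b - a))) = (a + b) / (2 * R)"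
      unfolding sf using y R(1) by (simp add: field_simps)
    moreover have "q * (inverse (sqrt (1 - g\<^sup>2)) * (2 * a * b / (y\<^sup>2 * (b - a)))) = a * b / (y * R)"
      unfolding sg using y R(1) q(1) by (simp add: field_simps power2_eq_square)
    moreover have "(a + b - 2 * y) / (2 * R) + (a + b) / (2 * R) - a * b / (y * R) = R\<^sup>2 / (y * R)"
      unfolding R(2) using y R(1) by (simp add: field_simps)
    ultimately show ?thesis
      using R(1) by (simp add: power2_eq_square)
  qed
  ultimately show ?thesis
    unfolding R_def by simp
qed

lemma arc_primitive_continuous:
  assumes "0 < a" "a < b" shows "continuous_on {a..b} (arc_primitive a b)"
proof -
  have 1: "- 1 \<le> (2 * y - a - b) / (b - a)" "(2 * y - a - b) / (b - a) \<le> 1" if "y \<in> {a..b}" for y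
    using that assms by (auto simp: field_simps)
  have 2: "- 1 \<le> ((a + b) * y - 2 * a * b) / (y * (b - a))"
    "((a + b) * y - 2 * a * b) / (y * (b - a)) \<le> 1" if y: "y \<in> {a..b}" for y
  proof -
    have "0 \<le> 2 * b * (y - a)" "0 \<le> 2 * a * (b - y)" "0 < y * (b - a)"
      using assms y by auto
    then show "- 1 \<le> ((a + b) * y - 2 * a * b) / (y * (b - a))"
      "((a + b) * y - 2 * a * b) / (y * (b - a)) \<le> 1"
      by (simp_all add: pos_le_divide_eq pos_divide_le_eq algebra_simps)
  qed
  show ?thesis
    unfolding arc_primitive_def using assms 1 2 by (intro continuous_intros ballI) auto
qed

text \<open>For \<open>\<zeta> < s\<close> this is \<open>1 / pi\<close> times the integral of
  \<open>sqrt ((x - s) * (t - x)) / (x - \<zeta>)\<close> over the interval.\<close>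

definition arc_transform :: "real \<Rightarrow> real \<Rightarrow> real \<Rightarrow> real" where
  "arc_transform s t \<zeta> = (s + t) / 2 - \<zeta> - sqrt ((s - \<zeta>) * (t - \<zeta>))"

lemma arc_transform_integral:
  assumes "\<zeta> < s" "s < t"
  shows "((\<lambda>x. sqrt ((x - s) * (t - x)) / (x - \<zeta>)) has_integral pi * arc_transform s t \<zeta>) {s..t}"
proof -
  let ?a = "s - \<zeta>" and ?b = "t - \<zeta>"
  let ?F = "\<lambda>x. arc_primitive ?a ?b (x - \<zeta>)"
  have ab: "0 < ?a" "?a < ?b"
    using assms by auto
  have "((\<lambda>x. sqrt ((x - s) * (t - x)) / (x - \<zeta>)) has_integral (?F t - ?F s)) {s..t}"
  proof (rule fundamental_theorem_of_calculus_interior)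
    show "s \<le> t"
      using assms by simp
    show "continuous_on {s..t} ?F"
      by (rule continuous_on_compose2[OF arc_primitive_continuous[OF ab]]) (auto intro!: continuous_intros)
    show "(?F has_vector_derivative sqrt ((x - s) * (t - x)) / (x - \<zeta>)) (at x)" if "x \<in> {s<..<t}" for x
    proof -
      have "(arc_primitive ?a ?b has_real_derivative sqrt ((x - \<zeta> - ?a) * (?b - (x - \<zeta>))) / (x - \<zeta>)) (at (x - \<zeta>))"
        using that ab by (intro arc_primitive_deriv) auto
      then have "(?F has_real_derivative sqrt ((x - s) * (t - x)) / (x - \<zeta>) * 1) (at x)"
        by (intro DERIV_chain2[where f = "arc_primitive ?a ?b"]) (auto intro!: derivative_eq_intros)
      then show ?thesis
        by (simp add: has_real_derivative_iff_has_vector_derivative)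
    qed
  qed
  moreover have "?F t - ?F s = pi * arc_transform s t \<zeta>"
  proof -
    have "(2 * ?b - ?a - ?b) / (?b - ?a) = 1" "(2 * ?a - ?a - ?b) / (?b - ?a) = -1"
      using ab by (simp_all add: field_simps)
    moreover have "((?a + ?b) * ?b - 2 * ?a * ?b) / (?b * (?b - ?a)) = 1"
      "((?a + ?b) * ?a - 2 * ?a * ?b) / (?a * (?b - ?a)) = -1"
    proof -
      have "(?a + ?b) * ?b - 2 * ?a * ?b = ?b * (?b - ?a)" "(?a + ?b) * ?a - 2 * ?a * ?b = - (?a * (?b - ?a))"
        by (simp_all add: algebra_simps)
      moreover have "?b * (?b - ?a) \<noteq> 0" "?a * (?b - ?a) \<noteq> 0"
        using ab by auto
      ultimately show "((?a + ?b) * ?b - 2 * ?a * ?b) / (?b * (?b - ?a)) = 1"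
        "((?a + ?b) * ?a - 2 * ?a * ?b) / (?a * (?b - ?a)) = -1"
        by (simp_all only: divide_self_if minus_divide_left[symmetric] if_False)
    qed
    ultimately show ?thesis
      unfolding arc_primitive_def arc_transform_def
      by (simp only: arcsin_1 arcsin_minus_1) (simp add: field_simps)
  qed
  ultimately show ?thesis
    by simp
qed

text \<open>\<open>h\<close> is the formula continuous up to the end points, \<open>f\<close> its
  cutoff to the open interval; on the closed interval they differ at most at two points. Lebesgue
  integrals against \<open>N\<close> can thus be evaluated by the fundamental theorem of
  calculus.\<close>

lemma density_on_interval:
  fixes h :: "real \<Rightarrow> real"
  assumes st: "0 \<le> s" "s \<le> t" and h: "continuous_on {s..t} h" "\<And>x. x \<in> {s<..<t} \<Longrightarrow> 0 \<le> h x"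
    and f: "f \<in> borel_measurable borel" "\<And>x. f x = h x * indicator {s<..<t} x"
  defines "N \<equiv> density lborel (\<lambda>x. ennreal (f x))"
  shows "bounded_measure N t" "emeasure N (- {s..t}) = 0"
    and "\<And>k I. k \<in> borel_measurable borel \<Longrightarrow> continuous_on {s..t} k \<Longrightarrow>
      ((\<lambda>x. h x * k x) has_integral I) {s..t} \<Longrightarrow> (\<integral>x. k x \<partial>N) = I"
proof -
  have f0: "f x \<ge> 0" for x
    using h(2)[of x] by (auto simp: f(2) indicator_def)
  have int: "integrable lborel (\<lambda>x. f x * k x)" "(\<integral>x. f x * k x \<partial>lborel) = integral {s..t} (\<lambda>x. h x * k x)"
    if k: "k \<in> borel_measurable borel" "continuous_on {s..t} k" for k :: "real \<Rightarrow> real"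
  proof -
    have c: "set_integrable lborel {s..t} (\<lambda>x. h x * k x)"
      by (intro borel_integrable_atLeastAtMost' continuous_intros h k)
    have ae: "AE x in lborel. indicator {s..t} x *\<^sub>R (h x * k x) = f x * k x"
    proof -
      have "AE x in lborel. x \<noteq> s" "AE x in lborel. x \<noteq> t"
        by (rule AE_lborel_singleton)+
      then show ?thesis
        by eventually_elim (auto simp: f(2) indicator_def)
    qed
    have m: "(\<lambda>x. f x * k x) \<in> borel_measurable lborel"
      using f(1) k(1) by measurable
    have mm: "(\<lambda>x. indicator {s..t} x *\<^sub>R (h x * k x)) \<in> borel_measurable lborel"
      using c by (simp add: set_integrable_def borel_measurable_integrable)
    show "integrable lborel (\<lambda>x. f x * k x)"
      using c integrable_cong_AE[OF mm m ae] by (simp add: set_integrable_def)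
    have "(\<integral>x. f x * k x \<partial>lborel) = (LINT x:{s..t}|lborel. h x * k x)"
      unfolding set_lebesgue_integral_def by (rule integral_cong_AE[OF m mm]) (use ae in auto)
    then show "(\<integral>x. f x * k x \<partial>lborel) = integral {s..t} (\<lambda>x. h x * k x)"
      using set_borel_integral_eq_integral(2)[OF c] by simp
  qed
  have "integrable lborel f"
    using int(1)[of "\<lambda>_. 1"] by simp
  then have "emeasure N UNIV = ennreal (\<integral>x. f x \<partial>lborel)"
    using f0 f(1) by (simp add: N_def emeasure_density nn_integral_eq_integral)
  then have fin: "finite_measure N"
    by (intro finite_measureI) (simp add: N_def)
  have null: "emeasure N (- {s..t}) = 0"
  proof -
    have "emeasure N (- {s..t}) = (\<integral>\<^sup>+x. ennreal (f x) * indicator (- {s..t}) x \<partial>lborel)"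
      unfolding N_def by (rule emeasure_density) (use f(1) in auto)
    also have "\<dots> = (\<integral>\<^sup>+x. 0 \<partial>(lborel :: real measure))"
      by (rule nn_integral_cong) (auto simp: f(2) indicator_def)
    finally have "emeasure N (- {s..t}) = (\<integral>\<^sup>+x. 0 \<partial>(lborel :: real measure))" .
    then show ?thesis by simp
  qed
  show "emeasure N (- {s..t}) = 0"
    by (rule null)
  have "AE x in N. x \<notin> - {s..t}"
    by (rule AE_not_in) (auto simp: null_sets_def null, simp add: N_def)
  then have "AE x in N. x \<in> {0..t}"
    by eventually_elim (use st in auto)
  moreover have "sets N = sets borel"
    by (simp add: N_def)
  ultimately show "bounded_measure N t"
    by (intro bounded_measure.intro bounded_measure_axioms.intro fin)
  fix k :: "real \<Rightarrow> real" and I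
  assume k: "k \<in> borel_measurable borel" "continuous_on {s..t} k"
    "((\<lambda>x. h x * k x) has_integral I) {s..t}"
  have "(\<integral>x. k x \<partial>N) = (\<integral>x. f x * k x \<partial>lborel)"
    unfolding N_def using f0 f(1) k(1) by (subst integral_density) auto
  then show "(\<integral>x. k x \<partial>N) = I"
    using int(2)[OF k(1,2)] integral_unique[OF k(3)] by simp
qed

section \<open>Identification of the free Poisson law\<close>

lemma bounded_distribution_measure:
  assumes "bounded_distribution \<mu> a b" "0 \<le> a" shows "bounded_measure \<mu> b"
proof -
  interpret bounded_distribution \<mu> a b by fact
  have "AE x in \<mu>. x \<in> {0..b}"
    using AE_range by eventually_elim (use assms(2) in auto)
  then show ?thesis
    using finite_measure_axioms sets_eq by (auto simp: bounded_measure_def bounded_measure_axioms_def)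
qed

text \<open>The total mass of \<open>N\<close> is its moment of order \<open>0\<close>, so equality
  of moments also makes it a probability measure.\<close>

lemma has_distribution_same_moments:
  assumes "has_distribution \<phi> X \<mu>" "bounded_measure N K" "compact S" "emeasure N (- S) = 0"
    and "\<And>n. (\<integral>x. x ^ n \<partial>\<mu>) = (\<integral>x. x ^ n \<partial>N)"
  shows "has_distribution \<phi> X N"
proof -
  interpret N: bounded_measure N K by fact
  interpret prob_space \<mu>
    using assms(1) by (simp add: has_distribution_def)
  have "measure N (space N) = 1"
    using assms(5)[of 0] prob_space by simp
  then have "prob_space N"
    by (intro prob_spaceI) (simp add: N.emeasure_eq_measure)
  then show ?thesis
    using assms N.M_sets by (auto simp: has_distribution_def)
qed

text \<open>The mean and the variance are read off the expansion of the transform at \<open>u = 0\<close>, the sign of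
  \<open>c\<close> from its decay at infinity.\<close>

lemma free_Poisson_parameters:
  assumes "bounded_distribution \<mu> e b" "0 < e"
    and eq: "\<And>u. 0 < u \<Longrightarrow> 1 - (\<integral>x. 1 / (1 + u * x) \<partial>\<mu>)
      = u * (\<integral>x. 1 / (1 + u * x) \<partial>\<mu>) * (c + g * (\<integral>x. 1 / (1 + u * x) \<partial>\<mu>))"
    and var: "(\<integral>x. x \<partial>\<mu>)\<^sup>2 < (\<integral>x. x\<^sup>2 \<partial>\<mu>)"
  shows "0 < g" "0 < c"
proof -
  interpret bounded_distribution \<mu> e b by fact
  interpret M: bounded_measure \<mu> b
    by (rule bounded_distribution_measure) (use assms in auto)
  define P where "P u = M.F 0 u" for u
  have P: "(\<integral>x. 1 / (1 + u * x) \<partial>\<mu>) = P u" for u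
    by (simp add: P_def M.F_def)
  have eq: "1 - P u = u * P u * (c + g * P u)" if "u > 0" for u
    using eq[OF that] by (simp add: P)
  have m0: "(\<integral>x. x ^ 0 \<partial>\<mu>) = 1"
    using prob_space by simp
  have F1: "M.F 1 u = P u * (c + g * P u)" if u: "u > 0" for u
  proof -
    have "u * M.F 1 u = 1 - P u"
      using M.F_step[OF u, of 0] unfolding m0 by (simp add: P_def)
    also have "\<dots> = u * (P u * (c + g * P u))"
      unfolding eq[OF u] by (rule mult.assoc)
    finally show ?thesis
      by (rule mult_left_cancel[THEN iffD1, rotated]) (use u in simp)
  qed
  let ?u = "\<lambda>k. inverse (real (Suc k))"
  have lim0: "(\<lambda>k. P (?u k)) \<longlonglongrightarrow> 1"
    using M.F_tendsto[of 0] by (simp only: P_def m0)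
  define m where "m = (\<integral>x. x \<partial>\<mu>)"
  have F1k: "M.F 1 (?u k) = P (?u k) * (c + g * P (?u k))" for k
    by (rule F1) simp
  have "(\<lambda>k. M.F 1 (?u k)) \<longlonglongrightarrow> 1 * (c + g * 1)"
    unfolding F1k by (intro tendsto_intros lim0)
  moreover have lim1: "(\<lambda>k. M.F 1 (?u k)) \<longlonglongrightarrow> m"
    using M.F_tendsto[of 1] by (simp add: m_def)
  ultimately have "1 * (c + g * 1) = m"
    by (rule LIMSEQ_unique)
  then have m: "m = c + g"
    by simp
  have F2: "M.F 2 u = M.F 1 u * (c + g * (1 + P u))" if u: "u > 0" for u
  proof -
    have "u * M.F 2 u = m - M.F 1 u"
      using M.F_step[OF u, of 1] by (simp add: m_def numeral_2_eq_2)
    also have "\<dots> = (1 - P u) * (c + g * (1 + P u))"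
      unfolding F1[OF u] m by (simp add: algebra_simps)
    also have "1 - P u = u * M.F 1 u"
      using eq[OF u] F1[OF u] by simp
    finally show ?thesis
      using u by simp
  qed
  have F2k: "M.F 2 (?u k) = M.F 1 (?u k) * (c + g * (1 + P (?u k)))" for k
    by (rule F2) simp
  have "(\<lambda>k. M.F 2 (?u k)) \<longlonglongrightarrow> m * (c + g * (1 + 1))"
    unfolding F2k by (intro tendsto_intros lim0 lim1)
  moreover have "(\<lambda>k. M.F 2 (?u k)) \<longlonglongrightarrow> (\<integral>x. x\<^sup>2 \<partial>\<mu>)"
    by (rule M.F_tendsto)
  ultimately have "m * (c + g * (1 + 1)) = (\<integral>x. x\<^sup>2 \<partial>\<mu>)"
    by (rule LIMSEQ_unique)
  then have "0 < m * g"
    using var unfolding m_def[symmetric] by (simp add: m power2_eq_square algebra_simps)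
  moreover have "e \<le> m"
  proof -
    have "(\<integral>x. e \<partial>\<mu>) \<le> (\<integral>x. x \<partial>\<mu>)"
      using M.integrable_power[of 1] by (intro integral_mono_on) auto
    then show ?thesis
      using prob_space by (simp add: m_def)
  qed
  ultimately show g: "0 < g"
    using assms(2) by (simp add: zero_less_mult_iff)
  have bound: "P u \<le> 1 / (1 + u * e)" if u: "u > 0" for u
  proof -
    have "(\<integral>x. 1 / (1 + u * x) \<partial>\<mu>) \<le> (\<integral>x. 1 / (1 + u * e) \<partial>\<mu>)"
    proof (rule integral_mono_on)
      show "integrable \<mu> (\<lambda>x. 1 / (1 + u * x))"
        using M.integrable_transform[OF u, of 0] by simp
      show "1 / (1 + u * x) \<le> 1 / (1 + u * e)" if "x \<in> {e..b}" for x
        using that u assms(2) by (intro divide_left_mono add_mono mult_left_mono mult_pos_pos add_pos_pos) auto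
    qed simp
    then show ?thesis
      using prob_space by (simp add: P)
  qed
  have P0: "0 \<le> P u" if "u > 0" for u
    unfolding P_def by (rule M.F_nonneg[OF that])
  \<comment> \<open>In the limit of large \<open>u\<close>, where \<open>P u\<close> tends to
    \<open>0\<close>, this inequality becomes \<open>e \<le> c\<close>.\<close>
  have le: "e * (1 - P u) \<le> c + g * P u" if u: "u > 0" for u
  proof -
    have "P u < 1"
      using bound[OF u] u assms(2) by (smt (verit) divide_less_eq_1 mult_pos_pos)
    then have "0 < u * P u * (c + g * P u)"
      using eq[OF u] by simp
    then have pos: "0 < c + g * P u"
      using mult_nonneg_nonpos[OF mult_nonneg_nonneg[OF less_imp_le[OF u] P0[OF u]], of "c + g * P u"]
      by linarith
    have "P u * (1 + u * e) \<le> 1"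
      using bound[OF u] u assms(2) by (simp add: pos_le_divide_eq add_pos_pos)
    then have "u * P u * e \<le> 1"
      using P0[OF u] by (simp add: algebra_simps)
    then have "(u * P u * e) * (c + g * P u) \<le> 1 * (c + g * P u)"
      using pos by (intro mult_right_mono) auto
    then show ?thesis
      unfolding eq[OF u] by (simp add: mult_ac)
  qed
  have limP: "(\<lambda>k. P (real (Suc k))) \<longlonglongrightarrow> 0"
  proof (rule real_tendsto_sandwich[where f = "\<lambda>_. 0"])
    show "(\<lambda>k. inverse e * inverse (real (Suc k))) \<longlonglongrightarrow> 0"
      using tendsto_mult[OF tendsto_const[of "inverse e"] LIMSEQ_inverse_real_of_nat] by simp
    show "\<forall>\<^sub>F k in sequentially. P (real (Suc k)) \<le> inverse e * inverse (real (Suc k))"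
    proof (intro always_eventually allI)
      fix k
      have "P (real (Suc k)) \<le> 1 / (1 + real (Suc k) * e)"
        by (rule bound) simp
      also have "\<dots> \<le> 1 / (real (Suc k) * e)"
        using assms(2) by (intro divide_left_mono mult_pos_pos add_pos_pos) auto
      finally show "P (real (Suc k)) \<le> inverse e * inverse (real (Suc k))"
        by (simp add: field_simps)
    qed
    show "\<forall>\<^sub>F k in sequentially. 0 \<le> P (real (Suc k))"
      by (intro always_eventually allI P0) simp
  qed simp
  have "(\<lambda>k. e * (1 - P (real (Suc k)))) \<longlonglongrightarrow> e * (1 - 0)" "(\<lambda>k. c + g * P (real (Suc k))) \<longlonglongrightarrow> c + g * 0"
    by (intro tendsto_intros limP)+
  then have "e * (1 - 0) \<le> c + g * 0"
    by (rule LIMSEQ_le) (use le in auto)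
  then show "0 < c"
    using assms(2) by simp
qed

text \<open>With \<open>\<zeta> = - 1 / u\<close> the hypothesis reads
  \<open>g P\<^sup>2 + (c - \<zeta>) P + \<zeta> = 0\<close>, and its discriminant is
  \<open>(s - \<zeta>) (t - \<zeta>)\<close> for the end points \<open>s\<close>, \<open>t\<close>
  of the free Poisson support. As \<open>c > 0\<close>, the rate exceeds \<open>1\<close> and there
  is no atom at \<open>0\<close>.\<close>

lemma has_distribution_free_Poisson:
  assumes \<mu>: "has_distribution \<phi> Y \<mu>" "bounded_distribution \<mu> e b" "0 < e"
    and eq: "\<And>u. 0 < u \<Longrightarrow> 1 - (\<integral>x. 1 / (1 + u * x) \<partial>\<mu>)
      = u * (\<integral>x. 1 / (1 + u * x) \<partial>\<mu>) * (c + g * (\<integral>x. 1 / (1 + u * x) \<partial>\<mu>))"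
    and pos: "0 < g" "0 < c"
  shows "has_distribution \<phi> Y (free_Poisson g ((c + g) / g))"
proof -
  interpret M: bounded_measure \<mu> b
    by (rule bounded_distribution_measure[OF \<mu>(2)]) (use \<mu>(3) in auto)
  define \<rho> where "\<rho> = (c + g) / g"
  define s t where "s = g * (1 - sqrt \<rho>)\<^sup>2" and "t = g * (1 + sqrt \<rho>)\<^sup>2"
  have \<rho>: "\<rho> > 1" "g * \<rho> = c + g"
    using pos by (auto simp: \<rho>_def field_simps)
  then have r: "sqrt \<rho> > 1" "(sqrt \<rho>)\<^sup>2 = \<rho>"
    by auto
  have sum: "s + t = 2 * (c + 2 * g)"
  proof -
    have "s + t = 2 * g * (1 + (sqrt \<rho>)\<^sup>2)"
      by (simp add: s_def t_def power2_eq_square algebra_simps)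
    then show ?thesis
      unfolding r(2) using \<rho>(2) by (simp add: algebra_simps)
  qed
  have prod: "s * t = c\<^sup>2"
  proof -
    have "s * t = (g * (1 - (sqrt \<rho>)\<^sup>2))\<^sup>2"
      by (simp add: s_def t_def power2_eq_square algebra_simps)
    also have "g * (1 - (sqrt \<rho>)\<^sup>2) = - c"
      unfolding r(2) using \<rho>(2) by (simp add: algebra_simps)
    finally show ?thesis by simp
  qed
  have st: "0 < s" "s < t"
  proof -
    show "0 < s"
      using r(1) pos(1) by (simp add: s_def)
    have "t - s = 4 * g * sqrt \<rho>"
      by (simp add: s_def t_def power2_eq_square algebra_simps)
    then show "s < t"
      using r(1) pos(1) by (smt (verit) mult_pos_pos)
  qed
  define h where "h x = sqrt ((x - s) * (t - x)) / (2 * pi * g * x)" for x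
  have dens: "free_Poisson_density g \<rho> x = h x * indicator {s<..<t} x" for x
  proof -
    have "4 * \<rho> * g\<^sup>2 - (x - g * (1 + \<rho>))\<^sup>2 = (s + t) * x - x\<^sup>2 - s * t"
      unfolding sum prod using \<rho>(2) by (simp add: power2_eq_square algebra_simps) algebra
    also have "\<dots> = (x - s) * (t - x)"
      by (simp add: power2_eq_square algebra_simps)
    finally show ?thesis
      by (simp add: free_Poisson_density_def h_def s_def t_def)
  qed
  have meas: "free_Poisson_density g \<rho> \<in> borel_measurable borel"
    unfolding free_Poisson_density_def by measurable
  let ?N = "density lborel (\<lambda>x. ennreal (free_Poisson_density g \<rho> x))"
  have N: "free_Poisson g \<rho> = ?N"
  proof (rule measure_eqI)
    fix B assume "B \<in> sets (free_Poisson g \<rho>)"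
    then show "emeasure (free_Poisson g \<rho>) B = emeasure ?N B"
      using meas \<rho>(1) by (simp add: emeasure_free_Poisson emeasure_density)
  qed simp
  have hc: "continuous_on {s..t} h"
    unfolding h_def using st pos(1) by (intro continuous_intros) auto
  have h0: "0 \<le> h x" if "x \<in> {s<..<t}" for x
    unfolding h_def using that st pos(1) by auto
  note D = density_on_interval[OF less_imp_le[OF st(1)] less_imp_le[OF st(2)] hc h0 meas dens]
  have "(\<integral>x. 1 / (1 + u * x) \<partial>\<mu>) = (\<integral>x. 1 / (1 + u * x) \<partial>?N)" if u: "0 < u" for u
  proof -
    define P where "P = (\<integral>x. 1 / (1 + u * x) \<partial>\<mu>)"
    define \<zeta> where "\<zeta> = - 1 / u"
    have \<zeta>: "\<zeta> < 0" "u * \<zeta> = -1"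
      using u by (auto simp: \<zeta>_def)
    have "P \<ge> 0"
      using M.F_nonneg[OF u, of 0] by (simp add: P_def M.F_def)
    \<comment> \<open>Partial fractions of \<open>1 / (x (x - \<zeta>))\<close> reduce the transform
      to arc integrals at \<open>0\<close> and at \<open>\<zeta>\<close>.\<close>
    have "((\<lambda>x. sqrt ((x - s) * (t - x)) / (x - 0) - sqrt ((x - s) * (t - x)) / (x - \<zeta>)) has_integral
        pi * arc_transform s t 0 - pi * arc_transform s t \<zeta>) {s..t}"
      using st \<zeta>(1) by (intro has_integral_diff arc_transform_integral) auto
    then have "((\<lambda>x. (sqrt ((x - s) * (t - x)) / (x - 0) - sqrt ((x - s) * (t - x)) / (x - \<zeta>)) / (2 * pi * g))
        has_integral (pi * arc_transform s t 0 - pi * arc_transform s t \<zeta>) / (2 * pi * g)) {s..t}"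
      by (rule has_integral_divide)
    moreover have "(sqrt ((x - s) * (t - x)) / (x - 0) - sqrt ((x - s) * (t - x)) / (x - \<zeta>)) / (2 * pi * g)
        = h x * (1 / (1 + u * x))" if x: "x \<in> {s..t}" for x
    proof -
      have x0: "x > 0" "x - \<zeta> > 0"
        using x st \<zeta> by auto
      have *: "1 + u * x = u * (x - \<zeta>)"
        using \<zeta>(2) by (simp add: algebra_simps)
      have "S / (x - 0) - S / (x - \<zeta>) = S / (x * (u * (x - \<zeta>)))" for S
      proof -
        have "S / (x - 0) - S / (x - \<zeta>) = (S * (x - \<zeta>) - S * x) / (x * (x - \<zeta>))"
          using x0 by (simp add: diff_frac_eq)
        also have "S * (x - \<zeta>) - S * x = S * (1 / u)"
          by (simp add: \<zeta>_def algebra_simps)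
        finally show ?thesis
          by (simp add: mult_ac)
      qed
      then show ?thesis
        unfolding * h_def by simp
    qed
    ultimately have "((\<lambda>x. h x * (1 / (1 + u * x))) has_integral
        (pi * arc_transform s t 0 - pi * arc_transform s t \<zeta>) / (2 * pi * g)) {s..t}"
      by (rule has_integral_eq[rotated])
    then have "(\<integral>x. 1 / (1 + u * x) \<partial>?N) = (pi * arc_transform s t 0 - pi * arc_transform s t \<zeta>) / (2 * pi * g)"
      using u st by (intro D(3)) (auto intro!: continuous_intros simp: add_nonneg_eq_0_iff)
    also have "\<dots> = (arc_transform s t 0 - arc_transform s t \<zeta>) / (2 * g)"
      by (simp add: right_diff_distrib[symmetric])
    also have "arc_transform s t 0 - arc_transform s t \<zeta> = \<zeta> - c + sqrt ((s - \<zeta>) * (t - \<zeta>))"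
      using prod pos(2) by (simp add: arc_transform_def)
    \<comment> \<open>The signs of \<open>P\<close>, \<open>c\<close> and \<open>\<zeta>\<close>
      make \<open>2 g P + c - \<zeta>\<close> nonnegative and so single out the root of the
      quadratic equation.\<close>
    also have "sqrt ((s - \<zeta>) * (t - \<zeta>)) = 2 * g * P + c - \<zeta>"
    proof (rule real_sqrt_unique)
      have e: "1 - P = u * P * (c + g * P)"
        using eq[OF u] by (simp add: P_def)
      have "\<zeta> * (1 - P) = - (P * (c + g * P))"
        unfolding e using \<zeta>(2) by (simp add: mult.assoc[symmetric] mult.commute[of \<zeta> u])
      then show "(2 * g * P + c - \<zeta>)\<^sup>2 = (s - \<zeta>) * (t - \<zeta>)"
        using sum prod by algebra
      show "0 \<le> 2 * g * P + c - \<zeta>"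
        using pos \<open>P \<ge> 0\<close> \<zeta>(1) by (smt (verit) mult_nonneg_nonneg)
    qed
    finally show ?thesis
      using pos(1) by (simp add: P_def)
  qed
  then have "(\<integral>x. x ^ n \<partial>\<mu>) = (\<integral>x. x ^ n \<partial>?N)" for n
    by (intro transform_determines_moments[OF M.bounded_measure_axioms D(1)])
  then show ?thesis
    unfolding \<rho>_def[symmetric] N
    by (intro has_distribution_same_moments[OF \<mu>(1) D(1) _ D(2)]) auto
qed

section \<open>The free Kummer distribution\<close>

text \<open>The transform of the distribution of \<open>X\<close> satisfies a quadratic equation whose discriminant \<open>D\<close>
  is a quartic polynomial; \<open>H\<close> is the corresponding square root of \<open>D\<close>. It changes sign on
  the half-line left of \<open>-1\<close>, which forces a double root \<open>z0\<close> of \<open>D\<close> there, and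
  positivity of the measure makes the two remaining roots \<open>s\<close>, \<open>t\<close> real and distinct.\<close>

locale kummer_equation = bounded_distribution \<mu> e b for \<mu> e b +
  fixes c g \<alpha> :: real
  assumes e_pos: "0 < e" and c_pos: "0 < c" and g_pos: "0 < g" and \<alpha>_g: "g < \<alpha>"
    and equation: "\<And>\<omega> P. \<omega> < 0 \<Longrightarrow> P = 1 + \<omega> * (\<integral>x. 1 / (x + (1 - \<omega>)) \<partial>\<mu>) \<Longrightarrow>
      g * P\<^sup>2 * (1 - \<omega>) + P * (\<alpha> * \<omega> + (c + \<omega>) * (1 - \<omega>) - g) - c - \<omega> * ((\<integral>x. x \<partial>\<mu>) + 1) = 0"
begin

definition "m = (\<integral>x. x \<partial>\<mu>)"
definition "wt x = x * (1 + x)" for x :: real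
definition "T v \<zeta> = (\<integral>x. v x / (x - \<zeta>) \<partial>\<mu>)" for v :: "real \<Rightarrow> real"
definition "quad \<zeta> = \<alpha> * (1 + \<zeta>) - \<zeta> * (c + 1 + \<zeta>) - g"
text \<open>In \<open>\<zeta> = \<omega> - 1\<close> the equation reads
  \<open>g \<zeta> P\<^sup>2 - quad P + c + (1 + \<zeta>) (m + 1) = 0\<close>; its discriminant is
  \<open>D\<close>, and \<open>H\<close> stands for \<open>quad - 2 g \<zeta> P\<close>. Writing
  \<open>H\<close> with the positive weight \<open>wt\<close> expresses its divided differences by
  transforms of positive weights, whose signs are known.\<close>

definition "H \<zeta> = 2 * g * (1 + m) - 2 * g * T wt \<zeta> + quad \<zeta>"
definition "D \<zeta> = (quad \<zeta>)\<^sup>2 - 4 * g * \<zeta> * (c + (1 + \<zeta>) * (m + 1))"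
definition "G \<zeta> = (\<integral>x. 1 / (x - \<zeta>) \<partial>\<mu>)"

lemma int_const: "(\<integral>x. k \<partial>\<mu>) = k" for k :: real
  using prob_space by simp

lemma int_id: "integrable \<mu> (\<lambda>x. x)"
  by (intro integrable_continuous continuous_intros) simp

lemma int_G: "\<zeta> \<le> -1 \<Longrightarrow> integrable \<mu> (\<lambda>x. 1 / (x - \<zeta>))"
  using e_pos by (intro integrable_continuous continuous_intros) auto

text \<open>A class of positive weights with a common bound, stable under division by
  \<open>x - z\<close> for \<open>z \<le> -1\<close> because there \<open>x - z \<ge> 1\<close>. The
  common bound gives Lipschitz and limit estimates for every \<open>T v\<close>.\<close>

definition admissible :: "(real \<Rightarrow> real) \<Rightarrow> bool" where
  "admissible v \<longleftrightarrow> v \<in> borel_measurable borel \<and> continuous_on {e..b} v \<and>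
     (\<forall>x\<in>{e..b}. 0 < v x \<and> v x \<le> wt b)"

lemma admissible_wt: "admissible wt"
  unfolding admissible_def
proof (intro conjI ballI)
  show "wt \<in> borel_measurable borel"
    unfolding wt_def by measurable
  show "continuous_on {e..b} wt"
    unfolding wt_def by (intro continuous_intros)
  fix x assume x: "x \<in> {e..b}"
  then show "0 < wt x"
    using e_pos by (simp add: wt_def)
  show "wt x \<le> wt b"
    using x e_pos unfolding wt_def by (intro mult_mono) auto
qed

lemma admissible_divide:
  assumes "admissible v" "z \<le> -1" shows "admissible (\<lambda>x. v x / (x - z))"
  unfolding admissible_def
proof (intro conjI ballI)
  show "(\<lambda>x. v x / (x - z)) \<in> borel_measurable borel"
    using assms(1) by (intro borel_measurable_divide borel_measurable_diff) (simp_all add: admissible_def)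
  show "continuous_on {e..b} (\<lambda>x. v x / (x - z))"
    using assms e_pos unfolding admissible_def by (intro continuous_intros) auto
  fix x assume x: "x \<in> {e..b}"
  then have v: "0 < v x" "v x \<le> wt b" "1 \<le> x - z"
    using assms e_pos by (auto simp: admissible_def)
  then show "0 < v x / (x - z)"
    by simp
  have "v x / (x - z) \<le> v x / 1"
    using v by (intro divide_left_mono) auto
  then show "v x / (x - z) \<le> wt b"
    using v by simp
qed

lemma admissible_integrable: "admissible v \<Longrightarrow> integrable \<mu> v"
  by (intro integrable_continuous) (auto simp: admissible_def)

lemma T_bounds:
  assumes "admissible v" "\<zeta> \<le> -1" shows "0 < T v \<zeta>" "T v \<zeta> \<le> wt b"
proof -
  note v = admissible_divide[OF assms]
  obtain x0 where x0: "x0 \<in> {e..b}" "\<And>x. x \<in> {e..b} \<Longrightarrow> v x0 / (x0 - \<zeta>) \<le> v x / (x - \<zeta>)"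
    using continuous_attains_inf[of "{e..b}" "\<lambda>x. v x / (x - \<zeta>)"] v range_nonempty
    by (auto simp: admissible_def)
  have "(\<integral>x. v x0 / (x0 - \<zeta>) \<partial>\<mu>) \<le> T v \<zeta>"
    unfolding T_def by (intro integral_mono_on integrable_const admissible_integrable v x0)
  moreover have "0 < v x0 / (x0 - \<zeta>)"
    using v x0(1) by (simp add: admissible_def)
  ultimately show "0 < T v \<zeta>"
    unfolding int_const by simp
  have "T v \<zeta> \<le> (\<integral>x. wt b \<partial>\<mu>)"
    unfolding T_def using v
    by (intro integral_mono_on integrable_const admissible_integrable v) (simp add: admissible_def)
  then show "T v \<zeta> \<le> wt b"
    unfolding int_const .
qed

text \<open>The resolvent identity: a divided difference of \<open>T v\<close> is again a transform,
  with the weight divided by \<open>x - z\<close>.\<close>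

lemma T_diff:
  assumes "admissible v" "\<zeta> \<le> -1" "z \<le> -1"
  shows "T v \<zeta> - T v z = (\<zeta> - z) * T (\<lambda>x. v x / (x - z)) \<zeta>"
proof -
  have int: "integrable \<mu> (\<lambda>x. v x / (x - \<zeta>))" "integrable \<mu> (\<lambda>x. v x / (x - z))"
    by (intro admissible_integrable admissible_divide assms)+
  have meas: "v \<in> borel_measurable borel"
    using assms(1) by (simp add: admissible_def)
  have "T v \<zeta> - T v z = (\<integral>x. v x / (x - \<zeta>) - v x / (x - z) \<partial>\<mu>)"
    unfolding T_def by (rule Bochner_Integration.integral_diff[symmetric]) (fact int)+
  also have "\<dots> = (\<integral>x. (\<zeta> - z) * (v x / (x - z) / (x - \<zeta>)) \<partial>\<mu>)"
  proof (rule integral_cong_on)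
    show "(\<lambda>x. v x / (x - \<zeta>) - v x / (x - z)) \<in> borel_measurable borel"
      "(\<lambda>x. (\<zeta> - z) * (v x / (x - z) / (x - \<zeta>))) \<in> borel_measurable borel"
      using meas by measurable
    fix x assume "x \<in> {e..b}"
    then have "x - \<zeta> \<noteq> 0" "x - z \<noteq> 0"
      using assms e_pos by auto
    then show "v x / (x - \<zeta>) - v x / (x - z) = (\<zeta> - z) * (v x / (x - z) / (x - \<zeta>))"
      by (simp add: diff_frac_eq mult.commute) (simp add: algebra_simps)
  qed
  finally show ?thesis
    by (simp only: T_def integral_mult_right_zero)
qed

lemma H_continuous: "continuous_on {..-1} H"
proof -
  have "continuous_on {..-1} (T wt)"
  proof (rule lipschitz_on_continuous_on[where L = "wt b"], rule lipschitz_onI)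
    fix \<zeta> z :: real assume "\<zeta> \<in> {..-1}" "z \<in> {..-1}"
    then have z: "\<zeta> \<le> -1" "z \<le> -1" by auto
    show "dist (T wt \<zeta>) (T wt z) \<le> wt b * dist \<zeta> z"
      using T_bounds[OF admissible_divide[OF admissible_wt z(2)] z(1)]
      unfolding dist_real_def T_diff[OF admissible_wt z] abs_mult
      by (simp add: mult.commute[of "wt b"] mult_left_mono)
  next
    show "0 \<le> wt b"
      using admissible_wt range_nonempty by (auto simp: admissible_def less_imp_le)
  qed
  then show ?thesis
    unfolding H_def quad_def by (intro continuous_intros)
qed

lemma H_minus_1: "H (-1) = c + g"
proof -
  have "T wt (-1) = (\<integral>x. x \<partial>\<mu>)"
    unfolding T_def
  proof (rule integral_cong_on)
    show "wt x / (x - - 1) = x" if "x \<in> {e..b}" for x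
      using that e_pos by (simp add: wt_def add.commute)
    show "(\<lambda>x. wt x / (x - - 1)) \<in> borel_measurable borel"
      unfolding wt_def by measurable
  qed simp
  then show ?thesis
    by (simp add: H_def m_def quad_def algebra_simps)
qed

lemma m_nonneg: "0 \<le> m"
proof -
  have "(\<integral>x. 0 \<partial>\<mu>) \<le> m"
    unfolding m_def by (rule integral_mono_on[OF _ int_id]) (use e_pos in auto)
  then show ?thesis by simp
qed

lemma H_negative: "\<exists>\<zeta>\<le>-1. H \<zeta> < 0"
proof -
  \<comment> \<open>As \<open>k \<ge> 1\<close>, constants may be enlarged by a factor
    \<open>k\<close>; the sum of the coefficients plus \<open>1\<close> is then just large enough
    for \<open>- k * k\<close> to absorb all other terms and leave \<open>- k\<close>.\<close>
  define k where "k = 1 + \<bar>\<alpha> - c - 1\<bar> + 2 * g * (1 + m) + \<bar>\<alpha> - g\<bar>"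
  have k: "1 \<le> k"
    using g_pos m_nonneg by (simp add: k_def)
  have "0 < T wt (-k)"
    using k by (intro T_bounds admissible_wt) simp
  then have "H (-k) \<le> 2 * g * (1 + m) + quad (-k)"
    using g_pos by (simp add: H_def)
  also have "quad (-k) = - (k * k) - (\<alpha> - c - 1) * k + (\<alpha> - g)"
    by (simp add: quad_def algebra_simps)
  also have "2 * g * (1 + m) + (- (k * k) - (\<alpha> - c - 1) * k + (\<alpha> - g))
      \<le> - (k * k) + \<bar>\<alpha> - c - 1\<bar> * k + (2 * g * (1 + m) + \<bar>\<alpha> - g\<bar>) * 1"
  proof -
    have "q + (- (k * k) - A * k + B) \<le> - (k * k) + \<bar>A\<bar> * k + (q + \<bar>B\<bar>) * 1" for q A B
    proof -
      have "- A * k \<le> \<bar>A\<bar> * k"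
        using k by (intro mult_right_mono) auto
      then show ?thesis
        using abs_ge_self[of B] by simp
    qed
    then show ?thesis .
  qed
  also have "\<dots> \<le> - (k * k) + \<bar>\<alpha> - c - 1\<bar> * k + (2 * g * (1 + m) + \<bar>\<alpha> - g\<bar>) * k"
    using k g_pos m_nonneg by (intro add_left_mono mult_left_mono) auto
  also have "\<dots> = - k"
    unfolding k_def by (simp add: algebra_simps)
  finally show ?thesis
    using k by (intro exI[of _ "-k"]) auto
qed

lemma H_eq:
  assumes "\<zeta> < -1"
  shows "H \<zeta> = - 2 * g * \<zeta> * (1 + (1 + \<zeta>) * G \<zeta>) + quad \<zeta>" "(H \<zeta>)\<^sup>2 = D \<zeta>"
proof -
  have TG: "T wt \<zeta> = m + (1 + \<zeta>) + \<zeta> * (1 + \<zeta>) * G \<zeta>"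
  proof -
    have "T wt \<zeta> = (\<integral>x. (x + (1 + \<zeta>)) + (\<zeta> * (1 + \<zeta>)) * (1 / (x - \<zeta>)) \<partial>\<mu>)"
      unfolding T_def
    proof (rule integral_cong_on)
      show "(\<lambda>x. wt x / (x - \<zeta>)) \<in> borel_measurable borel"
        "(\<lambda>x. (x + (1 + \<zeta>)) + (\<zeta> * (1 + \<zeta>)) * (1 / (x - \<zeta>))) \<in> borel_measurable borel"
        unfolding wt_def by measurable
      show "wt x / (x - \<zeta>) = (x + (1 + \<zeta>)) + (\<zeta> * (1 + \<zeta>)) * (1 / (x - \<zeta>))" if "x \<in> {e..b}" for x
      proof -
        have "x - \<zeta> \<noteq> 0"
          using that assms e_pos by auto
        then have "((x + (1 + \<zeta>)) + (\<zeta> * (1 + \<zeta>)) * (1 / (x - \<zeta>))) * (x - \<zeta>) = (x + (1 + \<zeta>)) * (x - \<zeta>) + \<zeta> * (1 + \<zeta>)"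
          by (simp add: distrib_right)
        also have "\<dots> = wt x"
          by (simp add: wt_def algebra_simps)
        finally show ?thesis
          unfolding nonzero_eq_divide_eq[OF \<open>x - \<zeta> \<noteq> 0\<close>, symmetric] by (rule sym)
      qed
    qed
    also have "\<dots> = (\<integral>x. x + (1 + \<zeta>) \<partial>\<mu>) + (\<integral>x. (\<zeta> * (1 + \<zeta>)) * (1 / (x - \<zeta>)) \<partial>\<mu>)"
      using assms by (intro Bochner_Integration.integral_add integrable_mult_right int_G
          Bochner_Integration.integrable_add int_id integrable_const) simp
    also have "(\<integral>x. x + (1 + \<zeta>) \<partial>\<mu>) = (\<integral>x. x \<partial>\<mu>) + (\<integral>x. 1 + \<zeta> \<partial>\<mu>)"
      by (intro Bochner_Integration.integral_add int_id integrable_const)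
    also have "\<dots> = m + (1 + \<zeta>)"
      unfolding m_def int_const ..
    also have "(\<integral>x. (\<zeta> * (1 + \<zeta>)) * (1 / (x - \<zeta>)) \<partial>\<mu>) = \<zeta> * (1 + \<zeta>) * G \<zeta>"
      unfolding G_def by (rule integral_mult_right_zero)
    finally show ?thesis .
  qed
  show H: "H \<zeta> = - 2 * g * \<zeta> * (1 + (1 + \<zeta>) * G \<zeta>) + quad \<zeta>"
    by (simp add: H_def TG algebra_simps)
  define P where "P = 1 + (1 + \<zeta>) * G \<zeta>"
  have "g * P\<^sup>2 * (1 - (1 + \<zeta>)) + P * (\<alpha> * (1 + \<zeta>) + (c + (1 + \<zeta>)) * (1 - (1 + \<zeta>)) - g) - c - (1 + \<zeta>) * (m + 1) = 0"
    unfolding m_def using assms by (intro equation) (simp_all add: P_def G_def)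
  then have "P * quad \<zeta> = g * \<zeta> * P\<^sup>2 + c + (1 + \<zeta>) * (m + 1)"
    by (simp add: quad_def algebra_simps)
  then show "(H \<zeta>)\<^sup>2 = D \<zeta>"
    unfolding H D_def P_def[symmetric] by algebra
qed

section \<open>The quartic discriminant and its double root\<close>

definition "d3 = - 2 * (\<alpha> - c - 1)"
definition "d2 = (\<alpha> - c - 1)\<^sup>2 - 2 * (\<alpha> - g) - 4 * g * (m + 1)"

definition "d1 = 2 * (\<alpha> - c - 1) * (\<alpha> - g) - 4 * g * (c + m + 1)"

lemma D_poly: "D \<zeta> = \<zeta> ^ 4 + d3 * \<zeta> ^ 3 + d2 * \<zeta>\<^sup>2 + d1 * \<zeta> + (\<alpha> - g)\<^sup>2"
proof -
  have "(- x\<^sup>2 + u * x + v)\<^sup>2 - 4 * g * x * (c + (1 + x) * k)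
      = x ^ 4 + (- 2 * u) * x ^ 3 + (u\<^sup>2 - 2 * v - 4 * g * k) * x\<^sup>2 + (2 * u * v - 4 * g * (c + k)) * x + v\<^sup>2"
    for x u v k :: real
    by (simp add: power2_eq_square power3_eq_cube power4_eq_xxxx algebra_simps)
  moreover have "quad \<zeta> = - \<zeta>\<^sup>2 + (\<alpha> - c - 1) * \<zeta> + (\<alpha> - g)"
    by (simp add: quad_def power2_eq_square algebra_simps)
  ultimately show ?thesis
    unfolding D_def d3_def d2_def d1_def by (simp only: add.assoc)
qed

lemma D_0: "D 0 = (\<alpha> - g)\<^sup>2" and D_minus_1: "D (-1) = (c + g)\<^sup>2"
  by (simp_all add: D_def quad_def) (simp add: power2_eq_square algebra_simps)

text \<open>For \<open>-1 \<le> \<zeta> < 0\<close> the subtracted product in \<open>D\<close> is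
  negative; at \<open>0\<close> only \<open>(\<alpha> - g)\<^sup>2\<close> is left. This bridges the
  gap between the origin and the half-line where \<open>D\<close> is known to be a square.\<close>

lemma D_pos:
  assumes "-1 \<le> \<zeta>" "\<zeta> \<le> 0" shows "0 < D \<zeta>"
proof (cases "\<zeta> = 0")
  case True
  then show ?thesis
    using \<alpha>_g by (simp add: D_0)
next
  case False
  then have "0 < (- \<zeta>) * (4 * g) * (c + (1 + \<zeta>) * (m + 1))"
    using assms g_pos c_pos m_nonneg by (intro mult_pos_pos add_pos_nonneg mult_nonneg_nonneg) auto
  also have "(- \<zeta>) * (4 * g) * (c + (1 + \<zeta>) * (m + 1)) = - (4 * g * \<zeta> * (c + (1 + \<zeta>) * (m + 1)))"
    by simp
  finally show ?thesis
    using zero_le_power2[of "quad \<zeta>"] unfolding D_def by linarith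
qed

lemma double_root:
  obtains z s t L where "z < -1" "0 < s" "s < t" "\<And>\<zeta>. D \<zeta> = (\<zeta> - z)\<^sup>2 * ((\<zeta> - s) * (\<zeta> - t))"
    "s + t = - (d3 + 2 * z)"
    "\<And>\<zeta>. \<zeta> < -1 \<Longrightarrow> H \<zeta> = (\<zeta> - z) * sqrt ((s - \<zeta>) * (t - \<zeta>))"
proof -
  obtain \<zeta>1 where \<zeta>1: "\<zeta>1 \<le> -1" "H \<zeta>1 < 0"
    using H_negative by blast
  have "\<exists>x\<ge>\<zeta>1. x \<le> -1 \<and> H x = 0"
    using \<zeta>1 H_minus_1 c_pos g_pos
    by (intro IVT' continuous_on_subset[OF H_continuous]) auto
  then obtain z where z: "z \<le> -1" "H z = 0"
    by blast
  then have z1: "z < -1"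
    using H_minus_1 c_pos g_pos by (cases "z = -1") auto
  define v1 where "v1 = (\<lambda>x. wt x / (x - z))"
  define v2 where "v2 = (\<lambda>x. v1 x / (x - z))"
  define v3 where "v3 = (\<lambda>x. v2 x / (x - z))"
  have v1: "admissible v1"
    unfolding v1_def by (intro admissible_divide admissible_wt z)
  have v2: "admissible v2"
    unfolding v2_def by (intro admissible_divide v1 z)
  have v3: "admissible v3"
    unfolding v3_def by (intro admissible_divide v2 z)
  \<comment> \<open>Divided difference of \<open>H\<close> at its zero \<open>z\<close>, so that
    \<open>H \<zeta> = (\<zeta> - z) * L \<zeta>\<close>.\<close>
  define L where "L \<zeta> = \<alpha> - c - 1 - \<zeta> - z - 2 * g * T v1 \<zeta>" for \<zeta>
  have HL: "H \<zeta> = (\<zeta> - z) * L \<zeta>" if "\<zeta> \<le> -1" for \<zeta>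
  proof -
    have "H \<zeta> = H \<zeta> - H z"
      by (simp add: z)
    also have "\<dots> = (quad \<zeta> - quad z) - 2 * g * (T wt \<zeta> - T wt z)"
      by (simp add: H_def algebra_simps)
    also have "\<dots> = (\<zeta> - z) * L \<zeta>"
      unfolding T_diff[OF admissible_wt that z(1)] by (simp add: quad_def L_def v1_def algebra_simps)
    finally show ?thesis .
  qed
  \<comment> \<open>\<open>- B\<close> is the divided difference of \<open>L\<close> at
    \<open>z\<close>: the \<open>1\<close> comes from \<open>quad\<close>, the excess over
    \<open>1\<close> from the positivity of the measure.\<close>
  define B where "B \<zeta> = 1 + 2 * g * T v2 \<zeta>" for \<zeta>
  have B1: "1 < B \<zeta>" if "\<zeta> \<le> -1" for \<zeta>
    using T_bounds(1)[OF v2 that] g_pos by (simp add: B_def)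
  have LB: "L \<zeta> = L z - (\<zeta> - z) * B \<zeta>" if "\<zeta> \<le> -1" for \<zeta>
    using T_diff[OF v1 that z(1), folded v2_def] by (simp add: L_def B_def) algebra
  \<comment> \<open>The points \<open>z + y k\<close> approach \<open>z\<close> inside the region
    where \<open>H\<^sup>2 = D\<close> is available; dividing by \<open>y k\<close> takes the place
    of differentiation at \<open>z\<close>.\<close>
  define y where "y k = - inverse (real (Suc k))" for k
  have y: "y k < 0" "z + y k < -1" for k
  proof -
    show "y k < 0"
      by (simp add: y_def)
    then show "z + y k < -1"
      using z1 by simp
  qed
  have lim_y: "y \<longlonglongrightarrow> 0"
    unfolding y_def using tendsto_minus[OF LIMSEQ_inverse_real_of_nat] by simp
  have lim_B: "(\<lambda>k. B (z + y k)) \<longlonglongrightarrow> B z"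
  proof -
    have "(\<lambda>k. y k * T v3 (z + y k)) \<longlonglongrightarrow> 0"
    proof (rule Lim_null_comparison)
      have "\<bar>T v3 \<zeta>\<bar> \<le> wt b" if "\<zeta> < -1" for \<zeta>
        using T_bounds[OF v3, of \<zeta>] that by simp
      then show "\<forall>\<^sub>F k in sequentially. norm (y k * T v3 (z + y k)) \<le> \<bar>y k\<bar> * wt b"
        using y(2) by (intro always_eventually allI) (simp add: abs_mult mult_left_mono)
      show "(\<lambda>k. \<bar>y k\<bar> * wt b) \<longlonglongrightarrow> 0"
        using tendsto_mult[OF tendsto_rabs[OF lim_y] tendsto_const[of "wt b"]] by simp
    qed
    moreover have "T v2 (z + y k) = T v2 z + y k * T v3 (z + y k)" for k
      using T_diff[OF v2 _ z(1), of "z + y k", folded v3_def] y(2)[of k] by simp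
    ultimately have "(\<lambda>k. T v2 (z + y k)) \<longlonglongrightarrow> T v2 z + 0"
      by (simp only:) (intro tendsto_intros)
    then show ?thesis
      unfolding B_def by (auto intro!: tendsto_intros)
  qed
  \<comment> \<open>Quotient of \<open>D\<close> by \<open>(\<zeta> - z)\<^sup>2\<close>;
    \<open>r\<close> is the derivative of \<open>D\<close> at \<open>z\<close> and must vanish
    because \<open>D = H\<^sup>2\<close> is of second order there.\<close>
  define Q where "Q \<zeta> = \<zeta>\<^sup>2 + (d3 + 2 * z) * \<zeta> + (d2 + 2 * z * d3 + 3 * z\<^sup>2)" for \<zeta>
  define r where "r = 4 * z ^ 3 + 3 * d3 * z\<^sup>2 + 2 * d2 * z + d1"
  have Dz: "D z = 0"
    using H_eq(2)[OF z1] z(2) by simp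
  have "D \<zeta> = (\<zeta> - z)\<^sup>2 * Q \<zeta> + r * (\<zeta> - z) + D z" for \<zeta>
    unfolding D_poly Q_def r_def
    by (simp add: power2_eq_square power3_eq_cube power4_eq_xxxx algebra_simps)
  then have DQ: "D \<zeta> = (\<zeta> - z)\<^sup>2 * Q \<zeta> + r * (\<zeta> - z)" for \<zeta>
    unfolding Dz add_0_right .
  have "r = 0"
  proof -
    have eq: "r = y k * ((L z - y k * B (z + y k))\<^sup>2 - Q (z + y k))" for k
    proof -
      have "(y k)\<^sup>2 * (L (z + y k))\<^sup>2 = (y k)\<^sup>2 * Q (z + y k) + r * y k"
        using HL[of "z + y k"] H_eq(2)[OF y(2)[of k]] DQ[of "z + y k"] y(2)[of k] by (simp add: power_mult_distrib)
      then have "y k * r = y k * (y k * ((L (z + y k))\<^sup>2 - Q (z + y k)))"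
        by (simp add: power2_eq_square algebra_simps)
      then have "r = y k * ((L (z + y k))\<^sup>2 - Q (z + y k))"
        using y(1)[of k] by simp
      then show ?thesis
        using LB[of "z + y k"] y(2)[of k] by simp
    qed
    have "(\<lambda>k. y k * ((L z - y k * B (z + y k))\<^sup>2 - Q (z + y k))) \<longlonglongrightarrow>
        0 * ((L z - 0 * B z)\<^sup>2 - Q (z + 0))"
      unfolding Q_def by (intro tendsto_intros lim_y lim_B)
    then have "(\<lambda>k. r) \<longlonglongrightarrow> 0"
      unfolding eq[symmetric] by simp
    then show ?thesis
      by (simp add: LIMSEQ_const_iff)
  qed
  then have DQ: "D \<zeta> = (\<zeta> - z)\<^sup>2 * Q \<zeta>" for \<zeta>
    using DQ by simp
  have LQ: "(L \<zeta>)\<^sup>2 = Q \<zeta>" if "\<zeta> < -1" "\<zeta> \<noteq> z" for \<zeta>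
    using HL[of \<zeta>] H_eq(2)[OF that(1)] DQ[of \<zeta>] that by (simp add: power_mult_distrib)
  \<comment> \<open>The derivative of \<open>Q\<close> at \<open>z\<close>; the first-order terms of
    \<open>L\<^sup>2 = Q\<close> will identify it as \<open>- 2 * L z * B z\<close>.\<close>
  define \<beta> where "\<beta> = 2 * z + d3 + 2 * z"
  have Qy: "Q (z + x) = x\<^sup>2 + \<beta> * x + Q z" for x
    by (simp add: Q_def \<beta>_def power2_eq_square algebra_simps)
  have eq: "(L z - y k * B (z + y k))\<^sup>2 = (y k)\<^sup>2 + \<beta> * y k + Q z" for k
    using LQ[of "z + y k"] LB[of "z + y k"] y[of k] Qy[of "y k"] by simp
  have Qz: "Q z = (L z)\<^sup>2"
  proof -
    have "(\<lambda>k. (L z - y k * B (z + y k))\<^sup>2) \<longlonglongrightarrow> (L z - 0 * B z)\<^sup>2"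
      by (intro tendsto_intros lim_y lim_B)
    moreover have "(\<lambda>k. (y k)\<^sup>2 + \<beta> * y k + Q z) \<longlonglongrightarrow> 0\<^sup>2 + \<beta> * 0 + Q z"
      by (intro tendsto_intros lim_y)
    ultimately have "(L z - 0 * B z)\<^sup>2 = 0\<^sup>2 + \<beta> * 0 + Q z"
      unfolding eq by (rule LIMSEQ_unique)
    then show ?thesis by simp
  qed
  have eq': "\<beta> = - 2 * L z * B (z + y k) + y k * (B (z + y k))\<^sup>2 - y k" for k
  proof -
    have "y k * \<beta> = y k * (- 2 * L z * B (z + y k) + y k * (B (z + y k))\<^sup>2 - y k)"
      using eq[of k] unfolding Qz by (simp add: power2_eq_square algebra_simps)
    then show ?thesis
      using y(1)[of k] by simp
  qed
  have \<beta>: "\<beta> = - 2 * L z * B z"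
  proof -
    have "(\<lambda>k. - 2 * L z * B (z + y k) + y k * (B (z + y k))\<^sup>2 - y k) \<longlonglongrightarrow>
        - 2 * L z * B z + 0 * (B z)\<^sup>2 - 0"
      by (intro tendsto_intros lim_y lim_B)
    then have "(\<lambda>k. \<beta>) \<longlonglongrightarrow> - 2 * L z * B z"
      unfolding eq'[symmetric] by simp
    then show ?thesis
      by (simp add: LIMSEQ_const_iff)
  qed
  \<comment> \<open>With \<open>L z = 0\<close>, what is left of \<open>L\<^sup>2 = Q\<close> would
    force \<open>B\<^sup>2 = 1\<close> at a nearby point, against \<open>B > 1\<close>.\<close>
  have Lz: "L z \<noteq> 0"
  proof
    assume "L z = 0"
    then have "y 0 * (B (z + y 0))\<^sup>2 = y 0"
      using eq'[of 0] \<beta> by simp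
    then have "(B (z + y 0))\<^sup>2 = 1"
      using y(1)[of 0] by simp
    then show False
      using B1[of "z + y 0"] y(2)[of 0] by (simp add: power2_eq_1_iff)
  qed
  \<comment> \<open>Inserting \<open>\<beta>\<close> and \<open>Q z\<close>, the discriminant equals
    \<open>4 (L z)\<^sup>2 ((B z)\<^sup>2 - 1)\<close>.\<close>
  have disc: "0 < \<beta>\<^sup>2 - 4 * Q z"
  proof -
    have "1 < (B z)\<^sup>2"
      using B1[OF z(1)] by (simp add: one_less_power)
    then have "0 < 4 * (L z)\<^sup>2 * ((B z)\<^sup>2 - 1)"
      using Lz by simp
    then show ?thesis
      unfolding \<beta> Qz by (simp add: power_mult_distrib algebra_simps)
  qed
  define \<delta> where "\<delta> = sqrt (\<beta>\<^sup>2 - 4 * Q z)"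
  define s t where "s = z + (- \<beta> - \<delta>) / 2" and "t = z + (- \<beta> + \<delta>) / 2"
  have \<delta>: "0 < \<delta>" "\<delta>\<^sup>2 = \<beta>\<^sup>2 - 4 * Q z"
    using disc by (simp_all add: \<delta>_def)
  have st: "s < t"
    using \<delta>(1) by (simp add: s_def t_def)
  have Q_st: "Q \<zeta> = (\<zeta> - s) * (\<zeta> - t)" for \<zeta>
  proof -
    have "(\<zeta> - s) * (\<zeta> - t) = (\<zeta> - z)\<^sup>2 + \<beta> * (\<zeta> - z) + (\<beta>\<^sup>2 - \<delta>\<^sup>2) / 4"
      unfolding s_def t_def by (simp add: power2_eq_square field_simps)
    then show ?thesis
      using Qy[of "\<zeta> - z"] unfolding \<delta>(2) by simp
  qed
  have Q_nonneg: "0 \<le> Q \<zeta>" if "\<zeta> \<le> 0" for \<zeta>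
  proof (cases "\<zeta> < -1")
    case True
    then have "Q \<zeta> = (L \<zeta>)\<^sup>2"
      using LQ[of \<zeta>] Qz by (cases "\<zeta> = z") auto
    then show ?thesis
      by simp
  next
    case False
    then have "0 < (\<zeta> - z)\<^sup>2 * Q \<zeta>"
      using D_pos[of \<zeta>] that DQ by simp
    then show ?thesis
      by (simp add: zero_less_mult_iff)
  qed
  \<comment> \<open>A root \<open>s < 0\<close> would make \<open>Q\<close> negative at the point
    \<open>\<xi>\<close> between the roots, where \<open>Q\<close> is known to be nonnegative;
    \<open>s = 0\<close> contradicts \<open>D 0 \<noteq> 0\<close>.\<close>
  have s_pos: "0 < s"
  proof (rule ccontr)
    assume "\<not> 0 < s"
    show False
    proof (cases "s = 0")
      case True
      then show False
        using D_0 DQ[of 0] Q_st[of 0] \<alpha>_g by simp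
    next
      case False
      define \<xi> where "\<xi> = (s + min t 0) / 2"
      have "s < \<xi>" "\<xi> < t" "\<xi> \<le> 0"
        using False \<open>\<not> 0 < s\<close> st by (auto simp: \<xi>_def)
      then show False
        using Q_nonneg[of \<xi>] unfolding Q_st by (simp add: zero_le_mult_iff)
    qed
  qed
  \<comment> \<open>\<open>L\<close> is positive at \<open>-1\<close> and nowhere smaller to the
    left of it; this fixes the sign of the square root of \<open>Q\<close>.\<close>
  have L_pos: "0 < L \<zeta>" if \<zeta>: "\<zeta> \<le> -1" for \<zeta>
  proof -
    have "(-1 - z) * L (-1) = c + g"
      using HL[of "-1"] H_minus_1 by simp
    then have "0 < L (-1)"
      using z1 c_pos g_pos by (metis add_pos_pos diff_gt_0_iff_gt zero_less_mult_pos)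
    moreover have "T v1 \<zeta> - T v1 (-1) \<le> 0"
      using T_bounds(1)[OF admissible_divide[OF v1, of "-1"] \<zeta>] \<zeta>
      by (subst T_diff[OF v1 \<zeta>]) (auto intro: mult_nonpos_nonneg)
    then have "2 * g * T v1 \<zeta> \<le> 2 * g * T v1 (-1)"
      using g_pos by (intro mult_left_mono) auto
    then have "L (-1) \<le> L \<zeta>"
      using \<zeta> unfolding L_def by linarith
    ultimately show ?thesis
      by simp
  qed
  have L_sqrt: "L \<zeta> = sqrt ((s - \<zeta>) * (t - \<zeta>))" if "\<zeta> < -1" for \<zeta>
  proof -
    have "(L \<zeta>)\<^sup>2 = Q \<zeta>"
      using LQ[OF that] Qz by (cases "\<zeta> = z") auto
    also have "\<dots> = (s - \<zeta>) * (t - \<zeta>)"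
      unfolding Q_st by (simp add: algebra_simps)
    finally have "sqrt ((s - \<zeta>) * (t - \<zeta>)) = L \<zeta>"
      using L_pos[of \<zeta>] that by (intro real_sqrt_unique) auto
    then show ?thesis ..
  qed
  show ?thesis
  proof (rule that[OF z1 s_pos st])
    show "D \<zeta> = (\<zeta> - z)\<^sup>2 * ((\<zeta> - s) * (\<zeta> - t))" for \<zeta>
      unfolding DQ Q_st ..
    show "s + t = - (d3 + 2 * z)"
      by (simp add: s_def t_def \<beta>_def field_simps)
    show "H \<zeta> = (\<zeta> - z) * sqrt ((s - \<zeta>) * (t - \<zeta>))" if "\<zeta> < -1" for \<zeta>
      using HL[of \<zeta>] L_sqrt[OF that] that by simp
  qed
qed

text \<open>Comparing \<open>D\<close> with its factorisation at \<open>0\<close> and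
  \<open>-1\<close> gives \<open>- z * sqrt (s * t) = \<alpha> - g\<close> and
  \<open>- (1 + z) * sqrt ((s + 1) * (t + 1)) = c + g\<close>. So the two coefficients of the
  density are \<open>- z / g\<close> and \<open>- (1 + z) / g\<close>: their difference
  \<open>1 / g\<close> is the first equation of the system, and the sum of the roots yields the
  second.\<close>

theorem has_distribution_free_Kummer:
  assumes X: "has_distribution \<phi> X \<mu>"
  shows "\<exists>\<nu>. is_free_Kummer (\<alpha> / g) ((c + g) / g) (1 / g) \<nu> \<and> has_distribution \<phi> X \<nu>"
proof -
  obtain z s t where z: "z < -1" and st: "0 < s" "s < t"
    and D: "\<And>\<zeta>. D \<zeta> = (\<zeta> - z)\<^sup>2 * ((\<zeta> - s) * (\<zeta> - t))"
    and sum: "s + t = - (d3 + 2 * z)"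
    and H: "\<And>\<zeta>. \<zeta> < -1 \<Longrightarrow> H \<zeta> = (\<zeta> - z) * sqrt ((s - \<zeta>) * (t - \<zeta>))"
    by (rule double_root) blast
  define p q where "p = sqrt (s * t)" and "q = sqrt ((s + 1) * (t + 1))"
  have pq: "0 < p" "0 < q"
    using st by (simp_all add: p_def q_def)
  have zp: "- z * p = \<alpha> - g"
  proof (rule power2_eq_imp_eq)
    show "(- z * p)\<^sup>2 = (\<alpha> - g)\<^sup>2"
      using D[of 0] D_0 st by (simp add: p_def power_mult_distrib)
    show "0 \<le> - z * p"
      using z pq by (intro mult_nonneg_nonneg) auto
  qed (use \<alpha>_g in simp)
  have zq: "- (1 + z) * q = c + g"
  proof (rule power2_eq_imp_eq)
    have "D (-1) = (1 + z)\<^sup>2 * ((s + 1) * (t + 1))"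
      unfolding D by (simp add: power2_eq_square algebra_simps)
    then show "(- (1 + z) * q)\<^sup>2 = (c + g)\<^sup>2"
      using D_minus_1 st by (simp add: q_def power_mult_distrib power2_eq_square algebra_simps)
    show "0 \<le> - (1 + z) * q"
      using z pq by (intro mult_nonneg_nonneg) auto
  qed (use c_pos g_pos in simp)
  define a1 b1 where "a1 = (\<alpha> / g - 1) / p" and "b1 = ((c + g) / g) / q"
  have a1: "a1 = - z / g" and b1: "b1 = - (1 + z) / g"
  proof -
    have "\<alpha> / g - 1 = (- z * p) / g"
      unfolding zp using g_pos by (simp add: diff_divide_distrib)
    then show "a1 = - z / g"
      unfolding a1_def using pq by simp
    show "b1 = - (1 + z) / g"
      unfolding b1_def zq[symmetric] using pq by simp
  qed
  have ab: "0 < a1" "0 < b1" "a1 - b1 = 1 / g"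
  proof -
    show "0 < a1" "0 < b1"
      unfolding a1 b1 using z g_pos by (intro divide_pos_pos; simp)+
    show "a1 - b1 = 1 / g"
      unfolding a1 b1 using g_pos by (simp add: field_simps)
  qed
  have system: "free_Kummer_system (\<alpha> / g) ((c + g) / g) (1 / g) s t"
    unfolding free_Kummer_system_def p_def[symmetric] q_def[symmetric] a1_def[symmetric] b1_def[symmetric]
  proof (intro conjI st)
    show "1 / g + b1 - a1 = 0"
      using ab(3) by simp
    show "1 / g * ((s + t) / 2) - \<alpha> / g + 1 + (c + g) / g - b1 = 2"
      unfolding sum b1 d3_def using g_pos by (simp add: field_simps)
  qed
  define h where "h x = 1 / (2 * pi) * sqrt ((x - s) * (t - x)) * (a1 / x - b1 / (1 + x))" for x
  have dens: "free_Kummer_density (\<alpha> / g) ((c + g) / g) s t x = h x * indicator {s<..<t} x" for x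
    unfolding free_Kummer_density_def h_def a1_def b1_def p_def q_def by (simp add: mult_ac)
  have meas: "free_Kummer_density (\<alpha> / g) ((c + g) / g) s t \<in> borel_measurable borel"
    unfolding free_Kummer_density_def by measurable
  let ?N = "density lborel (\<lambda>x. ennreal (free_Kummer_density (\<alpha> / g) ((c + g) / g) s t x))"
  have hc: "continuous_on {s..t} h"
    unfolding h_def using st by (intro continuous_intros) auto
  have h0: "0 \<le> h x" if x: "x \<in> {s<..<t}" for x
  proof -
    have x0: "0 < x"
      using x st by simp
    have "b1 / (1 + x) \<le> a1 / x"
      using x0 ab g_pos by (intro frac_le) (auto simp: algebra_simps)
    then show ?thesis
      unfolding h_def using x by (intro mult_nonneg_nonneg) auto
  qed
  note K = density_on_interval[OF less_imp_le[OF st(1)] less_imp_le[OF st(2)] hc h0 meas dens]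
  have transform: "(\<integral>x. 1 / (x - \<zeta>) \<partial>?N) = G \<zeta>" if \<zeta>: "\<zeta> < -1" for \<zeta>
  proof -
    let ?S = "\<lambda>x. sqrt ((x - s) * (t - x))"
    define L where "L = sqrt ((s - \<zeta>) * (t - \<zeta>))"
    have J: "((\<lambda>x. ?S x / (x - \<xi>)) has_integral pi * arc_transform s t \<xi>) {s..t}" if "\<xi> \<le> 0" for \<xi>
      using that st by (intro arc_transform_integral) auto
    \<comment> \<open>Partial fractions in \<open>x\<close> split the transform into arc integrals
      at \<open>\<zeta>\<close>, \<open>0\<close> and \<open>-1\<close>.\<close>
    have "((\<lambda>x. (a1 / \<zeta>) * (?S x / (x - \<zeta>) - ?S x / (x - 0))
        - (b1 / (1 + \<zeta>)) * (?S x / (x - \<zeta>) - ?S x / (x - -1))) has_integral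
        (a1 / \<zeta>) * (pi * arc_transform s t \<zeta> - pi * arc_transform s t 0)
        - (b1 / (1 + \<zeta>)) * (pi * arc_transform s t \<zeta> - pi * arc_transform s t (-1))) {s..t}"
      using \<zeta> by (intro has_integral_diff has_integral_mult_right J) auto
    then have "((\<lambda>x. 1 / (2 * pi) * ((a1 / \<zeta>) * (?S x / (x - \<zeta>) - ?S x / (x - 0))
        - (b1 / (1 + \<zeta>)) * (?S x / (x - \<zeta>) - ?S x / (x - -1)))) has_integral
        1 / (2 * pi) * ((a1 / \<zeta>) * (pi * arc_transform s t \<zeta> - pi * arc_transform s t 0)
        - (b1 / (1 + \<zeta>)) * (pi * arc_transform s t \<zeta> - pi * arc_transform s t (-1)))) {s..t}"
      by (rule has_integral_mult_right)
    moreover have "1 / (2 * pi) * ((a1 / \<zeta>) * (?S x / (x - \<zeta>) - ?S x / (x - 0))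
        - (b1 / (1 + \<zeta>)) * (?S x / (x - \<zeta>) - ?S x / (x - -1))) = h x * (1 / (x - \<zeta>))" if x: "x \<in> {s..t}" for x
    proof -
      have x0: "x \<noteq> 0" "x - \<zeta> \<noteq> 0" "x - -1 \<noteq> 0" "\<zeta> \<noteq> 0" "1 + \<zeta> \<noteq> 0" "1 + x \<noteq> 0"
        using x st \<zeta> by auto
      have "?S x / (x - \<zeta>) - ?S x / (x - 0) = \<zeta> * (?S x / (x * (x - \<zeta>)))"
        using x0 by (simp add: diff_frac_eq mult.commute) (simp add: algebra_simps)
      moreover have "?S x / (x - \<zeta>) - ?S x / (x - -1) = (1 + \<zeta>) * (?S x / ((1 + x) * (x - \<zeta>)))"
        using x0 by (simp add: diff_frac_eq mult.commute add.commute[of x 1]) (simp add: algebra_simps)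
      moreover have "(a1 / \<zeta>) * (\<zeta> * T) = a1 * T" "(b1 / (1 + \<zeta>)) * ((1 + \<zeta>) * T) = b1 * T" for T
        using x0 by simp_all
      moreover have "k * (u * (S / (x * d)) - v * (S / (w * d))) = k * S * (u / x - v / w) * (1 / d)"
        for k u v S d w :: real
        by (simp add: algebra_simps)
      ultimately show ?thesis
        unfolding h_def by (simp only:)
    qed
    ultimately have "((\<lambda>x. h x * (1 / (x - \<zeta>))) has_integral
        1 / (2 * pi) * ((a1 / \<zeta>) * (pi * arc_transform s t \<zeta> - pi * arc_transform s t 0)
        - (b1 / (1 + \<zeta>)) * (pi * arc_transform s t \<zeta> - pi * arc_transform s t (-1)))) {s..t}"
      by (rule has_integral_eq[rotated])
    then have "(\<integral>x. 1 / (x - \<zeta>) \<partial>?N) = 1 / (2 * pi) * ((a1 / \<zeta>) * (pi * arc_transform s t \<zeta> - pi * arc_transform s t 0)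
        - (b1 / (1 + \<zeta>)) * (pi * arc_transform s t \<zeta> - pi * arc_transform s t (-1)))"
      using \<zeta> st by (intro K(3)) (auto intro!: continuous_intros)
    also have "\<dots> = 1 / 2 * ((a1 / \<zeta>) * (arc_transform s t \<zeta> - arc_transform s t 0)
        - (b1 / (1 + \<zeta>)) * (arc_transform s t \<zeta> - arc_transform s t (-1)))"
    proof -
      have "A * (pi * j - pi * k) - B * (pi * j - pi * l) = pi * (A * (j - k) - B * (j - l))" for A B j k l
        by (simp add: algebra_simps)
      moreover have "1 / (2 * pi) * (pi * Z) = 1 / 2 * Z" for Z
        by simp
      ultimately show ?thesis
        by (simp only:)
    qed
    also have "arc_transform s t \<zeta> - arc_transform s t 0 = p - \<zeta> - L"
      by (simp add: arc_transform_def p_def L_def)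
    also have "arc_transform s t \<zeta> - arc_transform s t (-1) = q - (1 + \<zeta>) - L"
      by (simp add: arc_transform_def q_def L_def)
    also have "1 / 2 * ((a1 / \<zeta>) * (p - \<zeta> - L) - (b1 / (1 + \<zeta>)) * (q - (1 + \<zeta>) - L)) = G \<zeta>"
    proof -
      have nz: "\<zeta> \<noteq> 0" "1 + \<zeta> \<noteq> 0"
        using \<zeta> by auto
      have HG: "(\<zeta> - z) * L = - 2 * g * \<zeta> * (1 + (1 + \<zeta>) * G \<zeta>) + quad \<zeta>"
        using H[OF \<zeta>] H_eq(1)[OF \<zeta>] by (simp add: L_def)
      have "2 * g * \<zeta> * (1 + \<zeta>) * (1 / 2 * ((a1 / \<zeta>) * (p - \<zeta> - L) - (b1 / (1 + \<zeta>)) * (q - (1 + \<zeta>) - L)))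
          = (g * a1) * (1 + \<zeta>) * (p - \<zeta> - L) - (g * b1) * \<zeta> * (q - (1 + \<zeta>) - L)"
      proof -
        have "2 * g * z * w * (1 / 2 * (A * u - B * v)) = (g * (A * z)) * w * u - (g * (B * w)) * z * v"
          for z w A B u v :: real
          by (simp add: algebra_simps)
        moreover have "a1 / \<zeta> * \<zeta> = a1" "b1 / (1 + \<zeta>) * (1 + \<zeta>) = b1"
          using nz by simp_all
        ultimately show ?thesis
          by (simp only:)
      qed
      also have "g * a1 = - z"
        using g_pos by (simp add: a1)
      also have "g * b1 = - (1 + z)"
        using g_pos by (simp add: b1)
      \<comment> \<open>The coefficient of \<open>L\<close> collapses to
        \<open>- (\<zeta> - z)\<close>, so that \<open>H\<close> appears; \<open>zp\<close> and
        \<open>zq\<close> supply the polynomial part \<open>quad\<close>.\<close>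
      also have "- z * (1 + \<zeta>) * (p - \<zeta> - L) - - (1 + z) * \<zeta> * (q - (1 + \<zeta>) - L) = 2 * g * \<zeta> * (1 + \<zeta>) * G \<zeta>"
        using HG zp zq unfolding quad_def by algebra
      finally show ?thesis
        using nz g_pos by simp
    qed
    finally show ?thesis .
  qed
  have "(\<integral>x. x ^ n \<partial>\<mu>) = (\<integral>x. x ^ n \<partial>?N)" for n
  proof (rule transform_determines_moments[OF bounded_distribution_measure K(1)])
    show "bounded_distribution \<mu> e b"
      by unfold_locales
    show "0 \<le> e"
      using e_pos by simp
    fix u :: real assume u: "0 < u" "u < 1"
    have eq: "1 / (1 + u * x) = (1 / u) * (1 / (x - (- 1 / u)))" for x
      using u by (simp add: distrib_left)
    have "- 1 / u < -1"
      using u by (simp add: field_simps)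
    then show "(\<integral>x. 1 / (1 + u * x) \<partial>\<mu>) = (\<integral>x. 1 / (1 + u * x) \<partial>?N)"
      unfolding eq using transform[of "- 1 / u"] by (simp only: integral_mult_right_zero G_def)
  qed
  then have "has_distribution \<phi> X ?N"
    by (intro has_distribution_same_moments[OF X K(1) _ K(2)]) auto
  moreover have "is_free_Kummer (\<alpha> / g) ((c + g) / g) (1 / g) ?N"
    unfolding is_free_Kummer_def using system \<alpha>_g g_pos by auto
  ultimately show ?thesis
    by blast
qed

end

section \<open>The characterization\<close>

context bounded_distribution
begin

text \<open>Every negative \<open>\<omega>\<close> needs a partner \<open>w\<close> with the same
  trace \<open>P\<close>, and conversely. The transform is Lipschitz and squeezed between
  \<open>1 / (1 + u * k1)\<close> and \<open>1 / (1 + u * k0)\<close>, so the intermediate value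
  theorem applies. It is used with \<open>k x = 1 / (1 + x)\<close> for \<open>X\<close> and
  \<open>k x = x\<close> for \<open>Y\<close>.\<close>

lemma transform_surjective:
  fixes k :: "real \<Rightarrow> real"
  assumes k: "k \<in> borel_measurable borel" "\<And>x. x \<in> {a..b} \<Longrightarrow> k0 \<le> k x \<and> k x \<le> k1" and "0 < k0"
  shows "0 < u \<Longrightarrow> 0 < (\<integral>x. 1 / (1 + u * k x) \<partial>\<mu>) \<and> (\<integral>x. 1 / (1 + u * k x) \<partial>\<mu>) < 1"
    and "0 < P \<Longrightarrow> P < 1 \<Longrightarrow> \<exists>u>0. (\<integral>x. 1 / (1 + u * k x) \<partial>\<mu>) = P"
proof -
  define h where "h u = (\<integral>x. 1 / (1 + u * k x) \<partial>\<mu>)" for u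
  have k01: "0 < k0" "k0 \<le> k1"
    using k(2)[of a] range_nonempty \<open>0 < k0\<close> by auto
  have pos: "1 \<le> 1 + u * k x" if "0 \<le> u" "x \<in> {a..b}" for u x
    using that k(2)[OF that(2)] k01 by simp
  have meas: "(\<lambda>x. 1 / (1 + u * k x)) \<in> borel_measurable borel" for u
    using k(1) by measurable
  have int: "integrable \<mu> (\<lambda>x. 1 / (1 + u * k x))" if "0 \<le> u" for u
  proof (rule integrable_bounded_on[OF meas])
    show "\<bar>1 / (1 + u * k x)\<bar> \<le> 1" if "x \<in> {a..b}" for x
      using pos[OF \<open>0 \<le> u\<close> that] by simp
  qed
  have const: "(\<integral>x. K \<partial>\<mu>) = K" for K :: real
    using prob_space by simp
  have bounds: "1 / (1 + u * k1) \<le> h u \<and> h u \<le> 1 / (1 + u * k0)" if u: "0 \<le> u" for u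
  proof -
    have "(\<integral>x. 1 / (1 + u * k1) \<partial>\<mu>) \<le> h u"
      unfolding h_def using pos[OF u] k(2) u k01
      by (intro integral_mono_on int) (auto intro!: divide_left_mono mult_left_mono mult_pos_pos add_pos_nonneg dest: less_le_trans[OF zero_less_one])
    moreover have "h u \<le> (\<integral>x. 1 / (1 + u * k0) \<partial>\<mu>)"
      unfolding h_def using pos[OF u] k(2) u k01
      by (intro integral_mono_on int) (auto intro!: divide_left_mono mult_left_mono mult_pos_pos add_pos_nonneg dest: less_le_trans[OF zero_less_one])
    ultimately show ?thesis
      unfolding const by simp
  qed
  show "0 < u \<Longrightarrow> 0 < (\<integral>x. 1 / (1 + u * k x) \<partial>\<mu>) \<and> (\<integral>x. 1 / (1 + u * k x) \<partial>\<mu>) < 1"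
  proof -
    assume u: "0 < u"
    have "0 < 1 / (1 + u * k1)" "1 / (1 + u * k0) < 1"
      using u k01 by (auto intro!: divide_pos_pos add_pos_nonneg simp: add_pos_pos)
    then have "0 < h u \<and> h u < 1"
      using bounds[OF less_imp_le[OF u]] by linarith
    then show ?thesis
      by (simp only: h_def)
  qed
  show "\<exists>u>0. (\<integral>x. 1 / (1 + u * k x) \<partial>\<mu>) = P" if P: "0 < P" "P < 1"
  proof -
    have lip: "dist (h u) (h v) \<le> k1 * dist u v" if uv: "0 \<le> u" "0 \<le> v" for u v
    proof -
      have "h u - h v = (\<integral>x. 1 / (1 + u * k x) - 1 / (1 + v * k x) \<partial>\<mu>)"
        unfolding h_def by (intro Bochner_Integration.integral_diff[symmetric] int uv)
      also have "\<bar>\<dots>\<bar> \<le> k1 * dist u v"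
      proof (rule integral_abs_le)
        show "(\<lambda>x. 1 / (1 + u * k x) - 1 / (1 + v * k x)) \<in> borel_measurable borel"
          by (intro borel_measurable_diff meas)
        fix x assume x: "x \<in> {a..b}"
        note p = pos[OF uv(1) x] pos[OF uv(2) x]
        have "1 / (1 + u * k x) - 1 / (1 + v * k x) = ((v - u) * k x) / ((1 + u * k x) * (1 + v * k x))"
          using p by (simp add: diff_frac_eq algebra_simps)
        also have "\<bar>\<dots>\<bar> \<le> \<bar>(v - u) * k x\<bar> / 1"
        proof -
          have "1 * 1 \<le> (1 + u * k x) * (1 + v * k x)"
            using p by (intro mult_mono) auto
          then show ?thesis
            unfolding abs_divide by (intro divide_left_mono) auto
        qed
        also have "\<dots> \<le> k1 * dist u v"
          using k(2)[OF x] k01 by (simp add: abs_mult dist_real_def abs_minus_commute mult.commute mult_right_mono)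
        finally show "\<bar>1 / (1 + u * k x) - 1 / (1 + v * k x)\<bar> \<le> k1 * dist u v" .
      qed
      finally show ?thesis
        by (simp add: dist_real_def)
    qed
    have cont: "continuous_on {0..} h"
      using k01 by (intro lipschitz_on_continuous_on[where L = k1] lipschitz_onI lip) auto
    \<comment> \<open>The two bounds take the value \<open>P\<close> exactly at
      \<open>u = q / k1\<close> and \<open>u = q / k0\<close>.\<close>
    define q where "q = 1 / P - 1"
    have q: "0 < q" "1 / (1 + q) = P"
      using P by (auto simp: q_def field_simps)
    have "\<exists>u\<ge>q / k1. u \<le> q / k0 \<and> h u = P"
    proof (rule IVT2')
      show "h (q / k0) \<le> P" "P \<le> h (q / k1)"
        using bounds[of "q / k0"] bounds[of "q / k1"] q k01 by auto
      show "q / k1 \<le> q / k0"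
        using q k01 by (intro divide_left_mono) auto
      show "continuous_on {q / k1..q / k0} h"
        using q k01 by (intro continuous_on_subset[OF cont]) auto
    qed
    then obtain u where "q / k1 \<le> u" "h u = P"
      by blast
    moreover have "0 < q / k1"
      using q k01 by simp
    ultimately show ?thesis
      unfolding h_def by (intro exI[of _ u]) auto
  qed
qed

end

theorem theorem5p2:
  fixes A :: "'h::complex_hilbert_space op set"
    and \<phi> :: "'h op \<Rightarrow> complex"
    and E :: "'h op \<Rightarrow> 'h op"
    and X Y U V :: "'h op"
    and \<alpha> \<beta> :: real
  assumes "W_star_probability_space A \<phi>"
    and "X \<in> A" and "Y \<in> A"
    and "self_adjoint X" and "self_adjoint Y"
    and "positive_variable \<phi> X" and "positive_variable \<phi> Y"
    and "free_variables \<phi> X Y"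
    and "non_degenerate X" and "non_degenerate Y"
    and "U = op_inverse (op_sqrt (id_blinfun + X)) o\<^sub>L Y o\<^sub>L op_inverse (op_sqrt (id_blinfun + X))"
    and "V = op_sqrt (id_blinfun + U) o\<^sub>L X o\<^sub>L op_sqrt (id_blinfun + U)"
    and "conditional_expectation A \<phi> (generated_von_neumann_algebra {U}) E"
    and "\<alpha> > 0" and "\<beta> > 0"
    and "E V = op_scaleC (complex_of_real \<alpha>) id_blinfun"
    and "E (op_inverse V) = op_scaleC (complex_of_real \<beta>) id_blinfun"
  shows "\<alpha> * \<beta> > 1 \<and>
    (let \<gamma> = \<beta> / (\<alpha> * \<beta> - 1) in
      \<exists>a>0. (\<exists>\<mu>. is_free_Kummer (\<alpha> * \<gamma>) (a * \<gamma>) \<gamma> \<mu> \<and> has_distribution \<phi> X \<mu>) \<and>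
            has_distribution \<phi> Y (free_Poisson (1 / \<gamma>) (a * \<gamma>)))"
proof -
  interpret W_star_probability_space A \<phi> by fact
  obtain \<mu> where \<mu>: "has_distribution \<phi> X \<mu>" "measure_support \<mu> \<subseteq> {0<..}"
    using assms(6) by (auto simp: positive_variable_def)
  obtain \<nu> where \<nu>: "has_distribution \<phi> Y \<nu>" "measure_support \<nu> \<subseteq> {0<..}"
    using assms(7) by (auto simp: positive_variable_def)
  obtain e b where e: "0 < e" and bX: "bounded_distribution \<mu> e b"
    by (rule positive_distribution_bounded[OF \<mu>])
  obtain e' b' where e': "0 < e'" and bY: "bounded_distribution \<nu> e' b'"
    by (rule positive_distribution_bounded[OF \<nu>])
  interpret X: bounded_distribution \<mu> e b by (rule bX)
  interpret Y: bounded_distribution \<nu> e' b' by (rule bY)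
  have X_pos: "pos_op X" and Y_pos: "pos_op Y"
    unfolding pos_op_def
    using nonneg_of_distribution[OF assms(2,4) bX \<mu>(1)] nonneg_of_distribution[OF assms(3,5) bY \<nu>(1)] e e'
    by blast+
  have U_B: "U \<in> generated_von_neumann_algebra {U}"
    unfolding generated_von_neumann_algebra_def by (rule hull_inc) simp
  interpret conditional_expectation A \<phi> "generated_von_neumann_algebra {U}" E by fact
  interpret regression A \<phi> X Y "generated_von_neumann_algebra {U}" E U V \<alpha> \<beta>
    by (intro regression.intro free_pair.intro free_pair_axioms.intro regression_axioms.intro
        W_star_probability_space_axioms conditional_expectation_axioms)
      (use assms X_pos Y_pos U_B in \<open>simp_all add: op_scaleC_of_real\<close>)
  define m k where "m = tr X" and "k = tr X'"
  \<comment> \<open>The constants that remain when \<open>(1 - \<omega>) (1 + z) P\<close> is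
    eliminated between the two regression equations.\<close>
  define c g where "c = (1 + k) / \<beta> - (m + 1)" and "g = (\<alpha> * \<beta> - 1) / \<beta>"
  have m: "m = (\<integral>x. x \<partial>\<mu>)"
    using has_distribution_opoly[OF assms(2) bX \<mu>(1), of "[:0, 1:]"] by (simp add: m_def)
  define PX where "PX \<omega> = 1 + \<omega> * (\<integral>x. 1 / (x + (1 - \<omega>)) \<partial>\<mu>)" for \<omega>
  define PY where "PY u = (\<integral>x. 1 / (1 + u * x) \<partial>\<nu>)" for u
  define p where "p \<omega> = id_blinfun + \<omega> *\<^sub>R op_inverse ((1 - \<omega>) *\<^sub>R id_blinfun + X)" for \<omega>
  define q where "q u = op_inverse (id_blinfun - (- u) *\<^sub>R Y)" for u
  have tr_p: "tr (p \<omega>) = PX \<omega>" if \<omega>: "\<omega> < 0" for \<omega>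
  proof -
    have o: "opoly [:1 - \<omega>, 1:] X = (1 - \<omega>) *\<^sub>R id_blinfun + X"
      by simp
    have pos: "pos_op ((1 - \<omega>) *\<^sub>R id_blinfun + X)"
      using \<omega> by (intro pos_op_id_add pos_op_nonneg X_pos) simp
    have "tr (op_inverse (opoly [:1 - \<omega>, 1:] X)) = (\<integral>t. 1 / poly [:1 - \<omega>, 1:] t \<partial>\<mu>)"
      by (rule tr_op_inverse_opoly[OF assms(2,4) bX \<mu>(1)])
        (unfold o, rule pos_op_invertible[OF pos], use \<omega> e in auto)
    then have "tr (op_inverse ((1 - \<omega>) *\<^sub>R id_blinfun + X)) = (\<integral>x. 1 / (x + (1 - \<omega>)) \<partial>\<mu>)"
      unfolding o by (simp add: add.commute)
    moreover have "op_inverse ((1 - \<omega>) *\<^sub>R id_blinfun + X) \<in> A"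
      by (intro A_op_inverse pos_op_invertible pos A_intros assms)
    ultimately show ?thesis
      by (simp add: p_def PX_def tr_add tr_scaleR A_id A_scaleR)
  qed
  have tr_q: "tr (q u) = PY u" if u: "0 < u" for u
  proof -
    have o: "opoly [:1, u:] Y = id_blinfun - (- u) *\<^sub>R Y"
      by (simp add: comp_scaleR_right)
    have pos: "pos_op (id_blinfun - (- u) *\<^sub>R Y)"
      using pos_op_id_add[OF nonneg_scaleR[OF pos_op_nonneg[OF Y_pos], of u], of 1] u by simp
    have "tr (op_inverse (opoly [:1, u:] Y)) = (\<integral>t. 1 / poly [:1, u:] t \<partial>\<nu>)"
    proof (rule tr_op_inverse_opoly[OF assms(3,5) bY \<nu>(1)])
      show "invertible_op (opoly [:1, u:] Y)"
        unfolding o by (rule pos_op_invertible[OF pos])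
      show "poly [:1, u:] t \<noteq> 0" if "t \<in> {e'..b'}" for t
      proof -
        have "0 < t * u"
          using that u e' by simp
        then show ?thesis
          by simp
      qed
    qed
    then show ?thesis
      unfolding o by (simp add: q_def PY_def mult.commute)
  qed
  have PX_eq: "PX \<omega> = (\<integral>x. 1 / (1 + (- \<omega>) * (1 / (1 + x))) \<partial>\<mu>)" if \<omega>: "\<omega> < 0" for \<omega>
  proof -
    have int: "integrable \<mu> (\<lambda>x. 1 / (x + (1 - \<omega>)))"
      using \<omega> e by (intro X.integrable_continuous continuous_intros) auto
    have "PX \<omega> = (\<integral>x. 1 \<partial>\<mu>) + (\<integral>x. \<omega> * (1 / (x + (1 - \<omega>))) \<partial>\<mu>)"
      using X.prob_space by (simp only: PX_def integral_mult_right_zero) simp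
    also have "\<dots> = (\<integral>x. 1 + \<omega> * (1 / (x + (1 - \<omega>))) \<partial>\<mu>)"
      by (intro Bochner_Integration.integral_add[symmetric] integrable_mult_right int) simp
    also have "\<dots> = (\<integral>x. 1 / (1 + (- \<omega>) * (1 / (1 + x))) \<partial>\<mu>)"
    proof (rule X.integral_cong_on)
      fix x assume "x \<in> {e..b}"
      then have x: "1 + x > 0" "x + (1 - \<omega>) > 0"
        using e \<omega> by auto
      have "1 + (- \<omega>) * (1 / (1 + x)) = (x + (1 - \<omega>)) / (1 + x)"
        using x(1) by (simp add: field_simps)
      moreover have "1 + \<omega> * (1 / (x + (1 - \<omega>))) = (1 + x) / (x + (1 - \<omega>))"
        using x(2) by (simp add: field_simps)
      ultimately show "1 + \<omega> * (1 / (x + (1 - \<omega>))) = 1 / (1 + (- \<omega>) * (1 / (1 + x)))"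
        by simp
    qed measurable
    finally show ?thesis .
  qed
  have kX: "1 / (1 + b) \<le> 1 / (1 + x) \<and> 1 / (1 + x) \<le> 1 / (1 + e)" if "x \<in> {e..b}" for x
    using that e by (auto intro!: divide_left_mono)
  have kb: "0 < 1 / (1 + b)"
    using e X.range_nonempty by simp
  have kY: "e' \<le> x \<and> x \<le> b'" if "x \<in> {e'..b'}" for x
    using that by simp
  have mX: "(\<lambda>x :: real. 1 / (1 + x)) \<in> borel_measurable borel"
    and mY: "(\<lambda>x :: real. x) \<in> borel_measurable borel"
    by measurable
  have main: "1 - P = u * P * (c + g * P)"
    "g * P\<^sup>2 * (1 - \<omega>) + P * (\<alpha> * \<omega> + (c + \<omega>) * (1 - \<omega>) - g) - c - \<omega> * (m + 1) = 0"
    if \<omega>: "\<omega> < 0" and u: "0 < u" and P: "PX \<omega> = P" "PY u = P" for \<omega> u P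
  proof -
    obtain z where z: "z < 0" "z * (P - 1) = \<omega> * (- u) * P"
      "(1 + z) * (tr X + 1 + (\<omega> - 1) * P) - tr X = \<alpha> * z * P"
      "z * (tr X' + 1 - P) = \<beta> * (1 - \<omega>) * ((1 + z) * P - 1)"
      using regression_equations[OF \<omega>, of "- u", OF _ p_def q_def] u \<omega> P tr_p tr_q by (metis neg_less_0_iff_less)
    note z = z(1,2) z(3,4)[folded m_def k_def]
    have "\<beta> * c = (1 + k) - \<beta> * (m + 1)" "\<beta> * g = \<alpha> * \<beta> - 1"
      using assms(15) by (simp_all add: c_def g_def field_simps)
    \<comment> \<open>The second equation plus \<open>\<beta>\<close> times the first: the terms in
      \<open>(1 - \<omega>) (1 + z) P\<close> cancel.\<close>
    then have "\<beta> * \<omega> = \<beta> * (z * (c + g * P))"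
      using z(3,4) by algebra
    then have \<omega>z: "\<omega> = z * (c + g * P)"
      using assms(15) by simp
    have "z * (1 - P) = z * (u * P * (c + g * P))"
      using z(2) \<omega>z by algebra
    then show "1 - P = u * P * (c + g * P)"
      using z(1) by simp
    \<comment> \<open>The first equation multiplied by \<open>\<omega>\<close>, with this factor
      replaced by \<open>z (c + g P)\<close> in the terms that carry no \<open>z\<close>.\<close>
    have "z * (g * P\<^sup>2 * (1 - \<omega>) + P * (\<alpha> * \<omega> + (c + \<omega>) * (1 - \<omega>) - g) - c - \<omega> * (m + 1)) = 0"
      using z(3) \<omega>z by algebra
    then show "g * P\<^sup>2 * (1 - \<omega>) + P * (\<alpha> * \<omega> + (c + \<omega>) * (1 - \<omega>) - g) - c - \<omega> * (m + 1) = 0"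
      using z(1) by simp
  qed
  have eq_Y: "1 - (\<integral>x. 1 / (1 + u * x) \<partial>\<nu>)
      = u * (\<integral>x. 1 / (1 + u * x) \<partial>\<nu>) * (c + g * (\<integral>x. 1 / (1 + u * x) \<partial>\<nu>))" if u: "0 < u" for u
  proof -
    have P: "0 < PY u \<and> PY u < 1"
      unfolding PY_def by (rule Y.transform_surjective(1)[OF mY kY e' u])
    then obtain v where "0 < v" "(\<integral>x. 1 / (1 + v * (1 / (1 + x))) \<partial>\<mu>) = PY u"
      using X.transform_surjective(2)[OF mX kX kb, of "PY u"] by blast
    then have "PX (- v) = PY u"
      using PX_eq[of "- v"] by simp
    from main(1)[OF _ u this refl] \<open>0 < v\<close> show ?thesis
      by (simp add: PY_def)
  qed
  have eq_X: "g * P\<^sup>2 * (1 - \<omega>) + P * (\<alpha> * \<omega> + (c + \<omega>) * (1 - \<omega>) - g) - c - \<omega> * ((\<integral>x. x \<partial>\<mu>) + 1) = 0"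
    if \<omega>: "\<omega> < 0" and P: "P = 1 + \<omega> * (\<integral>x. 1 / (x + (1 - \<omega>)) \<partial>\<mu>)" for \<omega> P
  proof -
    have P: "PX \<omega> = P"
      using P by (simp add: PX_def)
    have "0 < PX \<omega> \<and> PX \<omega> < 1"
      unfolding PX_eq[OF \<omega>] using X.transform_surjective(1)[OF mX kX kb, of "- \<omega>"] \<omega> by simp
    then obtain u where "0 < u" "PY u = P"
      using Y.transform_surjective(2)[OF mY kY e', of P] P unfolding PY_def by blast
    from main(2)[OF \<omega> this(1) P this(2)] show ?thesis
      by (simp only: m)
  qed
  \<comment> \<open>Equality would make \<open>Y\<close> equal to its mean by faithfulness, against
    non-degeneracy.\<close>
  have var: "(\<integral>x. x \<partial>\<nu>)\<^sup>2 < (\<integral>x. x\<^sup>2 \<partial>\<nu>)"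
  proof -
    define M where "M = (\<integral>x. x \<partial>\<nu>)"
    define T where "T = Y - M *\<^sub>R id_blinfun"
    have T: "T \<in> A" "self_adjoint T"
      unfolding T_def by (intro A_diff A_scaleR A_id assms self_adjoint_diff self_adjoint_scaleR self_adjoint_id)+
    have tY: "tr Y = M"
      using has_distribution_opoly[OF assms(3) bY \<nu>(1), of "[:0, 1:]"] by (simp add: M_def)
    have tYY: "tr (Y \<circ>\<^sub>L Y) = (\<integral>x. x\<^sup>2 \<partial>\<nu>)"
      using has_distribution_opoly[OF assms(3) bY \<nu>(1), of "[:0, 0, 1:]"] by (simp add: power2_eq_square)
    have "tr (T \<circ>\<^sub>L T) = (\<integral>x. x\<^sup>2 \<partial>\<nu>) - M\<^sup>2"
      unfolding T_def tYY[symmetric]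
      by (simp add: comp_ring tr_diff tr_scaleR A_comp A_scaleR A_diff A_id assms tY)
        (simp add: power2_eq_square algebra_simps)
    moreover have "tr (T \<circ>\<^sub>L T) \<noteq> 0"
    proof
      assume "tr (T \<circ>\<^sub>L T) = 0"
      then have "T = 0"
        by (rule tr_faithful_square[OF T])
      then have "Y = op_scaleC (complex_of_real M) id_blinfun"
        by (simp add: T_def op_scaleC_of_real)
      then show False
        using assms(10) by (auto simp: non_degenerate_def)
    qed
    moreover have "0 \<le> tr (T \<circ>\<^sub>L T)"
      by (intro tr_nonneg A_comp nonneg_square T)
    ultimately show ?thesis
      by (simp add: M_def)
  qed
  have g: "0 < g" and c: "0 < c"
    using free_Poisson_parameters[OF bY e' eq_Y var] by auto
  have ab: "1 < \<alpha> * \<beta>"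
    using g assms(15) by (simp add: g_def zero_less_divide_iff)
  have "\<alpha> - g = 1 / \<beta>"
    using assms(15) by (simp add: g_def field_simps)
  then have \<alpha>g: "g < \<alpha>"
    using assms(15) by (metis diff_gt_0_iff_gt zero_less_divide_1_iff)
  interpret kummer_equation \<mu> e b c g \<alpha>
    by unfold_locales (use e c g \<alpha>g eq_X in auto)
  \<comment> \<open>The \<open>a\<close> of the theorem is \<open>c + g\<close>, the mean of
    \<open>Y\<close>; then \<open>a * \<gamma> = (c + g) / g\<close> is both the rate of the free
    Poisson law and the second Kummer parameter.\<close>
  have \<gamma>: "\<beta> / (\<alpha> * \<beta> - 1) = 1 / g"
    by (simp add: g_def)
  have "\<exists>\<mu>. is_free_Kummer (\<alpha> * (1 / g)) ((c + g) * (1 / g)) (1 / g) \<mu> \<and> has_distribution \<phi> X \<mu>"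
    using has_distribution_free_Kummer[OF \<mu>(1)] by simp
  moreover have "has_distribution \<phi> Y (free_Poisson (1 / (1 / g)) ((c + g) * (1 / g)))"
    using has_distribution_free_Poisson[OF \<nu>(1) bY e' eq_Y g c] by simp
  moreover have "0 < c + g"
    using c g by simp
  ultimately show ?thesis
    unfolding Let_def \<gamma> using ab by blast
qed

end
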